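(* Under assumptions (i)–(vi) of the context, let $f\in\mathscr{D}(\mathcal{Z})$ be given. Then $f(t)\in\mathscr{D}(\mathbf{B}(t))$ for almost every $t\ge 0$ and $$\left[\widehat{\mathfrak{B}}f\right](t)=\mathbf{B}(t)f(t)\qquad\text{for almost every }t\ge 0.$$ In other words, $\widehat{\mathfrak{B}}f=\mathfrak{B}f$ for any $f\in\mathscr{D}(\mathcal{Z})$, i.e. $\mathscr{D}(\mathcal{Z})\subset\mathscr{D}(\mathfrak{B})$ and $\mathfrak{B}|_{\mathscr{D}(\mathcal{Z})}=\widehat{\mathfrak{B}}$.
   Context: $\mathcal{E}$ is a real ordered Banach space with (closed) positive cone $\mathcal{E}_+$ that is generating, $\mathcal{E}=\mathcal{E}_+-\mathcal{E}_+$, and on which the norm is additive: $\|u+v\|=\|u\|+\|v\|$ for $u,v\in\mathcal{E}_+$. An evolution family in $\mathcal{E}$ is a family $(\mathbf{U}(t,s))_{t\ge s\ge 0}$ of bounded linear operators on $\mathcal{E}$ such that (a) for each $u\in\mathcal{E}$ the map $(t,s)\mapsto\mathbf{U}(t,s)u$ is continuous on $t\ge s\ge 0$; (b) $\mathbf{U}(t,s)=\mathbf{U}(t,r)\mathbf{U}(r,s)$ and $\mathbf{U}(t,t)=\mathbf{I}$ for $t\ge r\ge s$; (c) $\|\mathbf{U}(t,s)\|\le Ce^{\beta(t-s)}$ for $t\ge s$, for some constants $C,\beta>0$. Assumptions: $(\mathbf{U}(t,s))_{t\ge s\ge0}$ is a given evolution family in $\mathcal{E}$ and $(\mathbf{B}(t))_{t\ge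 0}$ is a family of (possibly unbounded) linear operators $\mathbf{B}(t):\mathscr{D}(\mathbf{B}(t))\subset\mathcal{E}\to\mathcal{E}$ such that: (i) $\mathbf{U}(t,s)u\in\mathcal{E}_+$ for $u\in\mathcal{E}_+$, $t\ge s\ge 0$; (ii) $\|\mathbf{U}(t,s)u\|_{\mathcal{E}}\le\|u\|_{\mathcal{E}}$ for $u\in\mathcal{E}_+$, $t\ge s\ge 0$; (iii) $\mathbf{B}(t)u\in\mathcal{E}_+$ for $u\in\mathscr{D}(\mathbf{B}(t))\cap\mathcal{E}_+$, $t\ge 0$; (iv) for any $u\in\mathcal{E}$ and $s\ge 0$, $\mathbf{U}(t,s)u\in\mathscr{D}(\mathbf{B}(t))$ for a.e. $t\ge s$ and the mapping $t\in[s,\infty)\mapsto\mathbf{B}(t)\mathbf{U}(t,s)u$ is measurable; moreover, for any $t\ge s\ge 0$ and $u\in\mathcal{E}_+$, $\int_s^t\|\mathbf{B}(\tau)\mathbf{U}(\tau,s)u\|_{\mathcal{E}}\,\mathrm{d}\tau\le\|u\|_{\mathcal{E}}-\|\mathbf{U}(t,s)u\|_{\mathcal{E}}$; (v) with $\Delta=\{(t,s):0\le s\le t<\infty\}$ and $\mathfrak{X}=L^1(\mathbb{R}_+,\mathcal{E})$, for any $f\in\mathfrak{X}$ the mapping $(t,s)\in\Delta\mapsto\mathbf{B}(t)\mathbf{U}(t,s)f(s)\in\mathcal{E}$ is well-defined for almost every $(t,s)\in\Delta$ and is measurable; (vi) for any $t\ge0$, $\mathbf{B}(t)$ is "increasingly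 closed": if $(u_n)_n\subset\mathscr{D}(\mathbf{B}(t))\cap\mathcal{E}_+$ is increasing with $\lim_nu_n=u\in\mathcal{E}_+$ and $\sup_n\|\mathbf{B}(t)u_n\|_{\mathcal{E}}<\infty$, then $u\in\mathscr{D}(\mathbf{B}(t))$ and $\lim_n\mathbf{B}(t)u_n=\mathbf{B}(t)u$. Set $\mathbf{V}_0(t,s)=\mathbf{U}(t,s)$, $\mathbf{V}_{n+1}(t,s)u=\int_s^t\mathbf{V}_n(t,r)\mathbf{B}(r)\mathbf{U}(r,s)u\,\mathrm{d}r$, and $\mathbf{V}(t,s)u=\sum_{n=0}^\infty\mathbf{V}_n(t,s)u$ for $t\ge s\ge 0$, $u\in\mathcal{E}$; $(\mathbf{V}(t,s))_{t\ge s\ge 0}$ is then an evolution family with $\|\mathbf{V}(t,s)u\|\le\|u\|$ for $u\in\mathcal{E}_+$. $\mathfrak{X}$ carries the norm $\|f\|_{\mathfrak{X}}=\int_0^\infty\|f(s)\|_{\mathcal{E}}\,\mathrm{d}s$. $(\mathcal{T}_0(t))_{t\ge0}$ is the $C_0$-semigroup on $\mathfrak{X}$ given by $[\mathcal{T}_0(t)f](s)=\mathbf{U}(s,s-t)f(s-t)$ if $s\ge t$ and $0$ if $0\le s<t$; its generator is $(\mathcal{Z},\mathscr{D}(\mathcal{Z}))$. $(\mathcal{T}(t))_{t\ge0}$ is the $C_0$-semigroup on $\mathfrak{X}$ given by $[\mathcal{T}(t)f](s)=\mathbf{V}(s,s-t)f(s-t)$ if $s\ge t$ and $0$ if $0\le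 s<t$; its generator is $(\mathcal{G},\mathscr{D}(\mathcal{G}))$. One has $\mathscr{D}(\mathcal{Z})\subset\mathscr{D}(\mathcal{G})$, and $\widehat{\mathfrak{B}}$ is the operator with domain $\mathscr{D}(\mathcal{Z})$ defined by $\widehat{\mathfrak{B}}f=\mathcal{G}f-\mathcal{Z}f$. $\mathfrak{B}$ is the multiplication operator in $\mathfrak{X}$: $\mathfrak{B}f=\mathbf{B}(\cdot)f(\cdot)$ with domain $\mathscr{D}(\mathfrak{B})=\{f\in\mathfrak{X}: f(s)\in\mathscr{D}(\mathbf{B}(s))\text{ for a.e. }s>0,\ \mathbf{B}(\cdot)f(\cdot)\in\mathfrak{X}\}$. *)

theory Defs
  imports "HOL-Analysis.Analysis"
begin

text \<open>
  The library's Bochner integral is confined to second countable spaces. The Banach spaces below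
  need not be separable, so strong measurability and the Bochner integral are set up here for an
  arbitrary normed space; the integral follows the library's construction, with strong measurability
  in place of Borel measurability.
\<close>

definition strongly_measurable :: "'m measure \<Rightarrow> ('m \<Rightarrow> 'a::real_normed_vector) \<Rightarrow> bool" where
  "strongly_measurable M f \<longleftrightarrow>
     (\<exists>\<sigma>. (\<forall>i::nat. simple_function M (\<sigma> i)) \<and> (AE x in M. (\<lambda>i. \<sigma> i x) \<longlonglongrightarrow> f x))"

definition has_strong_integral ::
    "'m measure \<Rightarrow> ('m \<Rightarrow> 'a) \<Rightarrow> 'a::real_normed_vector \<Rightarrow> bool" where
  "has_strong_integral M f v \<longleftrightarrow>
     strongly_measurable M f \<and>
     (\<exists>\<sigma>. (\<forall>i::nat. Bochner_Integration.simple_bochner_integrable M (\<sigma> i)) \<and>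
          (\<lambda>i. \<integral>\<^sup>+x. ennreal (norm (f x - \<sigma> i x)) \<partial>M) \<longlonglongrightarrow> 0 \<and>
          (\<lambda>i. Bochner_Integration.simple_bochner_integral M (\<sigma> i)) \<longlonglongrightarrow> v)"

definition strong_integral :: "'m measure \<Rightarrow> ('m \<Rightarrow> 'a) \<Rightarrow> 'a::real_normed_vector" where
  "strong_integral M f = (THE v. has_strong_integral M f v)"


definition Delta :: "(real \<times> real) set" where
  "Delta = {(t, s). 0 \<le> s \<and> s \<le> t}"

definition evolution_family :: "(real \<Rightarrow> real \<Rightarrow> 'a \<Rightarrow> 'a::real_normed_vector) \<Rightarrow> bool" where
  "evolution_family U \<longleftrightarrow>
     (\<forall>t s. 0 \<le> s \<and> s \<le> t \<longrightarrow> bounded_linear (U t s)) \<and>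
     (\<forall>u. continuous_on Delta (\<lambda>(t, s). U t s u)) \<and>
     (\<forall>t r s. 0 \<le> s \<and> s \<le> r \<and> r \<le> t \<longrightarrow> U t s = U t r \<circ> U r s) \<and>
     (\<forall>t\<ge>0. U t t = id) \<and>
     (\<exists>C>0. \<exists>\<beta>>0. \<forall>t s. 0 \<le> s \<and> s \<le> t \<longrightarrow> onorm (U t s) \<le> C * exp (\<beta> * (t - s)))"

text \<open>
  A partially defined operator is a total function together with its domain; the values outside the
  domain are irrelevant.
\<close>

definition linear_on_domain :: "'a::real_vector set \<Rightarrow> ('a \<Rightarrow> 'a) \<Rightarrow> bool" where
  "linear_on_domain D A \<longleftrightarrow>
     subspace D \<and>
     (\<forall>u\<in>D. \<forall>v\<in>D. A (u + v) = A u + A v) \<and>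
     (\<forall>u\<in>D. \<forall>c. A (c *\<^sub>R u) = c *\<^sub>R A u)"

definition increasingly_closed ::
    "'a::{real_normed_vector, ordered_real_vector} set \<Rightarrow> ('a \<Rightarrow> 'a) \<Rightarrow> bool" where
  "increasingly_closed D A \<longleftrightarrow>
     (\<forall>u v. (\<forall>n. u n \<in> D \<and> 0 \<le> u n) \<and> incseq u \<and> u \<longlonglongrightarrow> v \<and> 0 \<le> v \<and>
            bdd_above (range (\<lambda>n. norm (A (u n))))
        \<longrightarrow> v \<in> D \<and> (\<lambda>n. A (u n)) \<longlonglongrightarrow> A v)"

primrec Dyson_term ::
    "(real \<Rightarrow> real \<Rightarrow> 'a \<Rightarrow> 'a) \<Rightarrow> (real \<Rightarrow> 'a \<Rightarrow> 'a) \<Rightarrow> nat \<Rightarrow>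
     real \<Rightarrow> real \<Rightarrow> 'a \<Rightarrow> 'a::real_normed_vector" where
  "Dyson_term U B 0 = U"
| "Dyson_term U B (Suc n) =
     (\<lambda>t s u. strong_integral (lebesgue_on {s..t}) (\<lambda>r. Dyson_term U B n t r (B r (U r s u))))"

definition Dyson_series ::
    "(real \<Rightarrow> real \<Rightarrow> 'a \<Rightarrow> 'a) \<Rightarrow> (real \<Rightarrow> 'a \<Rightarrow> 'a) \<Rightarrow>
     real \<Rightarrow> real \<Rightarrow> 'a \<Rightarrow> 'a::real_normed_vector" where
  "Dyson_series U B t s u = (\<Sum>n. Dyson_term U B n t s u)"


text \<open>
  The space \<open>L\<^sup>1(\<real>\<^sub>+, \<E>)\<close> is represented by its functions, two of which are identified when they
  agree almost everywhere on \<open>{0..}\<close>; values at negative arguments play no role.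
\<close>

definition L1_norm :: "(real \<Rightarrow> 'a::real_normed_vector) \<Rightarrow> ennreal" where
  "L1_norm f = (\<integral>\<^sup>+s. ennreal (norm (f s)) \<partial>lebesgue_on {0..})"

definition L1 :: "(real \<Rightarrow> 'a::real_normed_vector) set" where
  "L1 = {f. strongly_measurable (lebesgue_on {0..}) f \<and> L1_norm f < \<infinity>}"

definition L1_eq ::
    "(real \<Rightarrow> 'a::real_normed_vector) \<Rightarrow> (real \<Rightarrow> 'a) \<Rightarrow> bool" where
  "L1_eq f g \<longleftrightarrow> (AE s in lebesgue_on {0..}. f s = g s)"

definition evolution_semigroup ::
    "(real \<Rightarrow> real \<Rightarrow> 'a \<Rightarrow> 'a) \<Rightarrow> real \<Rightarrow>
     (real \<Rightarrow> 'a) \<Rightarrow> real \<Rightarrow> 'a::real_normed_vector" where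
  "evolution_semigroup W t f = (\<lambda>s. if t \<le> s then W s (s - t) (f (s - t)) else 0)"

definition is_generator_value ::
    "(real \<Rightarrow> (real \<Rightarrow> 'a) \<Rightarrow> real \<Rightarrow> 'a::real_normed_vector) \<Rightarrow>
     (real \<Rightarrow> 'a) \<Rightarrow> (real \<Rightarrow> 'a) \<Rightarrow> bool" where
  "is_generator_value T f g \<longleftrightarrow>
     f \<in> L1 \<and> g \<in> L1 \<and>
     ((\<lambda>h. L1_norm (\<lambda>s. (T h f s - f s) /\<^sub>R h - g s)) \<longlongrightarrow> 0) (at_right 0)"

definition generator_domain ::
    "(real \<Rightarrow> (real \<Rightarrow> 'a) \<Rightarrow> real \<Rightarrow> 'a::real_normed_vector) \<Rightarrow>
     (real \<Rightarrow> 'a) set" where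
  "generator_domain T = {f. \<exists>g. is_generator_value T f g}"

text \<open>
  On the domain the choice is unique up to almost everywhere equality; off the domain the value is
  unspecified.
\<close>

definition generator ::
    "(real \<Rightarrow> (real \<Rightarrow> 'a) \<Rightarrow> real \<Rightarrow> 'a::real_normed_vector) \<Rightarrow>
     (real \<Rightarrow> 'a) \<Rightarrow> real \<Rightarrow> 'a" where
  "generator T f = (SOME g. is_generator_value T f g)"

abbreviation Z_domain ::
    "(real \<Rightarrow> real \<Rightarrow> 'a \<Rightarrow> 'a::real_normed_vector) \<Rightarrow> (real \<Rightarrow> 'a) set" where
  "Z_domain U \<equiv> generator_domain (evolution_semigroup U)"

text \<open>
  The operator \<open>\<G> - \<Z>\<close>, to be considered on \<open>Z_domain U\<close> only. It is meaningful there because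
  the domain of \<open>\<Z>\<close> is contained in that of \<open>\<G>\<close>, a consequence of the assumptions on \<open>U\<close> and \<open>B\<close>
  that is not built into the definition.
\<close>

definition B_hat ::
    "(real \<Rightarrow> real \<Rightarrow> 'a \<Rightarrow> 'a) \<Rightarrow> (real \<Rightarrow> 'a \<Rightarrow> 'a) \<Rightarrow>
     (real \<Rightarrow> 'a) \<Rightarrow> real \<Rightarrow> 'a::real_normed_vector" where
  "B_hat U B f = (\<lambda>s. generator (evolution_semigroup (Dyson_series U B)) f s
                      - generator (evolution_semigroup U) f s)"

definition mult_op :: "(real \<Rightarrow> 'a \<Rightarrow> 'a) \<Rightarrow> (real \<Rightarrow> 'a) \<Rightarrow> real \<Rightarrow> 'a" where
  "mult_op B f = (\<lambda>s. B s (f s))"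

definition mult_domain ::
    "(real \<Rightarrow> 'a set) \<Rightarrow> (real \<Rightarrow> 'a \<Rightarrow> 'a::real_normed_vector) \<Rightarrow> (real \<Rightarrow> 'a) set" where
  "mult_domain D B =
     {f \<in> L1. (AE s in lebesgue_on {0<..}. f s \<in> D s) \<and> mult_op B f \<in> L1}"

end

theory Submission
  imports Defs
begin

text \<open>
  By definition \<open>B_hat U B f\<close> is the difference of the values at \<open>f\<close> of two generators, hence the
  limit in \<open>L\<^sup>1\<close>, as \<open>h\<close> tends to 0 from the right, of \<open>(\<T>(h) f - \<T>\<^sub>0(h) f) / h\<close>, where \<open>\<T>\<^sub>0\<close> and \<open>\<T>\<close> are the
  evolution semigroups of \<open>U\<close> and of its Dyson series. So for \<open>f\<close> in the domain of \<open>\<Z>\<close> it has to be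
  shown that \<open>f(s)\<close> lies in \<open>D s\<close> for almost every \<open>s\<close>, that \<open>\<beta>(s) = B s (f s)\<close> is integrable, and
  that these quotients converge to \<open>\<beta>\<close>.

  Reduction to potentials of positive functions. Let \<open>E(t,s) = exp(s-t) U(t,s)\<close> and \<open>g = f - \<Z> f\<close>.
  Then \<open>f(s)\<close> is the integral of \<open>E(s,r) g(r)\<close> over \<open>0 \<le> r \<le> s\<close> (\<open>generator_mild\<close>, \<open>eq_mild_diff\<close>): the
  difference of the two is annihilated by the generator of the evolution semigroup of \<open>E\<close>, hence is
  left fixed by that semigroup, whose operator at time \<open>t\<close> yields functions that vanish on \<open>[0,t)\<close>.
  A closed generating cone admits decompositions \<open>u = v - w\<close> with norms bounded by a multiple of the
  norm of \<open>u\<close> (a Baire category argument, \<open>cone_decomposition\<close>), and therefore \<open>g\<close> is the difference of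
  two positive integrable functions. Since all the claims are linear in \<open>f\<close>, it may be assumed that
  \<open>g \<ge> 0\<close>.

  Applying \<open>B\<close> to a potential. If \<open>g \<ge> 0\<close>, the delayed values \<open>f\<^sub>d(x) = E(x,x-d) f(x-d)\<close> increase to
  \<open>f(x)\<close> as \<open>d\<close> decreases to 0, and for almost every \<open>d\<close> they lie in \<open>D x\<close> for almost every \<open>x\<close>.
  Integrating the assumed bound on \<open>B(t) U(t,s) u\<close> with \<open>u = f(s)\<close> over \<open>s\<close>, one finds that the mean over
  \<open>0 \<le> d \<le> h\<close> of the \<open>L\<^sup>1\<close> norm of \<open>x \<mapsto> B(x) f\<^sub>d(x)\<close> is at most \<open>(\<parallel>f\<parallel> - \<parallel>f\<^sub>h\<parallel>) / h\<close>, which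
  is at most \<open>\<parallel>g\<parallel> + o(1)\<close> because \<open>(f - f\<^sub>h) / h\<close> tends to \<open>g\<close>. As the norm is additive, hence monotone,
  on the cone, the \<open>L\<^sup>1\<close> norm of \<open>x \<mapsto> B(x) f\<^sub>d(x)\<close> decreases in \<open>d\<close>, so it is bounded for small \<open>d\<close>
  (\<open>B_lag_norm_bounded\<close>). Monotone convergence bounds the increasing family \<open>B(x) f\<^sub>d(x)\<close> for almost every \<open>x\<close>,
  and the increasing closedness of \<open>B(x)\<close> gives \<open>f(x) \<in> D x\<close> and convergence to \<open>\<beta>(x)\<close>
  (\<open>B_lag_limit\<close>); by domination the convergence also holds in \<open>L\<^sup>1\<close> (\<open>B_lag_tendsto_B_pot\<close>).

  The quotient. For \<open>u \<ge> 0\<close> induction on the number of terms gives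
  \<open>\<Sum>n\<ge>1. \<parallel>V\<^sub>n(t,s) u\<parallel> \<le> \<integral> \<parallel>B(r) U(r,s) u\<parallel> dr\<close>, the integral being over \<open>s \<le> r \<le> t\<close>. Hence the terms with
  \<open>n \<ge> 2\<close> together cost at most the difference between that integral and \<open>\<parallel>V\<^sub>1(t,s) u\<parallel>\<close>
  (\<open>Dyson_tail_le\<close>). For \<open>u = f(s)\<close> and \<open>t = s + h\<close>, the integral and \<open>\<parallel>V\<^sub>1(t,s) u\<parallel>\<close>, divided by \<open>h\<close>, are
  both close to \<open>\<parallel>\<beta>(t)\<parallel>\<close> in the mean, so the higher terms disappear in the limit, while \<open>V\<^sub>1(t,s) u / h\<close>
  tends to \<open>\<beta>(t)\<close>: only the first Dyson term contributes (\<open>Dyson_increment_estimate\<close>,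
  \<open>slope_error_tendsto_0\<close>).
\<close>

abbreviation (input) nint :: "'m measure \<Rightarrow> ('m \<Rightarrow> 'a::real_normed_vector) \<Rightarrow> ennreal" where
  "nint M f \<equiv> \<integral>\<^sup>+x. ennreal (norm (f x)) \<partial>M"

section \<open>Strong measurability\<close>

lemma complete_measure_restrict_space:
  assumes "complete_measure M" "S \<in> sets M"
  shows "complete_measure (restrict_space M S)"
proof
  fix A B assume "B \<subseteq> A" "A \<in> null_sets (restrict_space M S)"
  then show "B \<in> sets (restrict_space M S)"
    using complete_measure.complete[OF assms(1), of B A] assms(2)
    by (auto simp: null_sets_restrict_space sets_restrict_space_iff)
qed

lemma (in complete_measure) borel_measurable_cong_AE:
  assumes "f \<in> borel_measurable M" "AE x in M. f x = g x"
  shows "g \<in> borel_measurable M"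
proof (rule measurableI)
  fix A :: "'b set" assume A: "A \<in> sets borel"
  have "AE x in M. x \<in> f -` A \<inter> space M \<longleftrightarrow> x \<in> g -` A \<inter> space M"
    using assms(2) by eventually_elim auto
  then show "g -` A \<inter> space M \<in> sets M"
    by (rule in_sets_AE) (use A assms(1) in auto)
qed auto

lemma (in complete_measure) strongly_measurable_dist:
  assumes "strongly_measurable M f"
  shows "(\<lambda>x. dist (f x) c) \<in> borel_measurable M"
proof -
  obtain \<sigma> where \<sigma>: "\<And>i::nat. simple_function M (\<sigma> i)" "AE x in M. (\<lambda>i. \<sigma> i x) \<longlonglongrightarrow> f x"
    using assms unfolding strongly_measurable_def by blast
  have "(\<lambda>x. lim (\<lambda>i. dist (\<sigma> i x) c)) \<in> borel_measurable M"
    by (intro borel_measurable_lim_metric borel_measurable_simple_function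
        simple_function_compose1[OF \<sigma>(1)])
  moreover have "AE x in M. lim (\<lambda>i. dist (\<sigma> i x) c) = dist (f x) c"
    using \<sigma>(2) by eventually_elim (intro limI tendsto_intros)
  ultimately show ?thesis
    by (rule borel_measurable_cong_AE)
qed

lemma (in complete_measure) strongly_measurable_norm:
  assumes "strongly_measurable M f"
  shows "(\<lambda>x. norm (f x)) \<in> borel_measurable M"
  using strongly_measurable_dist[OF assms, of 0] by simp

text \<open>
  One half of Pettis' criterion: the simple approximants take countably many values altogether.
\<close>

lemma strongly_measurable_separable_range:
  assumes "strongly_measurable M f"
  obtains C where "countable C" "AE x in M. f x \<in> closure C"
proof -
  obtain \<sigma> where \<sigma>: "\<And>i::nat. simple_function M (\<sigma> i)" "AE x in M. (\<lambda>i. \<sigma> i x) \<longlonglongrightarrow> f x"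
    using assms unfolding strongly_measurable_def by blast
  show ?thesis
  proof
    show "countable (\<Union>i. \<sigma> i ` space M)"
      using \<sigma>(1) by (auto simp: simple_function_def countable_finite)
    show "AE x in M. f x \<in> closure (\<Union>i. \<sigma> i ` space M)"
      using \<sigma>(2) AE_space
      by eventually_elim (auto simp: closure_sequential intro!: exI[of _ "\<lambda>i. \<sigma> i _"])
  qed
qed

text \<open>
  The other half of Pettis' criterion, with distances to points in place of functionals: at stage \<open>n\<close>
  the approximant takes the nearest among the first \<open>n + 1\<close> points of a sequence that is dense in the
  essential range. The criterion turns closure properties of strong measurability into closure
  properties of real measurability.
\<close>

lemma strongly_measurableI_dist:
  fixes f :: "'m \<Rightarrow> 'a::real_normed_vector"
  assumes C: "countable C" "AE x in M. f x \<in> closure C"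
    and dist: "\<And>c. (\<lambda>x. dist (f x) c) \<in> borel_measurable M"
  shows "strongly_measurable M f"
proof -
  have "\<exists>d::nat \<Rightarrow> 'a. C \<subseteq> range d"
    using C(1) by (metis countableE range_from_nat_into subset_UNIV order_refl empty_subsetI)
  then obtain d :: "nat \<Rightarrow> 'a" where d: "C \<subseteq> range d" by blast
  \<comment> \<open>the least index is chosen so that \<open>k n\<close> is measurable\<close>
  define k where "k n x = (LEAST k. k \<le> n \<and> (\<forall>j\<le>n. dist (f x) (d k) \<le> dist (f x) (d j)))" for n x
  have k: "k n x \<le> n \<and> (\<forall>j\<le>n. dist (f x) (d (k n x)) \<le> dist (f x) (d j))" for n x
  proof -
    have "\<exists>k\<in>{..n}. \<forall>j\<in>{..n}. dist (f x) (d k) \<le> dist (f x) (d j)"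
      using ex_min_if_finite[of "(\<lambda>j. dist (f x) (d j)) ` {..n}"]
      by (auto simp: not_less)
    then show ?thesis unfolding k_def by (rule_tac LeastI_ex) auto
  qed
  have [measurable]: "(\<lambda>x. dist (f x) (d j)) \<in> borel_measurable M" for j
    by (rule dist)
  have k_meas [measurable]: "k n \<in> measurable M (count_space UNIV)" for n
    unfolding k_def by measurable
  have "simple_function M (\<lambda>x. d (k n x))" for n
  proof (rule simple_function_compose1[where g = d])
    have "finite (k n ` space M)"
      by (rule finite_subset[of _ "{..n}"]) (use k in auto)
    moreover have "k n -` {j} \<inter> space M \<in> sets M" for j
      using measurable_sets[OF k_meas, of "{j}"] by auto
    ultimately show "simple_function M (k n)"
      by (simp add: simple_function_def)
  qed
  moreover have "AE x in M. (\<lambda>n. d (k n x)) \<longlonglongrightarrow> f x"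
    using C(2)
  proof eventually_elim
    case (elim x)
    show ?case
    proof (rule metric_LIMSEQ_I)
      fix e :: real assume "0 < e"
      then obtain j where j: "dist (d j) (f x) < e"
        using elim d unfolding closure_approachable by blast
      show "\<exists>no. \<forall>n\<ge>no. dist (d (k n x)) (f x) < e"
        using k j by (intro exI[of _ j]) (metis dist_commute le_less_trans)
    qed
  qed
  ultimately show ?thesis
    unfolding strongly_measurable_def by (intro exI[of _ "\<lambda>n x. d (k n x)"]) auto
qed

text \<open>
  Both conditions of the criterion pass to pointwise limits, so that no diagonal sequence of simple
  functions has to be extracted.
\<close>

lemma (in complete_measure) strongly_measurable_LIMSEQ:
  assumes f: "\<And>n::nat. strongly_measurable M (f n)" and lim: "AE x in M. (\<lambda>n. f n x) \<longlonglongrightarrow> g x"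
  shows "strongly_measurable M g"
proof -
  have "\<exists>C. countable C \<and> (AE x in M. f n x \<in> closure C)" for n
    using strongly_measurable_separable_range[OF f] by metis
  then obtain C where C: "\<And>n. countable (C n)" "\<And>n. AE x in M. f n x \<in> closure (C n)"
    by metis
  show ?thesis
  proof (rule strongly_measurableI_dist)
    show "countable (\<Union>n. C n)" using C by auto
    have "AE x in M. \<forall>n. f n x \<in> closure (C n)"
      using C(2) by (simp add: AE_all_countable)
    then show "AE x in M. g x \<in> closure (\<Union>n. C n)"
      using lim
    proof eventually_elim
      case (elim x)
      have "f n x \<in> closure (\<Union>n. C n)" for n
        using elim(1) closure_mono[of "C n" "\<Union>n. C n"] by blast
      then show ?case
        using closed_sequentially[OF closed_closure _ elim(2)] by blast
    qed
    fix c
    have "(\<lambda>x. lim (\<lambda>i. dist (f i x) c)) \<in> borel_measurable M"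
      by (intro borel_measurable_lim_metric strongly_measurable_dist f)
    moreover have "AE x in M. lim (\<lambda>i. dist (f i x) c) = dist (g x) c"
      using lim by eventually_elim (intro limI tendsto_intros)
    ultimately show "(\<lambda>x. dist (g x) c) \<in> borel_measurable M"
      by (rule borel_measurable_cong_AE)
  qed
qed

lemma strongly_measurable_simple: "simple_function M f \<Longrightarrow> strongly_measurable M f"
  unfolding strongly_measurable_def by (intro exI[of _ "\<lambda>_. f"]) auto

lemma strongly_measurable_cong_AE:
  assumes "strongly_measurable M f" "AE x in M. f x = g x"
  shows "strongly_measurable M g"
proof -
  obtain \<sigma> where "\<And>i::nat. simple_function M (\<sigma> i)" "AE x in M. (\<lambda>i. \<sigma> i x) \<longlonglongrightarrow> f x"
    using assms(1) unfolding strongly_measurable_def by blast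
  moreover from this(2) assms(2) have "AE x in M. (\<lambda>i. \<sigma> i x) \<longlonglongrightarrow> g x"
    by eventually_elim simp
  ultimately show ?thesis unfolding strongly_measurable_def by blast
qed

lemma strongly_measurable_compose2:
  assumes f: "strongly_measurable M f" and g: "strongly_measurable M g"
    and h: "\<And>x y. isCont (\<lambda>z. h (fst z) (snd z)) (x, y)"
  shows "strongly_measurable M (\<lambda>x. h (f x) (g x))"
proof -
  obtain \<sigma> \<tau> where \<sigma>: "\<And>i::nat. simple_function M (\<sigma> i)" "AE x in M. (\<lambda>i. \<sigma> i x) \<longlonglongrightarrow> f x"
    and \<tau>: "\<And>i::nat. simple_function M (\<tau> i)" "AE x in M. (\<lambda>i. \<tau> i x) \<longlonglongrightarrow> g x"
    using f g unfolding strongly_measurable_def by blast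
  have "AE x in M. (\<lambda>i. h (\<sigma> i x) (\<tau> i x)) \<longlonglongrightarrow> h (f x) (g x)"
    using \<sigma>(2) \<tau>(2)
  proof eventually_elim
    case (elim x)
    show ?case
      using isCont_tendsto_compose[OF h tendsto_Pair[OF elim]] by simp
  qed
  then show ?thesis
    unfolding strongly_measurable_def
    by (intro exI[of _ "\<lambda>i x. h (\<sigma> i x) (\<tau> i x)"]) (auto intro: simple_function_compose2 \<sigma> \<tau>)
qed

lemma strongly_measurable_add:
  "strongly_measurable M f \<Longrightarrow> strongly_measurable M g \<Longrightarrow> strongly_measurable M (\<lambda>x. f x + g x)"
  by (erule strongly_measurable_compose2) (auto intro!: continuous_intros)

lemma strongly_measurable_diff:
  "strongly_measurable M f \<Longrightarrow> strongly_measurable M g \<Longrightarrow> strongly_measurable M (\<lambda>x. f x - g x)"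
  by (erule strongly_measurable_compose2) (auto intro!: continuous_intros)

lemma strongly_measurable_scaleR:
  fixes c :: "'m \<Rightarrow> real"
  assumes f: "strongly_measurable M f" and c: "c \<in> borel_measurable M"
  shows "strongly_measurable M (\<lambda>x. c x *\<^sub>R f x)"
proof -
  obtain \<sigma> where \<sigma>: "\<And>i::nat. simple_function M (\<sigma> i)" "\<And>x. x \<in> space M \<Longrightarrow> (\<lambda>i. \<sigma> i x) \<longlonglongrightarrow> c x"
    using borel_measurable_implies_sequence_metric[OF c, of 0] by blast
  then have "strongly_measurable M c"
    unfolding strongly_measurable_def by blast
  from strongly_measurable_compose2[OF this f, of "\<lambda>c v. c *\<^sub>R v"] show ?thesis
    by (auto intro!: continuous_intros)
qed

lemma strongly_measurable_const: "strongly_measurable M (\<lambda>_. c)"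
  by (rule strongly_measurable_simple) simp

lemma strongly_measurable_sum:
  "(\<And>i. i \<in> I \<Longrightarrow> strongly_measurable M (f i)) \<Longrightarrow> strongly_measurable M (\<lambda>x. \<Sum>i\<in>I. f i x)"
  by (induction I rule: infinite_finite_induct)
    (auto intro: strongly_measurable_const strongly_measurable_add)

lemma strongly_measurable_restrict_space_iff:
  assumes S: "S \<in> sets M"
  shows "strongly_measurable (restrict_space M S) f \<longleftrightarrow> strongly_measurable M (\<lambda>x. indicator S x *\<^sub>R f x)"
    (is "?L \<longleftrightarrow> ?R")
proof -
  have S': "S \<inter> space M \<in> sets M" using S by (metis sets.Int_space_eq2)
  have sim: "simple_function (restrict_space M S) \<sigma> \<longleftrightarrow> simple_function M (\<lambda>x. indicator S x *\<^sub>R \<sigma> x)"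
    for \<sigma> :: "'a \<Rightarrow> 'b"
    by (rule simple_function_restrict_space[OF S'])
  show ?thesis
  proof
    assume ?L
    then obtain \<sigma> where \<sigma>: "\<And>i::nat. simple_function (restrict_space M S) (\<sigma> i)"
      "AE x in restrict_space M S. (\<lambda>i. \<sigma> i x) \<longlonglongrightarrow> f x"
      unfolding strongly_measurable_def by blast
    have "AE x in M. x \<in> S \<longrightarrow> (\<lambda>i. \<sigma> i x) \<longlonglongrightarrow> f x"
      using \<sigma>(2) by (simp add: AE_restrict_space_iff S')
    then have "AE x in M. (\<lambda>i. indicator S x *\<^sub>R \<sigma> i x) \<longlonglongrightarrow> indicator S x *\<^sub>R f x"
      by eventually_elim (auto simp: indicator_def)
    then show ?R
      unfolding strongly_measurable_def using \<sigma>(1)[unfolded sim]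
      by (intro exI[of _ "\<lambda>i x. indicator S x *\<^sub>R \<sigma> i x"]) auto
  next
    assume ?R
    then obtain \<sigma> where \<sigma>: "\<And>i::nat. simple_function M (\<sigma> i)"
      "AE x in M. (\<lambda>i. \<sigma> i x) \<longlonglongrightarrow> indicator S x *\<^sub>R f x"
      unfolding strongly_measurable_def by blast
    have "simple_function (restrict_space M S) (\<sigma> i)" for i
      unfolding sim by (rule simple_function_compose2[OF simple_function_indicator[OF S] \<sigma>(1)])
    moreover have "AE x in restrict_space M S. (\<lambda>i. \<sigma> i x) \<longlonglongrightarrow> f x"
      unfolding AE_restrict_space_iff[OF S'] using \<sigma>(2) by eventually_elim auto
    ultimately show ?L
      unfolding strongly_measurable_def by blast
  qed
qed

section \<open>The strong integral\<close>

abbreviation (input) "sb_integrable \<equiv> Bochner_Integration.simple_bochner_integrable"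
abbreviation (input) "sb_integral \<equiv> Bochner_Integration.simple_bochner_integral"

definition strongly_integrable :: "'m measure \<Rightarrow> ('m \<Rightarrow> 'a::real_normed_vector) \<Rightarrow> bool" where
  "strongly_integrable M f \<longleftrightarrow>
     strongly_measurable M f \<and> nint M f < \<infinity>"

lemma norm_simple_bochner_integral_le_nn_integral:
  assumes "sb_integrable M s"
  shows "ennreal (norm (sb_integral M s)) \<le> nint M s"
proof -
  have "sb_integrable M (\<lambda>x. norm (s x))"
    using simple_bochner_integrable_compose2[of "\<lambda>x y. norm x" M s s] assms by simp
  then show ?thesis
    using simple_bochner_integral_norm_bound[OF assms]
      simple_bochner_integral_eq_nn_integral[of M "\<lambda>x. norm (s x)"]
    by (metis ennreal_leI norm_ge_zero)
qed

lemma strongly_measurable_simple_bochner: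
  "sb_integrable M s \<Longrightarrow> strongly_measurable M s"
  by (auto intro: strongly_measurable_simple elim: simple_bochner_integrable.cases)

lemma ennreal_norm_triangle: "ennreal (norm (a + b)) \<le> ennreal (norm a) + ennreal (norm b)"
  by (metis ennreal_leI ennreal_plus norm_ge_zero norm_triangle_ineq)

context complete_measure
begin

lemma nn_integral_norm_add_le:
  assumes "strongly_measurable M f" "strongly_measurable M g"
  shows "(nint M (\<lambda>x. f x + g x))
    \<le> nint M f + nint M g"
proof -
  have "(nint M (\<lambda>x. f x + g x))
      \<le> (\<integral>\<^sup>+x. ennreal (norm (f x)) + ennreal (norm (g x)) \<partial>M)"
    by (intro nn_integral_mono ennreal_norm_triangle)
  also have "\<dots> = nint M f + nint M g"
    using assms[THEN strongly_measurable_norm] by (intro nn_integral_add) auto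
  finally show ?thesis .
qed

text \<open>
  Since linear combinations of integrals are integrals, this bound applied to \<open>f - f = 0\<close> also yields
  the uniqueness of the integral.
\<close>

lemma has_strong_integral_norm_le:
  assumes "has_strong_integral M f v"
  shows "ennreal (norm v) \<le> nint M f"
proof -
  obtain \<sigma> where f: "strongly_measurable M f" and \<sigma>: "\<And>i::nat. sb_integrable M (\<sigma> i)"
    and lim: "(\<lambda>i. nint M (\<lambda>x. f x - \<sigma> i x)) \<longlonglongrightarrow> 0"
    and v: "(\<lambda>i. sb_integral M (\<sigma> i)) \<longlonglongrightarrow> v"
    using assms unfolding has_strong_integral_def by blast
  let ?I = "nint M f"
  have "ennreal (norm (sb_integral M (\<sigma> i))) \<le> ?I + (nint M (\<lambda>x. f x - \<sigma> i x))" for i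
  proof -
    have "(nint M (\<lambda>x. f x - (f x - \<sigma> i x)))
      \<le> ?I + (nint M (\<lambda>x. - (f x - \<sigma> i x)))"
      unfolding diff_conv_add_uminus[of "f _" "f _ - _"]
      using strongly_measurable_diff[OF strongly_measurable_simple_bochner[OF \<sigma>] f]
      by (intro nn_integral_norm_add_le f) simp
    then show ?thesis
      using norm_simple_bochner_integral_le_nn_integral[OF \<sigma>, of i]
      by (simp add: norm_minus_commute[of "\<sigma> i _"])
  qed
  moreover have "(\<lambda>i. ennreal (norm (sb_integral M (\<sigma> i)))) \<longlonglongrightarrow> ennreal (norm v)"
    by (intro tendsto_ennrealI tendsto_norm v)
  moreover have "(\<lambda>i. ?I + (nint M (\<lambda>x. f x - \<sigma> i x))) \<longlonglongrightarrow> ?I + 0"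
    by (intro tendsto_add tendsto_const lim)
  ultimately show ?thesis
    by (metis (no_types, lifting) LIMSEQ_le add_0_right)
qed

lemma has_strong_integral_lincomb:
  assumes f: "has_strong_integral M f v" and g: "has_strong_integral M g w"
  shows "has_strong_integral M (\<lambda>x. a *\<^sub>R f x + b *\<^sub>R g x) (a *\<^sub>R v + b *\<^sub>R w)"
proof -
  obtain \<sigma> where fm: "strongly_measurable M f" and \<sigma>: "\<And>i::nat. sb_integrable M (\<sigma> i)"
    and \<sigma>1: "(\<lambda>i. nint M (\<lambda>x. f x - \<sigma> i x)) \<longlonglongrightarrow> 0"
    and \<sigma>2: "(\<lambda>i. sb_integral M (\<sigma> i)) \<longlonglongrightarrow> v"
    using f unfolding has_strong_integral_def by blast
  obtain \<tau> where gm: "strongly_measurable M g" and \<tau>: "\<And>i::nat. sb_integrable M (\<tau> i)"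
    and \<tau>1: "(\<lambda>i. nint M (\<lambda>x. g x - \<tau> i x)) \<longlonglongrightarrow> 0"
    and \<tau>2: "(\<lambda>i. sb_integral M (\<tau> i)) \<longlonglongrightarrow> w"
    using g unfolding has_strong_integral_def by blast
  have a\<sigma>: "sb_integrable M (\<lambda>x. a *\<^sub>R \<sigma> i x)" and b\<tau>: "sb_integrable M (\<lambda>x. b *\<^sub>R \<tau> i x)" for i
    using simple_bochner_integrable_compose2[of "\<lambda>x y. a *\<^sub>R x" M "\<sigma> i" "\<sigma> i"]
      simple_bochner_integrable_compose2[of "\<lambda>x y. b *\<^sub>R x" M "\<tau> i" "\<tau> i"] \<sigma> \<tau> by simp_all
  have lin: "linear (\<lambda>x. c *\<^sub>R x)" for c :: real
    by (simp add: linear_iff scaleR_right_distrib)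
  have I: "sb_integral M (\<lambda>x. a *\<^sub>R \<sigma> i x + b *\<^sub>R \<tau> i x)
      = a *\<^sub>R sb_integral M (\<sigma> i) + b *\<^sub>R sb_integral M (\<tau> i)" for i
    by (simp add: simple_bochner_integral_add[OF a\<sigma> b\<tau>]
        simple_bochner_integral_linear[OF lin \<sigma>] simple_bochner_integral_linear[OF lin \<tau>])
  have ms: "strongly_measurable M (\<lambda>x. f x - \<sigma> i x)" "strongly_measurable M (\<lambda>x. g x - \<tau> i x)" for i
    by (intro strongly_measurable_diff fm gm strongly_measurable_simple_bochner \<sigma> \<tau>)+
  have B: "(nint M (\<lambda>x. a *\<^sub>R f x + b *\<^sub>R g x - (a *\<^sub>R \<sigma> i x + b *\<^sub>R \<tau> i x)))
    \<le> ennreal \<bar>a\<bar> * (nint M (\<lambda>x. f x - \<sigma> i x))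
      + ennreal \<bar>b\<bar> * (nint M (\<lambda>x. g x - \<tau> i x))" for i
  proof -
    have "(nint M (\<lambda>x. a *\<^sub>R f x + b *\<^sub>R g x - (a *\<^sub>R \<sigma> i x + b *\<^sub>R \<tau> i x)))
      = (nint M (\<lambda>x. a *\<^sub>R (f x - \<sigma> i x) + b *\<^sub>R (g x - \<tau> i x)))"
      by (simp add: algebra_simps)
    also have "\<dots> \<le> (nint M (\<lambda>x. a *\<^sub>R (f x - \<sigma> i x)))
        + (nint M (\<lambda>x. b *\<^sub>R (g x - \<tau> i x)))"
      by (intro nn_integral_norm_add_le strongly_measurable_scaleR ms) auto
    also have "\<dots> = ennreal \<bar>a\<bar> * (nint M (\<lambda>x. f x - \<sigma> i x))
      + ennreal \<bar>b\<bar> * (nint M (\<lambda>x. g x - \<tau> i x))"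
      using ms[THEN strongly_measurable_norm]
      by (simp add: ennreal_mult nn_integral_cmult)
    finally show ?thesis .
  qed
  have lim0: "(\<lambda>i. ennreal \<bar>a\<bar> * (nint M (\<lambda>x. f x - \<sigma> i x))
      + ennreal \<bar>b\<bar> * (nint M (\<lambda>x. g x - \<tau> i x))) \<longlonglongrightarrow> ennreal \<bar>a\<bar> * 0 + ennreal \<bar>b\<bar> * 0"
    by (intro tendsto_add ennreal_tendsto_cmult \<sigma>1 \<tau>1) auto
  have lim: "(\<lambda>i. nint M (\<lambda>x. a *\<^sub>R f x + b *\<^sub>R g x - (a *\<^sub>R \<sigma> i x + b *\<^sub>R \<tau> i x))) \<longlonglongrightarrow> 0"
    by (rule tendsto_sandwich[OF _ _ tendsto_const[of 0]]) (use lim0 B in auto)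
  have "strongly_measurable M (\<lambda>x. a *\<^sub>R f x + b *\<^sub>R g x)"
    by (intro strongly_measurable_add strongly_measurable_scaleR fm gm) auto
  moreover have "sb_integrable M (\<lambda>x. a *\<^sub>R \<sigma> i x + b *\<^sub>R \<tau> i x)" for i
    using simple_bochner_integrable_compose2[of "\<lambda>x y. a *\<^sub>R x + b *\<^sub>R y" M "\<sigma> i" "\<tau> i"] \<sigma> \<tau> by simp
  moreover have "(\<lambda>i. sb_integral M (\<lambda>x. a *\<^sub>R \<sigma> i x + b *\<^sub>R \<tau> i x)) \<longlonglongrightarrow> a *\<^sub>R v + b *\<^sub>R w"
    unfolding I by (intro tendsto_intros \<sigma>2 \<tau>2)
  ultimately show ?thesis
    unfolding has_strong_integral_def
    using lim by (intro conjI exI[of _ "\<lambda>i x. a *\<^sub>R \<sigma> i x + b *\<^sub>R \<tau> i x"]) auto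
qed

lemma has_strong_integral_unique:
  assumes "has_strong_integral M f v" "has_strong_integral M f w"
  shows "v = w"
  using has_strong_integral_norm_le[OF has_strong_integral_lincomb[OF assms, of 1 "-1"]] by simp

lemma strong_integral_eq: "has_strong_integral M f v \<Longrightarrow> strong_integral M f = v"
  unfolding strong_integral_def using has_strong_integral_unique by blast

text \<open>
  Pointwise convergence of simple functions says nothing about their integrals. An approximant is
  therefore set to 0 wherever its norm exceeds twice that of \<open>f\<close>, which keeps the pointwise limit
  and gives the majorant \<open>3 * norm (f x)\<close> for the error. Dominated convergence and completeness of the
  space of values do the rest.
\<close>

lemma has_strong_integral_exists:
  fixes f :: "'a \<Rightarrow> 'b::banach"
  assumes "strongly_integrable M f"
  shows "\<exists>v. has_strong_integral M f v"
proof -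
  have f: "strongly_measurable M f" and fin: "nint M f < \<infinity>"
    using assms by (auto simp: strongly_integrable_def)
  obtain \<sigma> where \<sigma>: "\<And>i::nat. simple_function M (\<sigma> i)" "AE x in M. (\<lambda>i. \<sigma> i x) \<longlonglongrightarrow> f x"
    using f unfolding strongly_measurable_def by blast
  have [measurable]: "(\<lambda>x. norm (f x)) \<in> borel_measurable M"
    by (rule strongly_measurable_norm[OF f])
  have [measurable]: "(\<lambda>x. norm (\<sigma> i x)) \<in> borel_measurable M" for i
    by (intro borel_measurable_simple_function simple_function_compose1[OF \<sigma>(1)])
  define \<tau> where "\<tau> i x = indicator {x\<in>space M. norm (\<sigma> i x) \<le> 2 * norm (f x)} x *\<^sub>R \<sigma> i x" for i x
  have \<tau>_simple: "simple_function M (\<tau> i)" for i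
    unfolding \<tau>_def by (intro simple_function_compose2[OF simple_function_indicator \<sigma>(1)]) measurable
  have \<tau>_le: "norm (\<tau> i x) \<le> 2 * norm (f x)" for i x
    by (simp add: \<tau>_def indicator_def)
  have \<tau>_int: "sb_integrable M (\<tau> i)" for i
  proof (rule simple_bochner_integrableI_bounded[OF \<tau>_simple])
    have "(nint M (\<lambda>x. \<tau> i x)) \<le> (\<integral>\<^sup>+x. 2 * ennreal (norm (f x)) \<partial>M)"
      using ennreal_leI[OF \<tau>_le] by (intro nn_integral_mono) (simp add: ennreal_mult)
    also have "\<dots> < \<infinity>"
      using fin by (simp add: nn_integral_cmult ennreal_mult_less_top)
    finally show "(nint M (\<lambda>x. \<tau> i x)) < \<infinity>" .
  qed
  have \<tau>_lim: "AE x in M. (\<lambda>i. \<tau> i x) \<longlonglongrightarrow> f x"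
    using \<sigma>(2) AE_space
  proof eventually_elim
    case (elim x)
    show ?case
    proof (cases "f x = 0")
      case True
      then have "\<tau> i x = 0" for i using \<tau>_le[of i x] by simp
      then show ?thesis using True by simp
    next
      case False
      have "(\<lambda>i. norm (\<sigma> i x)) \<longlonglongrightarrow> norm (f x)"
        by (intro tendsto_norm elim)
      then have "\<forall>\<^sub>F i in sequentially. norm (\<sigma> i x) < 2 * norm (f x)"
        using False by (intro order_tendstoD) auto
      then have "\<forall>\<^sub>F i in sequentially. \<sigma> i x = \<tau> i x"
        by eventually_elim (use elim in \<open>auto simp: \<tau>_def\<close>)
      with elim(1) show ?thesis by (rule Lim_transform_eventually)
    qed
  qed
  have dm: "(\<lambda>x. norm (f x - \<tau> i x)) \<in> borel_measurable M" for i
    by (intro strongly_measurable_norm strongly_measurable_diff f strongly_measurable_simple \<tau>_simple)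
  have "(\<lambda>i. nint M (\<lambda>x. f x - \<tau> i x)) \<longlonglongrightarrow> (\<integral>\<^sup>+x. 0 \<partial>M)"
  proof (rule nn_integral_dominated_convergence[where w = "\<lambda>x. 3 * ennreal (norm (f x))"])
    show "AE x in M. ennreal (norm (f x - \<tau> j x)) \<le> 3 * ennreal (norm (f x))" for j
    proof (rule AE_I2)
      fix x
      have "norm (f x - \<tau> j x) \<le> 3 * norm (f x)"
        using \<tau>_le[of j x] norm_triangle_ineq4[of "f x" "\<tau> j x"] by simp
      then show "ennreal (norm (f x - \<tau> j x)) \<le> 3 * ennreal (norm (f x))"
        using ennreal_leI by (fastforce simp: ennreal_mult)
    qed
    show "(\<integral>\<^sup>+x. 3 * ennreal (norm (f x)) \<partial>M) < \<infinity>"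
      using fin by (simp add: nn_integral_cmult ennreal_mult_less_top)
    show "AE x in M. (\<lambda>i. ennreal (norm (f x - \<tau> i x))) \<longlonglongrightarrow> 0"
      using \<tau>_lim
    proof eventually_elim
      case (elim x)
      then have "(\<lambda>i. norm (f x - \<tau> i x)) \<longlonglongrightarrow> norm (f x - f x)"
        by (intro tendsto_intros)
      then show ?case by (simp add: ennreal_tendsto_0_iff)
    qed
  qed (use dm in measurable)
  then have lim0: "(\<lambda>i. nint M (\<lambda>x. f x - \<tau> i x)) \<longlonglongrightarrow> 0" by simp
  have bnd: "ennreal (norm (sb_integral M (\<tau> i) - sb_integral M (\<tau> j)))
      \<le> (nint M (\<lambda>x. f x - \<tau> i x)) + (nint M (\<lambda>x. f x - \<tau> j x))" for i j
  proof -
    have d: "sb_integrable M (\<lambda>x. \<tau> i x - \<tau> j x)"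
      using simple_bochner_integrable_compose2[of "(-)" M "\<tau> i" "\<tau> j"] \<tau>_int by simp
    have "ennreal (norm (sb_integral M (\<tau> i) - sb_integral M (\<tau> j)))
        \<le> (nint M (\<lambda>x. \<tau> i x - \<tau> j x))"
      using norm_simple_bochner_integral_le_nn_integral[OF d]
      by (simp add: simple_bochner_integral_diff[OF \<tau>_int \<tau>_int])
    also have "\<dots> = (nint M (\<lambda>x. (\<tau> i x - f x) + (f x - \<tau> j x)))" by simp
    also have "\<dots> \<le> (nint M (\<lambda>x. \<tau> i x - f x)) + (nint M (\<lambda>x. f x - \<tau> j x))"
      by (intro nn_integral_norm_add_le strongly_measurable_diff f strongly_measurable_simple \<tau>_simple)
    finally show ?thesis by (simp add: norm_minus_commute)
  qed
  have "Cauchy (\<lambda>i. sb_integral M (\<tau> i))"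
  proof (rule metric_CauchyI)
    fix e :: real assume e: "0 < e"
    have "\<forall>\<^sub>F i in sequentially. (nint M (\<lambda>x. f x - \<tau> i x)) < ennreal (e / 2)"
      using lim0 e by (intro order_tendstoD) auto
    then obtain N where N: "\<And>i. i \<ge> N \<Longrightarrow> (nint M (\<lambda>x. f x - \<tau> i x)) < ennreal (e / 2)"
      by (auto simp: eventually_sequentially)
    show "\<exists>N. \<forall>i\<ge>N. \<forall>j\<ge>N. dist (sb_integral M (\<tau> i)) (sb_integral M (\<tau> j)) < e"
    proof (intro exI[of _ N] allI impI)
      fix i j assume "N \<le> i" "N \<le> j"
      from add_strict_mono[OF N[OF this(1)] N[OF this(2)]]
      have "ennreal (norm (sb_integral M (\<tau> i) - sb_integral M (\<tau> j))) < ennreal (e / 2) + ennreal (e / 2)"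
        by (rule le_less_trans[OF bnd])
      also have "\<dots> = ennreal e" using e by (simp flip: ennreal_plus)
      finally show "dist (sb_integral M (\<tau> i)) (sb_integral M (\<tau> j)) < e"
        using e by (simp add: dist_norm ennreal_less_iff)
    qed
  qed
  then obtain v where "(\<lambda>i. sb_integral M (\<tau> i)) \<longlonglongrightarrow> v"
    using Cauchy_convergent_iff convergent_def by blast
  then show ?thesis
    unfolding has_strong_integral_def using f \<tau>_int lim0 by blast
qed

lemma has_strong_integral_strong_integral:
  fixes f :: "'a \<Rightarrow> 'b::banach"
  assumes "strongly_integrable M f"
  shows "has_strong_integral M f (strong_integral M f)"
  using has_strong_integral_exists[OF assms] strong_integral_eq by metis

lemma has_strong_integral_cong_AE:
  assumes "has_strong_integral M f v" "AE x in M. f x = g x"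
  shows "has_strong_integral M g v"
proof -
  have "(nint M (\<lambda>x. f x - s x)) = (nint M (\<lambda>x. g x - s x))" for s
    using assms(2) by (intro nn_integral_cong_AE) auto
  then show ?thesis
    using assms strongly_measurable_cong_AE[OF _ assms(2)] unfolding has_strong_integral_def by simp
qed

lemma strong_integral_cong_AE:
  assumes "AE x in M. f x = g x"
  shows "strong_integral M f = strong_integral M g"
proof -
  have "AE x in M. g x = f x" using assms by auto
  then have "has_strong_integral M f = has_strong_integral M g"
    using has_strong_integral_cong_AE[OF _ assms] has_strong_integral_cong_AE by blast
  then show ?thesis by (simp add: strong_integral_def)
qed

lemma strongly_integrable_cong_AE:
  assumes "strongly_integrable M f" "AE x in M. f x = g x"
  shows "strongly_integrable M g"
proof -
  have "nint M f = nint M g"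
    using assms(2) by (intro nn_integral_cong_AE) auto
  then show ?thesis
    using assms strongly_measurable_cong_AE by (auto simp: strongly_integrable_def)
qed

lemma strongly_integrable_lincomb:
  assumes "strongly_integrable M f" "strongly_integrable M g"
  shows "strongly_integrable M (\<lambda>x. a *\<^sub>R f x + b *\<^sub>R g x)"
proof -
  have fm: "strongly_measurable M f" and gm: "strongly_measurable M g"
    using assms by (auto simp: strongly_integrable_def)
  have "(nint M (\<lambda>x. a *\<^sub>R f x + b *\<^sub>R g x))
    \<le> (nint M (\<lambda>x. a *\<^sub>R f x)) + (nint M (\<lambda>x. b *\<^sub>R g x))"
    by (intro nn_integral_norm_add_le strongly_measurable_scaleR fm gm) auto
  also have "\<dots> = ennreal \<bar>a\<bar> * nint M f
      + ennreal \<bar>b\<bar> * nint M g"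
    using strongly_measurable_norm[OF fm] strongly_measurable_norm[OF gm]
    by (simp add: ennreal_mult nn_integral_cmult)
  also have "\<dots> < \<infinity>"
    using assms by (auto simp: strongly_integrable_def ennreal_mult_less_top)
  finally show ?thesis
    by (auto simp: strongly_integrable_def intro!: strongly_measurable_add strongly_measurable_scaleR fm gm)
qed

lemma strong_integral_lincomb:
  fixes f g :: "'a \<Rightarrow> 'b::banach"
  assumes "strongly_integrable M f" "strongly_integrable M g"
  shows "strong_integral M (\<lambda>x. a *\<^sub>R f x + b *\<^sub>R g x) = a *\<^sub>R strong_integral M f + b *\<^sub>R strong_integral M g"
  using assms[THEN has_strong_integral_strong_integral]
  by (intro strong_integral_eq has_strong_integral_lincomb) auto

lemma norm_strong_integral_le:
  fixes f :: "'a \<Rightarrow> 'b::banach"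
  assumes "strongly_integrable M f"
  shows "ennreal (norm (strong_integral M f)) \<le> nint M f"
  by (rule has_strong_integral_norm_le[OF has_strong_integral_strong_integral[OF assms]])

lemma strongly_integrable_bounded_linear:
  assumes T: "bounded_linear T" and f: "strongly_integrable M f"
  shows "strongly_integrable M (\<lambda>x. T (f x))"
proof -
  interpret T: bounded_linear T by fact
  obtain K where K: "0 < K" "\<And>x. norm (T x) \<le> norm x * K" using T.pos_bounded by blast
  have fm: "strongly_measurable M f" using f by (simp add: strongly_integrable_def)
  have "(nint M (\<lambda>x. T (f x))) \<le> (\<integral>\<^sup>+x. ennreal (norm (f x)) * ennreal K \<partial>M)"
    using K by (intro nn_integral_mono) (simp flip: ennreal_mult'')
  also have "\<dots> < \<infinity>"
    using f strongly_measurable_norm[OF fm]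
    by (simp add: nn_integral_multc strongly_integrable_def ennreal_mult_less_top)
  finally show ?thesis
    using strongly_measurable_compose2[OF fm fm, of "\<lambda>x y. T x"]
    by (auto simp: strongly_integrable_def T.isCont)
qed

lemma strong_integral_bounded_linear:
  fixes f :: "'a \<Rightarrow> 'b::banach" and T :: "'b \<Rightarrow> 'c::banach"
  assumes T: "bounded_linear T" and f: "strongly_integrable M f"
  shows "strong_integral M (\<lambda>x. T (f x)) = T (strong_integral M f)"
proof (rule strong_integral_eq)
  interpret T: bounded_linear T by fact
  obtain K where K: "0 < K" "\<And>x. norm (T x) \<le> norm x * K" using T.pos_bounded by blast
  obtain \<sigma> where fm: "strongly_measurable M f" and \<sigma>: "\<And>i::nat. sb_integrable M (\<sigma> i)"
    and \<sigma>1: "(\<lambda>i. nint M (\<lambda>x. f x - \<sigma> i x)) \<longlonglongrightarrow> 0"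
    and \<sigma>2: "(\<lambda>i. sb_integral M (\<sigma> i)) \<longlonglongrightarrow> strong_integral M f"
    using has_strong_integral_strong_integral[OF f] unfolding has_strong_integral_def by blast
  have B: "(nint M (\<lambda>x. T (f x) - T (\<sigma> i x)))
      \<le> ennreal K * (nint M (\<lambda>x. f x - \<sigma> i x))" for i
  proof -
    have "(nint M (\<lambda>x. T (f x) - T (\<sigma> i x)))
      \<le> (\<integral>\<^sup>+x. ennreal K * ennreal (norm (f x - \<sigma> i x)) \<partial>M)"
      using K by (intro nn_integral_mono) (simp add: mult.commute flip: ennreal_mult'' T.diff)
    also have "\<dots> = ennreal K * (nint M (\<lambda>x. f x - \<sigma> i x))"
      using strongly_measurable_norm[OF strongly_measurable_diff[OF fm strongly_measurable_simple_bochner[OF \<sigma>]]]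
      by (intro nn_integral_cmult) auto
    finally show ?thesis .
  qed
  have lim0: "(\<lambda>i. ennreal K * (nint M (\<lambda>x. f x - \<sigma> i x))) \<longlonglongrightarrow> ennreal K * 0"
    by (intro ennreal_tendsto_cmult \<sigma>1) auto
  have "(\<lambda>i. nint M (\<lambda>x. T (f x) - T (\<sigma> i x))) \<longlonglongrightarrow> 0"
    by (rule tendsto_sandwich[OF _ _ tendsto_const[of 0]]) (use lim0 B in auto)
  moreover have "sb_integrable M (\<lambda>x. T (\<sigma> i x))" for i
    using simple_bochner_integrable_compose2[of "\<lambda>x y. T x" M "\<sigma> i" "\<sigma> i"] \<sigma> by (simp add: T.zero)
  moreover have "(\<lambda>i. sb_integral M (\<lambda>x. T (\<sigma> i x))) \<longlonglongrightarrow> T (strong_integral M f)"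
    unfolding simple_bochner_integral_linear[OF T.linear_axioms \<sigma>] by (intro T.tendsto \<sigma>2)
  ultimately show "has_strong_integral M (\<lambda>x. T (f x)) (T (strong_integral M f))"
    using strongly_integrable_bounded_linear[OF T f]
    unfolding has_strong_integral_def strongly_integrable_def
    by (intro conjI exI[of _ "\<lambda>i x. T (\<sigma> i x)"]) auto
qed

section \<open>Integrals over subsets and values in a closed cone\<close>

lemma strongly_integrable_restrict_space_iff:
  assumes S: "S \<in> sets M"
  shows "strongly_integrable (restrict_space M S) f \<longleftrightarrow> strongly_integrable M (\<lambda>x. indicator S x *\<^sub>R f x)"
proof -
  have "(nint (restrict_space M S) f)
      = (nint M (\<lambda>x. indicator S x *\<^sub>R f x))"
    using S by (simp add: nn_integral_restrict_space) (intro nn_integral_cong, auto simp: indicator_def)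
  then show ?thesis
    unfolding strongly_integrable_def strongly_measurable_restrict_space_iff[OF S] by simp
qed

lemma strong_integral_restrict_space:
  fixes f :: "'a \<Rightarrow> 'b::banach"
  assumes S: "S \<in> sets M" and f: "strongly_integrable (restrict_space M S) f"
  shows "strong_integral (restrict_space M S) f = strong_integral M (\<lambda>x. indicator S x *\<^sub>R f x)"
proof -
  have S': "S \<inter> space M \<in> sets M" using S by (metis sets.Int_space_eq2)
  interpret R: complete_measure "restrict_space M S"
    by (rule complete_measure_restrict_space[OF complete_measure_axioms S])
  obtain \<sigma> where \<sigma>: "\<And>i::nat. sb_integrable (restrict_space M S) (\<sigma> i)"
    and \<sigma>1: "(\<lambda>i. nint (restrict_space M S) (\<lambda>x. f x - \<sigma> i x)) \<longlonglongrightarrow> 0"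
    and \<sigma>2: "(\<lambda>i. sb_integral (restrict_space M S) (\<sigma> i)) \<longlonglongrightarrow> strong_integral (restrict_space M S) f"
    using R.has_strong_integral_strong_integral[OF f] unfolding has_strong_integral_def by blast
  have "(nint (restrict_space M S) (\<lambda>x. f x - \<sigma> i x))
    = (nint M (\<lambda>x. indicator S x *\<^sub>R f x - indicator S x *\<^sub>R \<sigma> i x))" for i
    using S by (simp add: nn_integral_restrict_space) (intro nn_integral_cong, auto simp: indicator_def)
  with \<sigma>1 have "(\<lambda>i. nint M (\<lambda>x. indicator S x *\<^sub>R f x - indicator S x *\<^sub>R \<sigma> i x)) \<longlonglongrightarrow> 0"
    by simp
  moreover have "sb_integrable M (\<lambda>x. indicator S x *\<^sub>R \<sigma> i x)" for i
    using \<sigma> simple_bochner_integrable_restrict_space[OF S'] by blast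
  moreover have "(\<lambda>i. sb_integral M (\<lambda>x. indicator S x *\<^sub>R \<sigma> i x))
      \<longlonglongrightarrow> strong_integral (restrict_space M S) f"
    using \<sigma>2 by (simp add: simple_bochner_integral_restrict_space[OF S' \<sigma>])
  moreover have "strongly_measurable M (\<lambda>x. indicator S x *\<^sub>R f x)"
    using f strongly_measurable_restrict_space_iff[OF S, of f] by (simp add: strongly_integrable_def)
  ultimately have "has_strong_integral M (\<lambda>x. indicator S x *\<^sub>R f x) (strong_integral (restrict_space M S) f)"
    unfolding has_strong_integral_def
    by (intro conjI exI[of _ "\<lambda>i x. indicator S x *\<^sub>R \<sigma> i x"]) auto
  then show ?thesis by (simp add: strong_integral_eq)
qed

end

lemma complete_lebesgue_on: "S \<in> sets lebesgue \<Longrightarrow> complete_measure (lebesgue_on S)"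
  by (rule complete_measure_restrict_space[OF completion.complete_measure_axioms])

lemma strongly_measurable_lebesgue_on_subset:
  assumes "strongly_measurable (lebesgue_on S) f" "S \<in> sets lebesgue" "T \<in> sets lebesgue" "T \<subseteq> S"
  shows "strongly_measurable (lebesgue_on T) f"
proof -
  have "strongly_measurable lebesgue (\<lambda>x. indicator T x *\<^sub>R (indicator S x *\<^sub>R f x))"
    using assms(1-3) strongly_measurable_restrict_space_iff[OF assms(2), of f]
    by (intro strongly_measurable_scaleR[of lebesgue "\<lambda>x. indicator S x *\<^sub>R f x"]) auto
  also have "(\<lambda>x. indicator T x *\<^sub>R (indicator S x *\<^sub>R f x)) = (\<lambda>x. indicator T x *\<^sub>R f x)"
    using assms(4) by (intro ext) (auto simp: indicator_def)
  finally show ?thesis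
    using assms(3) by (simp add: strongly_measurable_restrict_space_iff)
qed

lemma nn_integral_lebesgue_on_mono_set:
  assumes "T \<subseteq> S" "S \<in> sets lebesgue" "T \<in> sets lebesgue"
  shows "(\<integral>\<^sup>+x. f x \<partial>lebesgue_on T) \<le> (\<integral>\<^sup>+x. f x \<partial>lebesgue_on S)"
proof -
  have "(\<integral>\<^sup>+x. f x * indicator T x \<partial>lebesgue) \<le> (\<integral>\<^sup>+x. f x * indicator S x \<partial>lebesgue)"
    using assms(1) by (intro nn_integral_mono) (auto simp: indicator_def)
  then show ?thesis
    using assms(2,3) by (simp add: nn_integral_restrict_space)
qed

lemma strongly_integrable_lebesgue_on_subset:
  assumes "strongly_integrable (lebesgue_on S) f" "S \<in> sets lebesgue" "T \<in> sets lebesgue" "T \<subseteq> S"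
  shows "strongly_integrable (lebesgue_on T) f"
proof -
  have "(nint (lebesgue_on T) f) < \<infinity>"
    using assms(1) by (intro le_less_trans[OF nn_integral_lebesgue_on_mono_set[OF assms(4,2,3)]])
      (simp add: strongly_integrable_def)
  moreover have "strongly_measurable (lebesgue_on T) f"
    using assms(1) by (intro strongly_measurable_lebesgue_on_subset[OF _ assms(2-4)])
      (simp add: strongly_integrable_def)
  ultimately show ?thesis by (simp add: strongly_integrable_def)
qed

lemma strong_integral_combine:
  fixes f :: "real \<Rightarrow> 'a::banach"
  assumes "a \<le> b" "b \<le> c" and f: "strongly_integrable (lebesgue_on {a..c}) f"
  shows "strong_integral (lebesgue_on {a..c}) f
    = strong_integral (lebesgue_on {a..b}) f + strong_integral (lebesgue_on {b..c}) f"
proof -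
  have f1: "strongly_integrable (lebesgue_on {a..b}) f" and f2: "strongly_integrable (lebesgue_on {b..c}) f"
    using assms by (auto intro: strongly_integrable_lebesgue_on_subset[OF f])
  have "AE x in lebesgue. x \<noteq> b"
    by (rule AE_completion) (rule AE_lborel_singleton)
  then have ae: "AE x in lebesgue. 1 *\<^sub>R (indicator {a..b} x *\<^sub>R f x) + 1 *\<^sub>R (indicator {b..c} x *\<^sub>R f x)
      = indicator {a..c} x *\<^sub>R f x"
    by eventually_elim (use assms in \<open>auto simp: indicator_def\<close>)
  have "strong_integral lebesgue (\<lambda>x. indicator {a..c} x *\<^sub>R f x)
    = strong_integral lebesgue (\<lambda>x. 1 *\<^sub>R (indicator {a..b} x *\<^sub>R f x) + 1 *\<^sub>R (indicator {b..c} x *\<^sub>R f x))"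
    by (rule completion.strong_integral_cong_AE[OF ae, symmetric])
  also have "\<dots> = 1 *\<^sub>R strong_integral lebesgue (\<lambda>x. indicator {a..b} x *\<^sub>R f x)
      + 1 *\<^sub>R strong_integral lebesgue (\<lambda>x. indicator {b..c} x *\<^sub>R f x)"
    using f1 f2 by (intro completion.strong_integral_lincomb)
      (simp_all add: completion.strongly_integrable_restrict_space_iff)
  finally show ?thesis
    using f f1 f2 by (simp add: completion.strong_integral_restrict_space)
qed

lemma infdist_cone_add_le:
  fixes a b :: "'a::real_normed_vector"
  assumes add: "\<And>u v. u \<in> K \<Longrightarrow> v \<in> K \<Longrightarrow> u + v \<in> K" and ne: "K \<noteq> {}"
  shows "infdist (a + b) K \<le> infdist a K + infdist b K"
proof (rule field_le_epsilon)
  fix e :: real assume e: "0 < e"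
  have ex: "\<exists>k\<in>K. dist x k < infdist x K + e / 2" for x
  proof -
    have "bdd_below (dist x ` K)" by (rule bdd_belowI[of _ 0]) auto
    then show ?thesis
      using cINF_less_iff[OF ne, of "dist x" "infdist x K + e / 2"] e ne by (simp add: infdist_notempty)
  qed
  obtain k l where k: "k \<in> K" "dist a k < infdist a K + e / 2" and l: "l \<in> K" "dist b l < infdist b K + e / 2"
    using ex by meson
  have "infdist (a + b) K \<le> dist (a + b) (k + l)"
    using k l add by (intro infdist_le) auto
  also have "\<dots> \<le> dist a k + dist b l" unfolding dist_norm using norm_triangle_ineq[of "a - k" "b - l"] by (simp add: algebra_simps)
  finally show "infdist (a + b) K \<le> infdist a K + infdist b K + e" using k l by simp
qed

lemma infdist_cone_scaleR_le:
  fixes a :: "'a::real_normed_vector"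
  assumes scale: "\<And>u. u \<in> K \<Longrightarrow> c *\<^sub>R u \<in> K" and ne: "K \<noteq> {}" and c: "0 \<le> c"
  shows "infdist (c *\<^sub>R a) K \<le> c * infdist a K"
proof (cases "c = 0")
  case True
  obtain k where "k \<in> K" using ne by blast
  from scale[OF this] True have "0 \<in> K" by simp
  then show ?thesis using True by simp
next
  case False
  then have c: "0 < c" using c by simp
  have "infdist (c *\<^sub>R a) K / c \<le> infdist a K"
    unfolding infdist_notempty[OF ne, of a]
  proof (rule cINF_greatest[OF ne])
    fix k assume "k \<in> K"
    then have "infdist (c *\<^sub>R a) K \<le> dist (c *\<^sub>R a) (c *\<^sub>R k)"
      by (rule infdist_le[OF scale])
    also have "\<dots> = c * dist a k"
      using c unfolding dist_norm by (simp flip: scaleR_right_diff_distrib)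
    finally show "infdist (c *\<^sub>R a) K / c \<le> dist a k"
      using c by (simp add: pos_divide_le_eq mult.commute)
  qed
  then show ?thesis using c by (simp add: pos_divide_le_eq mult.commute)
qed

text \<open>
  The distance to a convex cone is sublinear, so for a simple function the distance of the integral
  is at most the integral of the distances. As the distance is also 1-Lipschitz and vanishes along
  \<open>f\<close>, both sides tend to 0 along simple functions that approximate \<open>f\<close>.
\<close>

lemma (in complete_measure) strong_integral_in_closed_cone:
  fixes f :: "'a \<Rightarrow> 'b::banach"
  assumes f: "strongly_integrable M f" and K: "closed K" "0 \<in> K"
    and add: "\<And>u v. u \<in> K \<Longrightarrow> v \<in> K \<Longrightarrow> u + v \<in> K"
    and scale: "\<And>c u. 0 \<le> c \<Longrightarrow> u \<in> K \<Longrightarrow> c *\<^sub>R u \<in> K"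
    and fK: "AE x in M. f x \<in> K"
  shows "strong_integral M f \<in> K"
proof -
  obtain \<sigma> where \<sigma>: "\<And>i::nat. sb_integrable M (\<sigma> i)"
    and \<sigma>1: "(\<lambda>i. nint M (\<lambda>x. f x - \<sigma> i x)) \<longlonglongrightarrow> 0"
    and \<sigma>2: "(\<lambda>i. sb_integral M (\<sigma> i)) \<longlonglongrightarrow> strong_integral M f"
    using has_strong_integral_strong_integral[OF f] unfolding has_strong_integral_def by blast
  have ne: "K \<noteq> {}" using K by auto
  have sum: "infdist (\<Sum>y\<in>Y. \<mu> y *\<^sub>R y) K \<le> (\<Sum>y\<in>Y. \<mu> y * infdist y K)"
    if "finite Y" "\<And>y. 0 \<le> \<mu> y" for Y and \<mu> :: "'b \<Rightarrow> real"
    using that(1)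
  proof induction
    case empty
    then show ?case using K by simp
  next
    case (insert y Y)
    have "infdist (\<mu> y *\<^sub>R y + (\<Sum>y\<in>Y. \<mu> y *\<^sub>R y)) K
      \<le> infdist (\<mu> y *\<^sub>R y) K + infdist (\<Sum>y\<in>Y. \<mu> y *\<^sub>R y) K"
      by (rule infdist_cone_add_le[OF add ne])
    also have "\<dots> \<le> \<mu> y * infdist y K + (\<Sum>y\<in>Y. \<mu> y * infdist y K)"
      by (intro add_mono insert infdist_cone_scaleR_le scale ne that)
    finally show ?case using insert by simp
  qed
  have bound: "ennreal (infdist (sb_integral M (\<sigma> i)) K) \<le> (nint M (\<lambda>x. f x - \<sigma> i x))" for i
  proof -
    have sb: "sb_integrable M (\<lambda>x. infdist (\<sigma> i x) K)"
      using simple_bochner_integrable_compose2[of "\<lambda>x y. infdist x K" M "\<sigma> i" "\<sigma> i"] \<sigma> K by simp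
    have "infdist (sb_integral M (\<sigma> i)) K
      \<le> (\<Sum>y\<in>\<sigma> i ` space M. measure M {x\<in>space M. \<sigma> i x = y} *\<^sub>R infdist y K)"
      unfolding Bochner_Integration.simple_bochner_integral_def using \<sigma>[of i]
      by (simp, intro sum) (auto simp: simple_bochner_integrable.simps simple_function_def)
    also have "\<dots> = sb_integral M (\<lambda>x. infdist (\<sigma> i x) K)"
      using \<sigma>[of i] by (intro simple_bochner_integral_partition[symmetric] sb)
        (auto simp: simple_bochner_integrable.simps)
    finally have "ennreal (infdist (sb_integral M (\<sigma> i)) K) \<le> (\<integral>\<^sup>+x. ennreal (infdist (\<sigma> i x) K) \<partial>M)"
      using simple_bochner_integral_eq_nn_integral[OF sb] infdist_nonneg by (metis ennreal_leI)
    also have "\<dots> \<le> (nint M (\<lambda>x. f x - \<sigma> i x))"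
    proof (rule nn_integral_mono_AE, use fK in eventually_elim)
      case (elim x)
      then show ?case using infdist_le[OF elim, of "\<sigma> i x"]
        by (intro ennreal_leI) (simp add: dist_norm norm_minus_commute)
    qed
    finally show ?thesis .
  qed
  have "(\<lambda>i. ennreal (infdist (sb_integral M (\<sigma> i)) K)) \<longlonglongrightarrow> 0"
    by (rule tendsto_sandwich[OF _ _ tendsto_const[of 0]]) (use \<sigma>1 bound in auto)
  moreover have "(\<lambda>i. ennreal (infdist (sb_integral M (\<sigma> i)) K)) \<longlonglongrightarrow> ennreal (infdist (strong_integral M f) K)"
    by (intro tendsto_ennrealI tendsto_infdist \<sigma>2)
  ultimately have "ennreal (infdist (strong_integral M f) K) = 0"
    using LIMSEQ_unique by blast
  then show ?thesis
    using in_closed_iff_infdist_zero[OF K(1) ne] infdist_nonneg[of "strong_integral M f" K]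
    by (simp add: ennreal_eq_0_iff)
qed

lemma (in complete_measure) strong_integral_nonneg:
  fixes f :: "'a \<Rightarrow> 'b::{banach, ordered_real_vector}"
  assumes "closed {u::'b. 0 \<le> u}" "strongly_integrable M f" "AE x in M. 0 \<le> f x"
  shows "0 \<le> strong_integral M f"
proof -
  have "strong_integral M f \<in> {u. 0 \<le> u}"
    by (rule strong_integral_in_closed_cone) (use assms in \<open>auto intro: scaleR_nonneg_nonneg\<close>)
  then show ?thesis by simp
qed

text \<open>
  The differences of two positive elements of norm at most \<open>n\<close> exhaust the space as \<open>n\<close> grows, so by
  Baire's theorem the closure of one such set contains a ball. These sets are symmetric and convex, hence
  the ball may be centred at 0, and scaling gives a constant that serves all elements.
\<close>

lemma cone_approximate_decomposition:
  assumes gen: "\<And>u::'a::{banach, ordered_real_vector}. \<exists>v w. 0 \<le> v \<and> 0 \<le> w \<and> u = v - w"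
  shows "\<exists>K>0. \<forall>(u::'a). \<forall>e>0. \<exists>v w. 0 \<le> v \<and> 0 \<le> w \<and> norm v \<le> K * norm u \<and> norm w \<le> K * norm u
        \<and> norm (u - (v - w)) < e"
proof -
  define C where "C n = {v - w |v w :: 'a. 0 \<le> v \<and> 0 \<le> w \<and> norm v \<le> real n \<and> norm w \<le> real n}" for n
  have UN: "(\<Union>n. C n) = UNIV"
  proof (intro equalityI subsetI UNIV_I)
    fix u :: 'a
    obtain v w where vw: "0 \<le> v" "0 \<le> w" "u = v - w" using gen by blast
    obtain n where "max (norm v) (norm w) \<le> real n" using real_arch_simple by blast
    then show "u \<in> (\<Union>n. C n)" using vw by (auto simp: C_def intro!: exI[of _ n])
  qed
  have "\<exists>n. interior (closure (C n)) \<noteq> {}"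
  proof (rule ccontr)
    assume "\<not> ?thesis"
    then have "euclidean interior_of (\<Union>(range (\<lambda>n. closure (C n)))) = {}"
      by (intro Baire_category_alt) (auto simp: completely_metrizable_space_euclidean)
    moreover have "\<Union>(range (\<lambda>n. closure (C n))) = UNIV"
      using UN closure_subset by blast
    ultimately show False by simp
  qed
  then obtain n x where "x \<in> interior (closure (C n))" by blast
  then obtain r where r: "0 < r" "ball x r \<subseteq> closure (C n)"
    by (meson mem_interior)
  have small: "\<exists>v w. 0 \<le> v \<and> 0 \<le> w \<and> norm v \<le> real n \<and> norm w \<le> real n \<and> norm (u - (v - w)) < e"
    if u: "norm u < r" and e: "0 < e" for u :: 'a and e
  proof -
    have "x + u \<in> closure (C n)" "x - u \<in> closure (C n)"
      using r u by (auto simp: subset_iff dist_norm)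
    then obtain c d where "c \<in> C n" "d \<in> C n" and cd: "norm (c - (x + u)) < e" "norm (d - (x - u)) < e"
      using e unfolding closure_approachable dist_norm by meson
    then obtain v1 w1 v2 w2 where c: "c = v1 - w1" "0 \<le> v1" "0 \<le> w1" "norm v1 \<le> real n" "norm w1 \<le> real n"
      and d: "d = v2 - w2" "0 \<le> v2" "0 \<le> w2" "norm v2 \<le> real n" "norm w2 \<le> real n"
      by (auto simp: C_def)
    \<comment> \<open>\<open>u\<close> is the midpoint of \<open>x + u\<close> and \<open>- (x - u)\<close>\<close>
    define v where "v = (1/2) *\<^sub>R (v1 + w2)"
    define w where "w = (1/2) *\<^sub>R (w1 + v2)"
    have "2 *\<^sub>R (u - (v - w)) = (d - (x - u)) - (c - (x + u))"
      unfolding v_def w_def c(1) d(1) scaleR_right_diff_distrib scaleR_2[of u] by simp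
    then have "2 * norm (u - (v - w)) = norm ((d - (x - u)) - (c - (x + u)))"
      by (metis abs_numeral norm_scaleR)
    also have "\<dots> \<le> norm (d - (x - u)) + norm (c - (x + u))"
      by (rule norm_triangle_ineq4)
    finally have "2 * norm (u - (v - w)) \<le> norm (d - (x - u)) + norm (c - (x + u))" .
    then have "norm (u - (v - w)) < e" using cd by simp
    moreover have "norm v \<le> real n" "norm w \<le> real n"
      using norm_triangle_ineq[of v1 w2] norm_triangle_ineq[of w1 v2] c d by (auto simp: v_def w_def)
    moreover have "0 \<le> v" "0 \<le> w"
      using c d by (auto simp: v_def w_def intro!: scaleR_nonneg_nonneg)
    ultimately show ?thesis by blast
  qed
  show ?thesis
  proof (intro exI[of _ "2 * (real n + 1) / r"] conjI allI impI)
    show "0 < 2 * (real n + 1) / r" using r by simp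
    fix u :: 'a and e :: real assume e: "0 < e"
    show "\<exists>v w. 0 \<le> v \<and> 0 \<le> w \<and> norm v \<le> 2 * (real n + 1) / r * norm u
        \<and> norm w \<le> 2 * (real n + 1) / r * norm u \<and> norm (u - (v - w)) < e"
    proof (cases "u = 0")
      case True
      then show ?thesis using e by (intro exI[of _ 0]) simp
    next
      case False
      define t where "t = 2 * norm u / r"
      have t: "0 < t" using False r by (simp add: t_def)
      have "norm ((1 / t) *\<^sub>R u) < r" using False r by (simp add: t_def field_simps)
      from small[OF this, of "e / t"] e t obtain v w
        where vw: "0 \<le> v" "0 \<le> w" "norm v \<le> real n" "norm w \<le> real n"
          "norm ((1 / t) *\<^sub>R u - (v - w)) < e / t" by auto
      have "u - (t *\<^sub>R v - t *\<^sub>R w) = t *\<^sub>R ((1 / t) *\<^sub>R u - (v - w))"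
        using t by (simp add: algebra_simps)
      then have "norm (u - (t *\<^sub>R v - t *\<^sub>R w)) < e"
        using vw(5) t by (simp add: pos_less_divide_eq mult.commute)
      moreover have "norm (t *\<^sub>R y) \<le> 2 * (real n + 1) / r * norm u" if "norm y \<le> real n" for y :: 'a
      proof -
        have "norm (t *\<^sub>R y) = t * norm y" using t by simp
        also have "\<dots> \<le> t * (real n + 1)" using that t by (intro mult_left_mono) auto
        finally show ?thesis by (simp add: t_def field_simps)
      qed
      ultimately show ?thesis
        using vw t by (intro exI[of _ "t *\<^sub>R v"] exI[of _ "t *\<^sub>R w"]) (auto intro: scaleR_nonneg_nonneg)
    qed
  qed
qed

lemma suminf_nonneg_closed_cone:
  fixes f :: "nat \<Rightarrow> 'a::{banach, ordered_real_vector}"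
  assumes "closed {u::'a. 0 \<le> u}" "summable f" "\<And>n. 0 \<le> f n"
  shows "0 \<le> suminf f"
proof -
  have "suminf f \<in> {u. 0 \<le> u}"
    by (rule closed_sequentially[OF assms(1) _ summable_LIMSEQ[OF assms(2)]])
      (use assms(3) in \<open>auto intro: sum_nonneg\<close>)
  then show ?thesis by simp
qed

text \<open>
  As in the open mapping theorem, the approximate decomposition is applied again to what is left over,
  which is halved each time; the sums of the positive parts and of the negative parts converge geometrically,
  and their limits are positive because the cone is closed.
\<close>

lemma cone_decomposition:
  assumes closed: "closed {u::'a::{banach, ordered_real_vector}. 0 \<le> u}"
    and gen: "\<And>u::'a. \<exists>v w. 0 \<le> v \<and> 0 \<le> w \<and> u = v - w"
  shows "\<exists>K\<ge>1. \<forall>u::'a. \<exists>v w. 0 \<le> v \<and> 0 \<le> w \<and> u = v - w \<and> norm v \<le> K * norm u \<and> norm w \<le> K * norm u"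
proof -
  obtain K where K: "0 < K"
    "\<forall>(u::'a). \<forall>e>0. \<exists>v w. 0 \<le> v \<and> 0 \<le> w \<and> norm v \<le> K * norm u \<and> norm w \<le> K * norm u
        \<and> norm (u - (v - w)) < e"
    using cone_approximate_decomposition[OF gen] by (elim exE conjE) 
  have "\<exists>v w. 0 \<le> v \<and> 0 \<le> w \<and> norm v \<le> K * norm u \<and> norm w \<le> K * norm u
        \<and> norm (u - (v - w)) \<le> norm u / 2" for u :: 'a
  proof (cases "u = 0")
    case True
    then show ?thesis by (intro exI[of _ 0]) simp
  next
    case False
    then show ?thesis using K(2)[rule_format, of "norm u / 2" u] by (auto intro: less_imp_le)
  qed
  then obtain P Q where PQ: "\<And>u::'a. 0 \<le> P u" "\<And>u. 0 \<le> Q u" "\<And>u. norm (P u) \<le> K * norm u"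
    "\<And>u. norm (Q u) \<le> K * norm u" "\<And>u. norm (u - (P u - Q u)) \<le> norm u / 2"
    by metis
  show ?thesis
  proof (intro exI[of _ "max 1 (2 * K)"] conjI allI)
    show "1 \<le> max 1 (2 * K)" by simp
    fix u :: 'a
    define x where "x n = ((\<lambda>y. y - (P y - Q y)) ^^ n) u" for n
    have x0: "x 0 = u" and xS: "x (Suc n) = x n - (P (x n) - Q (x n))" for n
      by (simp_all add: x_def)
    have nx: "norm (x n) \<le> norm u * (1/2) ^ n" for n
    proof (induction n)
      case (Suc n)
      then show ?case using PQ(5)[of "x n"] by (simp add: xS)
    qed (simp add: x0)
    have geo: "(\<lambda>n. K * (norm u * (1/2) ^ n)) sums (2 * K * norm u)"
      using sums_mult[OF geometric_sums[of "1/2::real"], of "K * norm u"] by (simp add: mult_ac)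
    have *: "summable (\<lambda>n. R (x n)) \<and> norm (\<Sum>n. R (x n)) \<le> max 1 (2 * K) * norm u"
      if R: "\<And>u. norm (R u) \<le> K * norm u" for R :: "'a \<Rightarrow> 'a"
    proof -
      have le: "norm (R (x n)) \<le> K * (norm u * (1/2) ^ n)" for n
        using R[of "x n"] mult_left_mono[OF nx[of n], of K] K(1) by linarith
      have sm: "summable (\<lambda>n. norm (R (x n)))"
        by (rule summable_comparison_test[OF _ sums_summable[OF geo]]) (use le in auto)
      have "norm (\<Sum>n. R (x n)) \<le> (\<Sum>n. norm (R (x n)))" by (rule summable_norm[OF sm])
      also have "\<dots> \<le> (\<Sum>n. K * (norm u * (1/2) ^ n))"
        by (rule suminf_le[OF le sm sums_summable[OF geo]])
      also have "\<dots> = 2 * K * norm u" using geo by (simp add: sums_iff)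
      also have "\<dots> \<le> max 1 (2 * K) * norm u" by (intro mult_right_mono) auto
      finally show ?thesis using summable_norm_cancel[OF sm] by simp
    qed
    have "x \<longlonglongrightarrow> 0"
    proof (rule tendsto_norm_zero_cancel, rule tendsto_sandwich[OF _ _ tendsto_const[of 0]])
      show "(\<lambda>n. norm u * (1/2) ^ n) \<longlonglongrightarrow> 0"
        by (intro tendsto_mult_right_zero LIMSEQ_realpow_zero) auto
    qed (use nx in auto)
    then have "(\<lambda>n. x n - x (Suc n)) sums (x 0 - 0)"
      by (rule telescope_sums')
    then have "u = (\<Sum>n. P (x n) - Q (x n))"
      by (simp add: xS x0 sums_iff)
    also have "\<dots> = (\<Sum>n. P (x n)) - (\<Sum>n. Q (x n))"
      using *[OF PQ(3)] *[OF PQ(4)] by (intro suminf_diff[symmetric]) auto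
    finally show "\<exists>v w. 0 \<le> v \<and> 0 \<le> w \<and> u = v - w \<and> norm v \<le> max 1 (2 * K) * norm u
        \<and> norm w \<le> max 1 (2 * K) * norm u"
      using *[OF PQ(3)] *[OF PQ(4)] PQ(1,2)
      by (intro exI[of _ "\<Sum>n. P (x n)"] exI[of _ "\<Sum>n. Q (x n)"]) (auto intro: suminf_nonneg_closed_cone[OF closed])
  qed
qed

section \<open>Lebesgue measure in the plane\<close>

lemma strongly_measurable_comp:
  assumes f: "strongly_measurable M f" and g: "g \<in> measurable N M"
    and null: "\<And>A. A \<in> null_sets M \<Longrightarrow> g -` A \<inter> space N \<in> null_sets N"
  shows "strongly_measurable N (\<lambda>x. f (g x))"
proof -
  obtain \<sigma> where \<sigma>: "\<And>i::nat. simple_function M (\<sigma> i)" "AE x in M. (\<lambda>i. \<sigma> i x) \<longlonglongrightarrow> f x"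
    using f unfolding strongly_measurable_def by blast
  obtain A where A: "A \<in> null_sets M" "{x\<in>space M. \<not> (\<lambda>i. \<sigma> i x) \<longlonglongrightarrow> f x} \<subseteq> A"
    using \<sigma>(2) by (auto simp: eventually_ae_filter)
  have "simple_function N (\<lambda>x. \<sigma> i (g x))" for i
    unfolding simple_function_def
  proof (intro conjI ballI)
    have "(\<lambda>x. \<sigma> i (g x)) ` space N \<subseteq> \<sigma> i ` space M"
      using measurable_space[OF g] by auto
    then show "finite ((\<lambda>x. \<sigma> i (g x)) ` space N)"
      using simple_functionD(1)[OF \<sigma>(1)] by (rule finite_subset)
    fix y
    have "(\<lambda>x. \<sigma> i (g x)) -` {y} \<inter> space N = g -` (\<sigma> i -` {y} \<inter> space M) \<inter> space N"
      using measurable_space[OF g] by auto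
    then show "(\<lambda>x. \<sigma> i (g x)) -` {y} \<inter> space N \<in> sets N"
      using measurable_sets[OF g simple_functionD(2)[OF \<sigma>(1)]] by simp
  qed
  moreover have "AE x in N. (\<lambda>i. \<sigma> i (g x)) \<longlonglongrightarrow> f (g x)"
    using null[OF A(1)] A(2) measurable_space[OF g]
    by (auto simp: eventually_ae_filter intro!: bexI[of _ "g -` A \<inter> space N"])
  ultimately show ?thesis
    unfolding strongly_measurable_def by (intro exI[of _ "\<lambda>i x. \<sigma> i (g x)"]) simp
qed

text \<open>
  Composition with such a map respects equality almost everywhere and hence strong measurability, which is
  itself defined up to null sets.
\<close>

definition nonsingular :: "('a::euclidean_space \<Rightarrow> 'b::euclidean_space) \<Rightarrow> bool" where
  "nonsingular g \<longleftrightarrow> g \<in> lebesgue \<rightarrow>\<^sub>M lebesgue \<and> (\<forall>A\<in>null_sets lebesgue. g -` A \<in> null_sets lebesgue)"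

lemma nonsingularI:
  assumes g: "g \<in> borel_measurable borel"
    and null: "\<And>A. A \<in> null_sets lborel \<Longrightarrow> emeasure lborel (g -` A) = 0"
  shows "nonsingular g"
  unfolding nonsingular_def
proof (intro conjI ballI)
  have g': "g \<in> lebesgue \<rightarrow>\<^sub>M lborel"
    using g by (auto intro: measurable_completion)
  have pre: "g -` A \<in> null_sets lborel" if "A \<in> null_sets lborel" for A
    using null[OF that] measurable_sets[OF g, of A] that by (auto simp: null_sets_def)
  show "g \<in> lebesgue \<rightarrow>\<^sub>M lebesgue"
  proof (rule completion.measurable_completion2[OF g'])
    show "null_sets lborel \<subseteq> null_sets (distr lebesgue lborel g)"
    proof
      fix A :: "'b set" assume A: "A \<in> null_sets lborel"
      then show "A \<in> null_sets (distr lebesgue lborel g)"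
        using null_sets_completionI[OF pre[OF A]] null_setsD2[OF A] by (simp add: null_sets_distr_iff[OF g'])
    qed
  qed
  fix A assume "A \<in> null_sets (lebesgue :: 'b measure)"
  then obtain B where B: "B \<in> null_sets lborel" "A \<subseteq> B"
    unfolding null_sets_completion_iff2 by (elim bexE)
  show "g -` A \<in> null_sets lebesgue"
    unfolding null_sets_completion_iff2
    using pre[OF B(1)] vimage_mono[OF B(2), of g] by (intro bexI[of _ "g -` B"])
qed

lemma nonsingular_AE:
  assumes "nonsingular g" "AE x in lebesgue. P x"
  shows "AE y in lebesgue. P (g y)"
proof -
  obtain A where A: "A \<in> null_sets lebesgue" "{x. \<not> P x} \<subseteq> A"
    using assms(2) by (auto simp: eventually_ae_filter)
  then show ?thesis
    using assms(1) by (auto simp: eventually_ae_filter nonsingular_def intro!: bexI[of _ "g -` A"])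
qed

lemma nonsingular_strongly_measurable:
  assumes "nonsingular g" "strongly_measurable lebesgue f"
  shows "strongly_measurable lebesgue (\<lambda>x. f (g x))"
  using assms(1) unfolding nonsingular_def by (intro strongly_measurable_comp[OF assms(2)]) simp_all

lemma strongly_measurable_pullback:
  assumes g: "nonsingular g" and f: "strongly_measurable (lebesgue_on S) f"
    and S: "S \<in> sets lebesgue" and T: "T \<in> sets lebesgue" and sub: "\<And>x. x \<in> T \<Longrightarrow> g x \<in> S"
  shows "strongly_measurable (lebesgue_on T) (\<lambda>x. f (g x))"
proof (rule strongly_measurable_comp[OF f])
  show "g \<in> lebesgue_on T \<rightarrow>\<^sub>M lebesgue_on S"
    using g sub by (intro measurable_restrict_space3) (auto simp: nonsingular_def)
  fix A assume "A \<in> null_sets (lebesgue_on S)"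
  then have "A \<in> null_sets lebesgue" using S by (simp add: null_sets_restrict_space)
  then have "g -` A \<in> null_sets lebesgue" using g by (simp add: nonsingular_def)
  then have "g -` A \<inter> T \<in> null_sets lebesgue" using T by (rule null_set_Int2)
  then show "g -` A \<inter> space (lebesgue_on T) \<in> null_sets (lebesgue_on T)"
    using T by (simp add: null_sets_restrict_space)
qed

lemma strongly_measurable_extend_zero:
  assumes "strongly_measurable (lebesgue_on T) f" "T \<in> sets lebesgue" "S \<in> sets lebesgue"
  shows "strongly_measurable (lebesgue_on S) (\<lambda>x. if x \<in> T then f x else 0)"
proof -
  have "strongly_measurable (lebesgue_on UNIV) (\<lambda>x. indicator T x *\<^sub>R f x)"
    using assms strongly_measurable_restrict_space_iff[of T lebesgue f] by (simp add: lebesgue_on_UNIV_eq)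
  from strongly_measurable_lebesgue_on_subset[OF this _ assms(3)]
  have "strongly_measurable (lebesgue_on S) (\<lambda>x. indicator T x *\<^sub>R f x)" by simp
  also have "(\<lambda>x. indicator T x *\<^sub>R f x) = (\<lambda>x. if x \<in> T then f x else 0)" by auto
  finally show ?thesis .
qed

lemma nonsingular_measurable:
  "nonsingular g \<Longrightarrow> f \<in> borel_measurable lebesgue \<Longrightarrow> (\<lambda>x. f (g x)) \<in> borel_measurable lebesgue"
  unfolding nonsingular_def by (elim conjE, rule measurable_compose[of g _ lebesgue f])

lemma nonsingular_translation: "nonsingular (\<lambda>x::real. x + c)"
proof (rule nonsingularI)
  fix A :: "real set" assume A: "A \<in> null_sets lborel"
  then have [measurable]: "A \<in> sets borel" by auto
  have "emeasure lborel A = (\<integral>\<^sup>+x. indicator A x \<partial>lborel)" by simp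
  also have "\<dots> = (\<integral>\<^sup>+x. indicator A (c + 1 * x) \<partial>lborel)"
    by (subst nn_integral_real_affine[of _ 1 c]) auto
  also have "\<dots> = (\<integral>\<^sup>+x. indicator ((\<lambda>x. x + c) -` A) x \<partial>lborel)"
    by (intro nn_integral_cong) (auto simp: indicator_def add.commute)
  also have "\<dots> = emeasure lborel ((\<lambda>x. x + c) -` A)"
  proof (rule nn_integral_indicator)
    have "(\<lambda>x. x + c) -` A \<inter> space borel \<in> sets borel"
      by (rule measurable_sets[of _ borel borel]) auto
    then show "(\<lambda>x. x + c) -` A \<in> sets lborel" by simp
  qed
  finally show "emeasure lborel ((\<lambda>x. x + c) -` A) = 0" using A by auto
qed auto

lemma nn_integral_translation:
  fixes f :: "real \<Rightarrow> ennreal"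
  assumes "f \<in> borel_measurable lebesgue"
  shows "(\<integral>\<^sup>+x. f (x + c) \<partial>lebesgue) = (\<integral>\<^sup>+x. f x \<partial>lebesgue)"
  using nn_integral_real_affine_lebesgue[OF assms, of 1 c] by (simp add: add.commute)

lemma nn_integral_lborel_snd:
  fixes f :: "real \<times> real \<Rightarrow> ennreal"
  assumes "f \<in> borel_measurable borel"
  shows "(\<integral>\<^sup>+y. \<integral>\<^sup>+x. f (x, y) \<partial>lborel \<partial>lborel) = (\<integral>\<^sup>+p. f p \<partial>lborel)"
  using lborel_pair.nn_integral_snd[of f] assms by (simp add: lborel_prod)

lemma nn_integral_lborel_fst:
  fixes f :: "real \<times> real \<Rightarrow> ennreal"
  assumes "f \<in> borel_measurable borel"
  shows "(\<integral>\<^sup>+x. \<integral>\<^sup>+y. f (x, y) \<partial>lborel \<partial>lborel) = (\<integral>\<^sup>+p. f p \<partial>lborel)"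
  using lborel.nn_integral_fst[of f lborel] assms by (simp add: lborel_prod)

text \<open>
  Lebesgue measure of the plane is the completion of the product and not the product of the completions, so
  the library's theorems on product measures apply to a Borel null set that covers the exceptional set.
\<close>

lemma AE_lebesgue_slices:
  assumes "AE p in lebesgue. P (p :: real \<times> real)"
  shows "AE x in lebesgue. AE y in lebesgue. P (x, y)" "AE y in lebesgue. AE x in lebesgue. P (x, y)"
proof -
  obtain N where N: "N \<in> null_sets lborel" "{p. \<not> P p} \<subseteq> N"
    using assms unfolding AE_completion_iff by (auto simp: eventually_ae_filter)
  then have [measurable]: "N \<in> sets borel" by auto
  have i: "(\<integral>\<^sup>+p. indicator N p \<partial>lborel) = (0::ennreal)" using N by auto
  have x: "AE x in lborel. AE y in lborel. P (x, y)"
  proof -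
    have "(\<integral>\<^sup>+x. \<integral>\<^sup>+y. indicator N (x, y) \<partial>lborel \<partial>lborel) = (0::ennreal)"
      by (subst nn_integral_lborel_fst) (auto simp: i)
    then have "AE x in lborel. (\<integral>\<^sup>+y. indicator N (x, y) \<partial>lborel) = (0::ennreal)"
      by (subst (asm) nn_integral_0_iff_AE) auto
    then show ?thesis
    proof eventually_elim
      case (elim x)
      then have "AE y in lborel. indicator N (x, y) = (0::ennreal)"
        by (subst (asm) nn_integral_0_iff_AE) auto
      then show ?case by eventually_elim (use N in \<open>auto simp: indicator_def split: if_splits\<close>)
    qed
  qed
  have y: "AE y in lborel. AE x in lborel. P (x, y)"
  proof -
    have "(\<integral>\<^sup>+y. \<integral>\<^sup>+x. indicator N (x, y) \<partial>lborel \<partial>lborel) = (0::ennreal)"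
      by (subst nn_integral_lborel_snd) (auto simp: i)
    then have "AE y in lborel. (\<integral>\<^sup>+x. indicator N (x, y) \<partial>lborel) = (0::ennreal)"
      by (subst (asm) nn_integral_0_iff_AE) auto
    then show ?thesis
    proof eventually_elim
      case (elim y)
      then have "AE x in lborel. indicator N (x, y) = (0::ennreal)"
        by (subst (asm) nn_integral_0_iff_AE) auto
      then show ?case by eventually_elim (use N in \<open>auto simp: indicator_def split: if_splits\<close>)
    qed
  qed
  show "AE x in lebesgue. AE y in lebesgue. P (x, y)" "AE y in lebesgue. AE x in lebesgue. P (x, y)"
    using x y by (auto simp: AE_completion_iff)
qed

text \<open>
  The slices of a Lebesgue measurable simple function may fail to be measurable; those of a Borel
  measurable modification are measurable, and agree with the former for almost every slice.
\<close>

lemma strongly_measurable_slice: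
  assumes "strongly_measurable (lebesgue :: (real \<times> real) measure) F"
  shows "AE x in lebesgue. strongly_measurable lebesgue (\<lambda>y. F (x, y))"
proof -
  obtain \<sigma> where \<sigma>: "\<And>i::nat. simple_function lebesgue (\<sigma> i)" "AE p in lebesgue. (\<lambda>i. \<sigma> i p) \<longlonglongrightarrow> F p"
    using assms unfolding strongly_measurable_def by blast
  have "\<exists>\<tau>. simple_function lborel \<tau> \<and> (AE p in lborel. \<sigma> i p = \<tau> p)" for i
    by (rule completion_ex_simple_function[OF \<sigma>(1)])
  then obtain \<tau> where \<tau>: "\<And>i. simple_function lborel (\<tau> i)" "\<And>i. AE p in lborel. \<sigma> i p = \<tau> i p"
    by metis
  have "AE p in lborel. \<forall>i. \<sigma> i p = \<tau> i p" using \<tau>(2) by (simp add: AE_all_countable)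
  then have "AE p in lebesgue. (\<lambda>i. \<tau> i p) \<longlonglongrightarrow> F p"
    using \<sigma>(2) unfolding AE_completion_iff by eventually_elim simp
  from AE_lebesgue_slices(1)[OF this] show ?thesis
  proof eventually_elim
    case (elim x)
    have "simple_function lebesgue (\<lambda>y. \<tau> i (x, y))" for i
      unfolding simple_function_def
    proof (intro conjI ballI)
      show "finite ((\<lambda>y. \<tau> i (x, y)) ` space lebesgue)"
        by (rule finite_subset[OF _ simple_functionD(1)[OF \<tau>(1)[of i]]]) auto
      fix c
      have "Pair x -` (\<tau> i -` {c} \<inter> space lborel) \<inter> space borel \<in> sets borel"
        using simple_functionD(2)[OF \<tau>(1)[of i], of "{c}"]
        by (intro measurable_sets[of _ borel borel]) auto
      also have "Pair x -` (\<tau> i -` {c} \<inter> space lborel) \<inter> space borel = (\<lambda>y. \<tau> i (x, y)) -` {c} \<inter> space lebesgue"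
        by auto
      finally show "(\<lambda>y. \<tau> i (x, y)) -` {c} \<inter> space lebesgue \<in> sets lebesgue"
        by auto
    qed
    with elim show ?case
      unfolding strongly_measurable_def by (intro exI[of _ "\<lambda>i y. \<tau> i (x, y)"] conjI allI)
  qed
qed

text \<open>
  Tonelli's theorem for completed measures, by passing to a Borel measurable modification.
\<close>

lemma nn_integral_lebesgue_prod:
  fixes F :: "real \<times> real \<Rightarrow> ennreal"
  assumes F: "F \<in> borel_measurable lebesgue"
  shows "(\<integral>\<^sup>+x. \<integral>\<^sup>+y. F (x, y) \<partial>lebesgue \<partial>lebesgue) = (\<integral>\<^sup>+p. F p \<partial>lebesgue)"
    and "(\<integral>\<^sup>+y. \<integral>\<^sup>+x. F (x, y) \<partial>lebesgue \<partial>lebesgue) = (\<integral>\<^sup>+p. F p \<partial>lebesgue)"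
    and "(\<lambda>x. \<integral>\<^sup>+y. F (x, y) \<partial>lebesgue) \<in> borel_measurable lebesgue"
    and "(\<lambda>y. \<integral>\<^sup>+x. F (x, y) \<partial>lebesgue) \<in> borel_measurable lebesgue"
proof -
  obtain G where G: "G \<in> borel_measurable lborel" "AE p in lborel. F p = G p"
    using completion_ex_borel_measurable[OF F] by blast
  have G' [measurable]: "G \<in> borel_measurable borel" using G(1) by simp
  have ae: "AE p in lebesgue. F p = G p" using G(2) by (simp add: AE_completion_iff)
  have I: "(\<integral>\<^sup>+p. F p \<partial>lebesgue) = (\<integral>\<^sup>+p. G p \<partial>lborel)"
    using nn_integral_cong_AE[OF ae] by (simp add: nn_integral_completion)
  have x: "AE x in lebesgue. (\<integral>\<^sup>+y. G (x, y) \<partial>lborel) = (\<integral>\<^sup>+y. F (x, y) \<partial>lebesgue)"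
    using AE_lebesgue_slices(1)[OF ae]
  proof eventually_elim
    case (elim x)
    from nn_integral_cong_AE[OF elim] show ?case by (simp add: nn_integral_completion)
  qed
  have y: "AE y in lebesgue. (\<integral>\<^sup>+x. G (x, y) \<partial>lborel) = (\<integral>\<^sup>+x. F (x, y) \<partial>lebesgue)"
    using AE_lebesgue_slices(2)[OF ae]
  proof eventually_elim
    case (elim y)
    from nn_integral_cong_AE[OF elim] show ?case by (simp add: nn_integral_completion)
  qed
  show "(\<integral>\<^sup>+x. \<integral>\<^sup>+y. F (x, y) \<partial>lebesgue \<partial>lebesgue) = (\<integral>\<^sup>+p. F p \<partial>lebesgue)"
  proof -
    have "(\<integral>\<^sup>+x. \<integral>\<^sup>+y. F (x, y) \<partial>lebesgue \<partial>lebesgue) = (\<integral>\<^sup>+x. \<integral>\<^sup>+y. G (x, y) \<partial>lborel \<partial>lebesgue)"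
      by (rule nn_integral_cong_AE[OF x, symmetric])
    also have "\<dots> = (\<integral>\<^sup>+p. G p \<partial>lborel)"
      unfolding nn_integral_completion by (rule nn_integral_lborel_fst[OF G'])
    finally show ?thesis by (simp only: I)
  qed
  show "(\<integral>\<^sup>+y. \<integral>\<^sup>+x. F (x, y) \<partial>lebesgue \<partial>lebesgue) = (\<integral>\<^sup>+p. F p \<partial>lebesgue)"
  proof -
    have "(\<integral>\<^sup>+y. \<integral>\<^sup>+x. F (x, y) \<partial>lebesgue \<partial>lebesgue) = (\<integral>\<^sup>+y. \<integral>\<^sup>+x. G (x, y) \<partial>lborel \<partial>lebesgue)"
      by (rule nn_integral_cong_AE[OF y, symmetric])
    also have "\<dots> = (\<integral>\<^sup>+p. G p \<partial>lborel)"
      unfolding nn_integral_completion by (rule nn_integral_lborel_snd[OF G'])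
    finally show ?thesis by (simp only: I)
  qed
  have "(\<lambda>x. \<integral>\<^sup>+y. G (x, y) \<partial>lborel) \<in> borel_measurable lborel" by measurable
  then have "(\<lambda>x. \<integral>\<^sup>+y. G (x, y) \<partial>lborel) \<in> borel_measurable lebesgue" by (rule measurable_completion)
  then show "(\<lambda>x. \<integral>\<^sup>+y. F (x, y) \<partial>lebesgue) \<in> borel_measurable lebesgue"
    by (rule completion.borel_measurable_cong_AE[OF _ x])
  have "(\<lambda>y. \<integral>\<^sup>+x. G (x, y) \<partial>lborel) \<in> borel_measurable lborel" by measurable
  then have "(\<lambda>y. \<integral>\<^sup>+x. G (x, y) \<partial>lborel) \<in> borel_measurable lebesgue" by (rule measurable_completion)
  then show "(\<lambda>y. \<integral>\<^sup>+x. F (x, y) \<partial>lebesgue) \<in> borel_measurable lebesgue"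
    by (rule completion.borel_measurable_cong_AE[OF _ y])
qed

lemma nonsingular_fst: "nonsingular (fst :: real \<times> real \<Rightarrow> real)"
proof (rule nonsingularI)
  fix A :: "real set" assume A: "A \<in> null_sets lborel"
  then have [measurable]: "A \<in> sets borel" by auto
  have "fst -` A \<inter> space borel \<in> sets (borel :: (real \<times> real) measure)"
    by (rule measurable_sets[of _ borel borel]) (auto simp flip: borel_prod)
  then have "emeasure lborel (fst -` A :: (real \<times> real) set) = (\<integral>\<^sup>+p. indicator (fst -` A) (p :: real \<times> real) \<partial>lborel)"
    by simp
  also have "\<dots> = (\<integral>\<^sup>+p. indicator A (fst (p :: real \<times> real)) \<partial>lborel)"
    by (intro nn_integral_cong) (simp add: indicator_def)
  also have "\<dots> = (\<integral>\<^sup>+y. \<integral>\<^sup>+x. indicator A x \<partial>lborel \<partial>(lborel :: real measure))"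
    by (subst nn_integral_lborel_snd[symmetric]) (auto simp flip: borel_prod)
  finally show "emeasure lborel (fst -` A :: (real \<times> real) set) = 0" using null_setsD1[OF A] by simp
qed (auto simp flip: borel_prod)

lemma nonsingular_snd: "nonsingular (snd :: real \<times> real \<Rightarrow> real)"
proof (rule nonsingularI)
  fix A :: "real set" assume A: "A \<in> null_sets lborel"
  then have [measurable]: "A \<in> sets borel" by auto
  have "snd -` A \<inter> space borel \<in> sets (borel :: (real \<times> real) measure)"
    by (rule measurable_sets[of _ borel borel]) (auto simp flip: borel_prod)
  then have "emeasure lborel (snd -` A :: (real \<times> real) set) = (\<integral>\<^sup>+p. indicator (snd -` A) (p :: real \<times> real) \<partial>lborel)"
    by simp
  also have "\<dots> = (\<integral>\<^sup>+p. indicator A (snd (p :: real \<times> real)) \<partial>lborel)"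
    by (intro nn_integral_cong) (simp add: indicator_def)
  also have "\<dots> = (\<integral>\<^sup>+x. \<integral>\<^sup>+y. indicator A y \<partial>lborel \<partial>(lborel :: real measure))"
    by (subst nn_integral_lborel_fst[symmetric]) (auto simp flip: borel_prod)
  finally show "emeasure lborel (snd -` A :: (real \<times> real) set) = 0" using null_setsD1[OF A] by simp
qed (auto simp flip: borel_prod)

lemma nn_integral_lborel_shear:
  fixes F :: "real \<times> real \<Rightarrow> ennreal"
  assumes [measurable]: "F \<in> borel_measurable borel"
  shows "(\<integral>\<^sup>+p. F (fst p + snd p, snd p) \<partial>lborel) = (\<integral>\<^sup>+p. F p \<partial>lborel)"
proof -
  have "(\<integral>\<^sup>+p. F (fst p + snd p, snd p) \<partial>lborel) = (\<integral>\<^sup>+s. \<integral>\<^sup>+d. F (d + s, s) \<partial>lborel \<partial>lborel)"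
    by (subst nn_integral_lborel_snd[symmetric]) (auto simp flip: borel_prod)
  also have "\<dots> = (\<integral>\<^sup>+s. \<integral>\<^sup>+t. F (t, s) \<partial>lborel \<partial>lborel)"
  proof (rule nn_integral_cong)
    fix s
    show "(\<integral>\<^sup>+d. F (d + s, s) \<partial>lborel) = (\<integral>\<^sup>+t. F (t, s) \<partial>lborel)"
      using nn_integral_real_affine[of "\<lambda>t. F (t, s)" 1 s] by (simp add: add.commute)
  qed
  finally show ?thesis by (simp add: nn_integral_lborel_snd)
qed

lemma nonsingular_shear: "nonsingular (\<lambda>p::real \<times> real. (fst p + snd p, snd p))"
proof (rule nonsingularI)
  show m: "(\<lambda>p::real \<times> real. (fst p + snd p, snd p)) \<in> borel_measurable borel"
    by (auto simp flip: borel_prod)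
  fix A :: "(real \<times> real) set" assume A: "A \<in> null_sets lborel"
  then have [measurable]: "A \<in> sets borel" by auto
  have "(\<lambda>p. (fst p + snd p, snd p)) -` A \<inter> space borel \<in> sets borel"
    by (rule measurable_sets[OF m]) auto
  then have "emeasure lborel ((\<lambda>p. (fst p + snd p, snd p)) -` A)
      = (\<integral>\<^sup>+p. indicator ((\<lambda>p. (fst p + snd p, snd p)) -` A) p \<partial>lborel)"
    by simp
  also have "\<dots> = (\<integral>\<^sup>+p. indicator A (fst p + snd p, snd p) \<partial>lborel)"
    by (intro nn_integral_cong) (simp add: indicator_def)
  also have "\<dots> = 0" using A by (subst nn_integral_lborel_shear) auto
  finally show "emeasure lborel ((\<lambda>p. (fst p + snd p, snd p)) -` A) = 0" .
qed

lemma nn_integral_lebesgue_shear: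
  fixes F :: "real \<times> real \<Rightarrow> ennreal"
  assumes F: "F \<in> borel_measurable lebesgue"
  shows "(\<integral>\<^sup>+p. F (fst p + snd p, snd p) \<partial>lebesgue) = (\<integral>\<^sup>+p. F p \<partial>lebesgue)"
proof -
  obtain G where G: "G \<in> borel_measurable lborel" "AE p in lborel. F p = G p"
    using completion_ex_borel_measurable[OF F] by blast
  have ae: "AE p in lebesgue. F p = G p" using G(2) by (simp add: AE_completion_iff)
  have "(\<integral>\<^sup>+p. F (fst p + snd p, snd p) \<partial>lebesgue) = (\<integral>\<^sup>+p. G (fst p + snd p, snd p) \<partial>lebesgue)"
    by (rule nn_integral_cong_AE[OF nonsingular_AE[OF nonsingular_shear ae]])
  also have "\<dots> = (\<integral>\<^sup>+p. G p \<partial>lebesgue)"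
    using nn_integral_lborel_shear[of G] G(1) by (simp add: nn_integral_completion)
  also have "\<dots> = (\<integral>\<^sup>+p. F p \<partial>lebesgue)"
    by (rule nn_integral_cong_AE) (use ae in auto)
  finally show ?thesis .
qed

lemma closed_Delta: "closed Delta"
proof -
  have "Delta = {p. 0 \<le> snd p} \<inter> {p. snd p \<le> fst p}" by (auto simp: Delta_def)
  moreover have "closed ({p. 0 \<le> snd p} \<inter> {p. snd p \<le> fst p} :: (real \<times> real) set)"
    by (intro closed_Int closed_Collect_le continuous_intros)
  ultimately show ?thesis by simp
qed

lemma Delta_lebesgue: "Delta \<in> sets lebesgue"
  using borel_closed[OF closed_Delta] by auto

text \<open>
  The strip \<open>0 \<le> s \<le> t \<le> s + h\<close> is swept out by vertical lines, by horizontal lines, and, after the shear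
  \<open>(d, s) \<mapsto> (s + d, s)\<close>, by lines of slope 1. Estimates for a fixed starting point \<open>s\<close> or a fixed end
  point \<open>t\<close> are turned in this way into averages over the delay \<open>d = t - s\<close>.
\<close>

lemma nn_integral_strip:
  fixes F :: "real \<times> real \<Rightarrow> ennreal"
  assumes F: "F \<in> borel_measurable (lebesgue_on Delta)" and h: "0 \<le> h"
  shows "(\<integral>\<^sup>+s. \<integral>\<^sup>+t. F (t, s) \<partial>lebesgue_on {s..s + h} \<partial>lebesgue_on {0..})
      = (\<integral>\<^sup>+d. \<integral>\<^sup>+s. F (s + d, s) \<partial>lebesgue_on {0..} \<partial>lebesgue_on {0..h})" (is ?a)
    and "(\<integral>\<^sup>+t. \<integral>\<^sup>+s. F (t, s) \<partial>lebesgue_on {max 0 (t - h)..t} \<partial>lebesgue_on {0..})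
      = (\<integral>\<^sup>+d. \<integral>\<^sup>+s. F (s + d, s) \<partial>lebesgue_on {0..} \<partial>lebesgue_on {0..h})" (is ?b)
    and "(\<lambda>s. \<integral>\<^sup>+t. F (t, s) \<partial>lebesgue_on {s..s + h}) \<in> borel_measurable (lebesgue_on {0..})" (is ?c)
    and "(\<lambda>t. \<integral>\<^sup>+s. F (t, s) \<partial>lebesgue_on {max 0 (t - h)..t}) \<in> borel_measurable (lebesgue_on {0..})" (is ?d)
proof -
  define S where "S = {p :: real \<times> real. 0 \<le> snd p \<and> snd p \<le> fst p \<and> fst p \<le> snd p + h}"
  define G where "G p = F p * indicator S p" for p
  have S_eq: "S = Delta \<inter> {p. fst p \<le> snd p + h}" by (auto simp: S_def Delta_def)
  have "closed S" unfolding S_eq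
    by (intro closed_Int closed_Delta closed_Collect_le continuous_intros)
  then have S: "S \<in> sets lebesgue" using borel_closed by auto
  have "(\<lambda>p. F p * indicator Delta p) \<in> borel_measurable lebesgue"
    using F Delta_lebesgue by (simp add: borel_measurable_restrict_space_iff_ennreal)
  then have "(\<lambda>p. (F p * indicator Delta p) * indicator S p) \<in> borel_measurable lebesgue"
    by (rule borel_measurable_times_ennreal[OF _ borel_measurable_indicator[OF S]])
  also have "(\<lambda>p. (F p * indicator Delta p) * indicator S p) = G"
    by (auto simp: G_def S_eq indicator_def)
  finally have G: "G \<in> borel_measurable lebesgue" .
  have H: "(\<lambda>p. G (fst p + snd p, snd p)) \<in> borel_measurable lebesgue"
    by (rule nonsingular_measurable[OF nonsingular_shear G])
  have s: "(\<integral>\<^sup>+t. G (t, s) \<partial>lebesgue) = (\<integral>\<^sup>+t. F (t, s) \<partial>lebesgue_on {s..s + h}) * indicator {0..} s" for s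
    by (auto simp: G_def nn_integral_restrict_space indicator_def S_def intro!: nn_integral_cong)
  have t: "(\<integral>\<^sup>+s. G (t, s) \<partial>lebesgue) = (\<integral>\<^sup>+s. F (t, s) \<partial>lebesgue_on {max 0 (t - h)..t}) * indicator {0..} t" for t
  proof (cases "0 \<le> t")
    case True
    then show ?thesis
      by (auto simp: G_def nn_integral_restrict_space indicator_def S_def intro!: nn_integral_cong)
  next
    case False
    then have "G (t, s) = 0" for s by (simp add: G_def S_def)
    then show ?thesis using False by simp
  qed
  have d: "(\<integral>\<^sup>+s. G (d + s, s) \<partial>lebesgue)
      = (\<integral>\<^sup>+s. F (s + d, s) \<partial>lebesgue_on {0..}) * indicator {0..h} d" for d
    by (auto simp: G_def nn_integral_restrict_space indicator_def S_def add.commute intro!: nn_integral_cong)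
  have D: "(\<integral>\<^sup>+d. \<integral>\<^sup>+s. F (s + d, s) \<partial>lebesgue_on {0..} \<partial>lebesgue_on {0..h}) = (\<integral>\<^sup>+p. G p \<partial>lebesgue)"
    using nn_integral_lebesgue_prod(1)[OF H] nn_integral_lebesgue_shear[OF G]
    by (simp add: d nn_integral_restrict_space)
  show ?a
    using nn_integral_lebesgue_prod(2)[OF G] unfolding D by (simp add: s nn_integral_restrict_space)
  show ?b
    using nn_integral_lebesgue_prod(1)[OF G] unfolding D by (simp add: t nn_integral_restrict_space)
  show ?c
    using nn_integral_lebesgue_prod(4)[OF G] by (simp add: s borel_measurable_restrict_space_iff_ennreal)
  show ?d
    using nn_integral_lebesgue_prod(3)[OF G] by (simp add: t borel_measurable_restrict_space_iff_ennreal)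
qed

section \<open>Measurability and translation on the half line\<close>

text \<open>
  A subset of Euclidean space is separable, and so is its continuous image.
\<close>

lemma strongly_measurable_continuous_on:
  fixes g :: "'x::euclidean_space \<Rightarrow> 'a::real_normed_vector"
  assumes g: "continuous_on S g" and S: "S \<in> sets lebesgue"
  shows "strongly_measurable (lebesgue_on S) g"
proof -
  obtain T where T: "countable T" "T \<subseteq> S" "S \<subseteq> closure T"
    using separable[of S] by metis
  show ?thesis
  proof (rule strongly_measurableI_dist)
    show "countable (g ` T)" using T by auto
    show "AE x in lebesgue_on S. g x \<in> closure (g ` T)"
    proof (rule AE_I2)
      fix x assume "x \<in> space (lebesgue_on S)"
      then have x: "x \<in> S" by simp
      have "\<exists>t. (\<forall>n. t n \<in> T) \<and> t \<longlonglongrightarrow> x"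
        by (rule closure_sequential[THEN iffD1, OF subsetD[OF T(3) x]])
      then obtain t where t: "\<And>n::nat. t n \<in> T" "t \<longlonglongrightarrow> x" by blast
      have "(\<lambda>n. g (t n)) \<longlonglongrightarrow> g x"
        by (rule continuous_on_tendsto_compose[OF g t(2) x]) (auto intro!: always_eventually subsetD[OF T(2)] t(1))
      moreover have "g (t n) \<in> closure (g ` T)" for n
        using t closure_subset[of "g ` T"] by auto
      ultimately show "g x \<in> closure (g ` T)"
        by (rule closed_sequentially[OF closed_closure, rotated])
    qed
    show "(\<lambda>x. dist (g x) c) \<in> borel_measurable (lebesgue_on S)" for c
      by (intro continuous_imp_measurable_on_sets_lebesgue S continuous_intros g)
  qed
qed

text \<open>
  On the set where a simple function takes the value \<open>c\<close> the composite is \<open>x \<mapsto> A x c\<close>, which is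
  continuous; the general case is a pointwise limit, each \<open>A x\<close> being continuous.
\<close>

lemma strongly_measurable_operator:
  fixes A :: "'x::euclidean_space \<Rightarrow> 'a::real_normed_vector \<Rightarrow> 'b::real_normed_vector"
  assumes S: "S \<in> sets lebesgue"
    and lin: "\<And>x. x \<in> S \<Longrightarrow> bounded_linear (A x)"
    and cont: "\<And>c. continuous_on S (\<lambda>x. A x c)"
    and f: "strongly_measurable (lebesgue_on S) f"
  shows "strongly_measurable (lebesgue_on S) (\<lambda>x. A x (f x))"
proof -
  interpret C: complete_measure "lebesgue_on S" by (rule complete_lebesgue_on[OF S])
  obtain \<sigma> where \<sigma>: "\<And>i::nat. simple_function (lebesgue_on S) (\<sigma> i)"
    "AE x in lebesgue_on S. (\<lambda>i. \<sigma> i x) \<longlonglongrightarrow> f x"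
    using f unfolding strongly_measurable_def by blast
  show ?thesis
  proof (rule C.strongly_measurable_LIMSEQ)
    fix i
    let ?V = "\<sigma> i ` S"
    have fin: "finite ?V" using simple_functionD(1)[OF \<sigma>(1)[of i]] by simp
    have "strongly_measurable (lebesgue_on S) (\<lambda>x. \<Sum>c\<in>?V. indicator (\<sigma> i -` {c} \<inter> S) x *\<^sub>R A x c)"
    proof (intro strongly_measurable_sum strongly_measurable_scaleR strongly_measurable_continuous_on cont S)
      fix c
      show "indicat_real (\<sigma> i -` {c} \<inter> S) \<in> borel_measurable (lebesgue_on S)"
        using simple_functionD(2)[OF \<sigma>(1)[of i], of "{c}"] by (intro borel_measurable_indicator) simp
    qed
    then show "strongly_measurable (lebesgue_on S) (\<lambda>x. A x (\<sigma> i x))"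
    proof (rule strongly_measurable_cong_AE, intro AE_I2)
      fix x assume "x \<in> space (lebesgue_on S)"
      then have x: "x \<in> S" by simp
      have "(\<Sum>c\<in>?V. indicator (\<sigma> i -` {c} \<inter> S) x *\<^sub>R A x c) = (\<Sum>c\<in>?V. if \<sigma> i x = c then A x c else 0)"
        using x by (intro sum.cong) (auto simp: indicator_def)
      also have "\<dots> = A x (\<sigma> i x)" using x fin by (simp add: sum.delta')
      finally show "(\<Sum>c\<in>?V. indicator (\<sigma> i -` {c} \<inter> S) x *\<^sub>R A x c) = A x (\<sigma> i x)" .
    qed
  next
    show "AE x in lebesgue_on S. (\<lambda>i. A x (\<sigma> i x)) \<longlonglongrightarrow> A x (f x)"
      using \<sigma>(2) AE_space
      by eventually_elim (use lin in \<open>auto intro: bounded_linear.tendsto\<close>)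
  qed
qed

abbreviation halfline :: "real measure" where "halfline \<equiv> lebesgue_on {0..}"

lemma complete_halfline: "complete_measure halfline"
  by (rule complete_lebesgue_on) simp

lemma L1_iff: "f \<in> L1 \<longleftrightarrow> strongly_integrable halfline f"
  by (simp add: L1_def L1_norm_def strongly_integrable_def)

lemma AE_halfline_iff: "(AE s in halfline. P s) \<longleftrightarrow> (AE s in lebesgue. 0 \<le> s \<longrightarrow> P s)"
  by (simp add: AE_restrict_space_iff)

lemma strongly_measurable_halfline_shift:
  assumes f: "strongly_measurable halfline f" and h: "0 \<le> h"
  shows "strongly_measurable halfline (\<lambda>s. f (s + h))"
  by (rule strongly_measurable_pullback[OF nonsingular_translation f]) (use h in auto)

lemma borel_measurable_halfline_shift:
  fixes g :: "real \<Rightarrow> ennreal"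
  assumes g: "g \<in> borel_measurable halfline" and h: "0 \<le> h"
  shows "(\<lambda>s. g (s + h)) \<in> borel_measurable halfline"
proof (rule measurable_compose[OF _ g])
  show "(\<lambda>s. s + h) \<in> halfline \<rightarrow>\<^sub>M halfline"
    using h nonsingular_translation[of h] by (intro measurable_restrict_space3) (auto simp: nonsingular_def)
qed

lemma nn_integral_halfline_shift:
  fixes g :: "real \<Rightarrow> ennreal"
  assumes g: "g \<in> borel_measurable halfline" and h: "0 \<le> h"
  shows "(\<integral>\<^sup>+s. g (s + h) \<partial>halfline) = (\<integral>\<^sup>+s. g s \<partial>lebesgue_on {h..})"
proof -
  have m: "(\<lambda>s. g s * indicator {0..} s) \<in> borel_measurable lebesgue"
    using g by (simp add: borel_measurable_restrict_space_iff_ennreal)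
  have "(\<lambda>s. (g s * indicator {0..} s) * indicator {h..} s) \<in> borel_measurable lebesgue"
    by (rule borel_measurable_times_ennreal[OF m borel_measurable_indicator]) simp
  also have "(\<lambda>s. (g s * indicator {0..} s) * indicator {h..} s) = (\<lambda>s. g s * indicator {h..} s)"
    using h by (intro ext) (auto simp: indicator_def)
  finally have "(\<integral>\<^sup>+s. g (s + h) * indicator {h..} (s + h) \<partial>lebesgue) = (\<integral>\<^sup>+s. g s * indicator {h..} s \<partial>lebesgue)"
    by (rule nn_integral_translation)
  moreover have "(\<integral>\<^sup>+s. g (s + h) * indicator {h..} (s + h) \<partial>lebesgue) = (\<integral>\<^sup>+s. g (s + h) * indicator {0..} s \<partial>lebesgue)"
    by (intro nn_integral_cong) (auto simp: indicator_def)
  ultimately show ?thesis by (simp add: nn_integral_restrict_space)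
qed

lemma nn_integral_halfline_shift_le:
  fixes g :: "real \<Rightarrow> ennreal"
  assumes g: "g \<in> borel_measurable halfline" and h: "0 \<le> h"
  shows "(\<integral>\<^sup>+s. g (s + h) \<partial>halfline) \<le> (\<integral>\<^sup>+s. g s \<partial>halfline)"
  unfolding nn_integral_halfline_shift[OF assms]
  by (rule nn_integral_lebesgue_on_mono_set) (use h in auto)

lemma nn_integral_dominated_convergence_at_right:
  fixes u :: "real \<Rightarrow> 'x \<Rightarrow> ennreal"
  assumes m: "\<And>h. 0 < h \<Longrightarrow> u h \<in> borel_measurable M" and w: "w \<in> borel_measurable M"
    and bound: "\<And>h. 0 < h \<Longrightarrow> AE x in M. u h x \<le> w x" and fin: "(\<integral>\<^sup>+x. w x \<partial>M) < \<infinity>"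
    and lim: "AE x in M. ((\<lambda>h. u h x) \<longlongrightarrow> 0) (at_right 0)"
  shows "((\<lambda>h. \<integral>\<^sup>+x. u h x \<partial>M) \<longlongrightarrow> 0) (at_right 0)"
proof (rule tendsto_at_right_sequentially[of 0 1])
  fix S :: "nat \<Rightarrow> real" assume S: "\<And>n. 0 < S n" "S \<longlonglongrightarrow> 0"
  have S': "filterlim S (at_right 0) sequentially"
    using S(2) less_imp_neq[OF S(1)] S(1) by (simp add: filterlim_at always_eventually)
  have "(\<lambda>n. \<integral>\<^sup>+x. u (S n) x \<partial>M) \<longlonglongrightarrow> (\<integral>\<^sup>+x. 0 \<partial>M)"
  proof (rule nn_integral_dominated_convergence[where w = w])
    show "AE x in M. (\<lambda>n. u (S n) x) \<longlonglongrightarrow> 0"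
      using lim by eventually_elim (rule filterlim_compose[OF _ S'])
  qed (use m w bound fin S in auto)
  then show "(\<lambda>n. \<integral>\<^sup>+x. u (S n) x \<partial>M) \<longlonglongrightarrow> 0" by simp
qed simp

lemma ennreal_tendsto_zero_approx:
  fixes \<Phi> :: "real \<Rightarrow> ennreal"
  assumes "\<And>e::real. 0 < e \<Longrightarrow> \<exists>\<Psi>. (\<Psi> \<longlongrightarrow> 0) F \<and> (\<forall>\<^sub>F h in F. \<Phi> h \<le> \<Psi> h + ennreal e)"
  shows "(\<Phi> \<longlongrightarrow> 0) F"
proof (rule order_tendstoI)
  fix a :: ennreal assume "0 < a"
  then obtain b where b: "0 < b" "b < a" using dense by blast
  then obtain e where e: "b = ennreal (2 * e)" "0 < e"
    by (cases b) (auto intro: that[of "_ / 2"] simp: ennreal_less_zero_iff)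
  obtain \<Psi> where \<Psi>: "(\<Psi> \<longlongrightarrow> 0) F" "\<forall>\<^sub>F h in F. \<Phi> h \<le> \<Psi> h + ennreal e"
    using assms[OF e(2)] by blast
  have "\<forall>\<^sub>F h in F. \<Psi> h < ennreal e"
    using \<Psi>(1) e(2) by (intro order_tendstoD) auto
  with \<Psi>(2) show "\<forall>\<^sub>F h in F. \<Phi> h < a"
  proof eventually_elim
    case (elim h)
    have "\<Phi> h \<le> ennreal e + ennreal e"
      by (rule order_trans[OF elim(1) add_right_mono[OF less_imp_le[OF elim(2)]]])
    also have "\<dots> = b" using e by (simp flip: ennreal_plus)
    finally show ?case using b by simp
  qed
qed simp

lemma ennreal_tendsto_zero_mono:
  fixes \<Phi> \<Psi> :: "real \<Rightarrow> ennreal"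
  assumes "(\<Psi> \<longlongrightarrow> 0) F" "\<forall>\<^sub>F h in F. \<Phi> h \<le> \<Psi> h"
  shows "(\<Phi> \<longlongrightarrow> 0) F"
  by (rule tendsto_sandwich[OF _ assms(2) tendsto_const assms(1)]) simp

text \<open>
  Choose a closed \<open>T\<close> and an open \<open>V\<close> with \<open>T \<subseteq> A \<subseteq> V\<close> and little measure in between. Up to twice the measure of
  \<open>V - T\<close>, the indicators of \<open>A\<close> and of its translate differ only where one of the points \<open>s\<close>, \<open>s + h\<close> is in
  \<open>T\<close> and the other outside \<open>V\<close>; for each given point of \<open>T\<close> this ceases to happen once \<open>h\<close> is small.
\<close>

lemma indicator_translation_continuous:
  assumes A: "A \<in> sets lebesgue" and fin: "emeasure lebesgue A < \<infinity>"
  shows "((\<lambda>h. \<integral>\<^sup>+s. ennreal \<bar>indicator A s - indicator A (s + h)\<bar> \<partial>lebesgue) \<longlongrightarrow> 0) (at_right (0::real))"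
proof (rule ennreal_tendsto_zero_approx)
  fix e :: real assume e: "0 < e"
  have e4: "0 < e / 4" using e by simp
  obtain V where V: "open V" "A \<subseteq> V" "emeasure lebesgue (V - A) < ennreal (e / 4)"
    by (rule sets_lebesgue_outer_open[OF A e4]) (rule that)
  obtain T where T: "closed T" "T \<subseteq> A" "emeasure lebesgue (A - T) < ennreal (e / 4)"
    by (rule sets_lebesgue_inner_closed[OF A e4]) (rule that)
  have Vm [measurable]: "V \<in> sets lebesgue" and Tm [measurable]: "T \<in> sets lebesgue"
    using V T borel_open borel_closed by auto
  note A [measurable]
  have Tfin: "emeasure lebesgue T < \<infinity>"
    using emeasure_mono[OF T(2) A] fin by (rule le_less_trans)
  have [measurable]: "(\<lambda>x::real. x + c) \<in> lebesgue \<rightarrow>\<^sub>M lebesgue" for c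
    using nonsingular_translation[of c] by (simp add: nonsingular_def)
  have lim: "((\<lambda>h. \<integral>\<^sup>+s. indicator T s * indicator (- V) (s + c * h) \<partial>lebesgue) \<longlongrightarrow> 0) (at_right (0::real))" for c
  proof (rule nn_integral_dominated_convergence_at_right[where w = "indicator T"])
    show "(\<lambda>s. indicator T s * indicator (- V) (s + c * h) :: ennreal) \<in> borel_measurable lebesgue" for h
      by measurable
    show "AE s in lebesgue. ((\<lambda>h. indicator T s * indicator (- V) (s + c * h) :: ennreal) \<longlongrightarrow> 0) (at_right 0)"
    proof (rule AE_I2)
      fix s
      show "((\<lambda>h. indicator T s * indicator (- V) (s + c * h) :: ennreal) \<longlongrightarrow> 0) (at_right 0)"
      proof (cases "s \<in> T")
        case True
        have "((\<lambda>h. s + c * h) \<longlongrightarrow> s + c * 0) (at_right 0)" by (intro tendsto_intros)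
        then have "\<forall>\<^sub>F h in at_right 0. s + c * h \<in> V"
          using True T V by (intro topological_tendstoD) auto
        then have "\<forall>\<^sub>F h in at_right 0. indicator T s * indicator (- V) (s + c * h) = (0::ennreal)"
          by eventually_elim simp
        then show ?thesis by (rule tendsto_eventually)
      qed simp
    qed
    show "AE s in lebesgue. indicator T s * indicator (- V) (s + c * h) \<le> (indicator T s :: ennreal)" for h
      by (intro AE_I2) (auto simp: indicator_def)
    show "(\<integral>\<^sup>+s. indicator T s \<partial>lebesgue) < \<infinity>" using Tfin by simp
  qed simp
  let ?\<Psi> = "\<lambda>h. (\<integral>\<^sup>+s. indicator T s * indicator (- V) (s + 1 * h) \<partial>lebesgue)
      + (\<integral>\<^sup>+s. indicator T s * indicator (- V) (s + (-1) * h) \<partial>lebesgue) :: ennreal"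
  have "(\<integral>\<^sup>+s. ennreal \<bar>indicator A s - indicator A (s + h)\<bar> \<partial>lebesgue) \<le> ?\<Psi> h + ennreal e" for h
  proof -
    have "(\<integral>\<^sup>+s. ennreal \<bar>indicator A s - indicator A (s + h)\<bar> \<partial>lebesgue)
      \<le> (\<integral>\<^sup>+s. (indicator T s * indicator (- V) (s + h) + indicator T (s + h) * indicator (- V) s)
         + ((indicator (A - T) s + indicator (V - A) s)
         + (indicator (A - T) (s + h) + indicator (V - A) (s + h))) \<partial>lebesgue)"
      using T(2) V(2) by (intro nn_integral_mono) (auto simp: indicator_def)
    also have "\<dots> = ((\<integral>\<^sup>+s. indicator T s * indicator (- V) (s + h) \<partial>lebesgue)
        + (\<integral>\<^sup>+s. indicator T (s + h) * indicator (- V) s \<partial>lebesgue))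
        + (((\<integral>\<^sup>+s. indicator (A - T) s \<partial>lebesgue) + (\<integral>\<^sup>+s. indicator (V - A) s \<partial>lebesgue))
        + ((\<integral>\<^sup>+s. indicator (A - T) (s + h) \<partial>lebesgue) + (\<integral>\<^sup>+s. indicator (V - A) (s + h) \<partial>lebesgue)))"
      by (simp add: nn_integral_add)
    also have "(\<integral>\<^sup>+s. indicator T (s + h) * indicator (- V) s \<partial>lebesgue)
        = (\<integral>\<^sup>+s. indicator T s * indicator (- V) (s + (-1) * h) \<partial>lebesgue)"
    proof -
      have m: "(\<lambda>s. indicator T s * indicator (- V) (s + (-1) * h) :: ennreal) \<in> borel_measurable lebesgue"
        by measurable
      show ?thesis using nn_integral_translation[OF m, of h] by simp
    qed
    also have "(\<integral>\<^sup>+s. indicator (A - T) (s + h) \<partial>lebesgue) = emeasure lebesgue (A - T)"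
      by (subst nn_integral_translation) auto
    also have "(\<integral>\<^sup>+s. indicator (V - A) (s + h) \<partial>lebesgue) = emeasure lebesgue (V - A)"
      by (subst nn_integral_translation) auto
    also have "(\<integral>\<^sup>+s. indicator (A - T) s \<partial>lebesgue) = emeasure lebesgue (A - T)" by simp
    also have "(\<integral>\<^sup>+s. indicator (V - A) s \<partial>lebesgue) = emeasure lebesgue (V - A)" by simp
    also have "(\<integral>\<^sup>+s. indicator T s * indicator (- V) (s + h) \<partial>lebesgue)
        = (\<integral>\<^sup>+s. indicator T s * indicator (- V) (s + 1 * h) \<partial>lebesgue)" by simp
    also have "?\<Psi> h + ((emeasure lebesgue (A - T) + emeasure lebesgue (V - A))
        + (emeasure lebesgue (A - T) + emeasure lebesgue (V - A)))
      \<le> ?\<Psi> h + ((ennreal (e / 4) + ennreal (e / 4)) + (ennreal (e / 4) + ennreal (e / 4)))"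
      using T(3) V(3) by (intro add_mono order_refl less_imp_le)
    also have "\<dots> = ?\<Psi> h + ennreal e"
      using e by (simp flip: ennreal_plus)
    finally show ?thesis by simp
  qed
  moreover have "(?\<Psi> \<longlongrightarrow> 0 + 0) (at_right 0)"
    by (intro tendsto_add lim)
  ultimately show "\<exists>\<Psi>. (\<Psi> \<longlongrightarrow> 0) (at_right 0) \<and> (\<forall>\<^sub>F h in at_right 0.
      (\<integral>\<^sup>+s. ennreal \<bar>indicator A s - indicator A (s + h)\<bar> \<partial>lebesgue) \<le> \<Psi> h + ennreal e)"
    by (intro exI[of _ ?\<Psi>]) auto
qed

section \<open>Bounded evolution families\<close>

text \<open>
  The family \<open>U\<close>, its damped version, and the family of identity operators are all instances. The bound
  is uniform in time, as it is for a family that contracts the norm of positive elements.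
\<close>

locale bounded_evolution =
  fixes U :: "real \<Rightarrow> real \<Rightarrow> 'a::banach \<Rightarrow> 'a" and K :: real
  assumes evolution: "evolution_family U"
    and K_ge_1: "1 \<le> K"
    and norm_le: "0 \<le> s \<Longrightarrow> s \<le> t \<Longrightarrow> norm (U t s u) \<le> K * norm u"
begin

lemma linear: "0 \<le> s \<Longrightarrow> s \<le> t \<Longrightarrow> bounded_linear (U t s)"
  using evolution by (simp add: evolution_family_def)

lemma continuous_Delta: "continuous_on Delta (\<lambda>p. U (fst p) (snd p) u)"
  using evolution by (simp add: evolution_family_def case_prod_beta)

lemma cocycle: "0 \<le> s \<Longrightarrow> s \<le> r \<Longrightarrow> r \<le> t \<Longrightarrow> U t r (U r s u) = U t s u"
  using evolution by (simp add: evolution_family_def)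

lemma refl: "0 \<le> t \<Longrightarrow> U t t u = u"
  using evolution by (simp add: evolution_family_def)

lemma continuous_shift: "0 \<le> h \<Longrightarrow> continuous_on {0..} (\<lambda>s. U (s + h) s u)"
proof -
  assume h: "0 \<le> h"
  have "continuous_on {0..} ((\<lambda>p. U (fst p) (snd p) u) \<circ> (\<lambda>s. (s + h, s)))"
    using h by (intro continuous_on_compose continuous_intros continuous_on_subset[OF continuous_Delta])
      (auto simp: Delta_def)
  then show ?thesis by (simp add: o_def)
qed

lemma continuous_start: "continuous_on {0..t} (\<lambda>r. U t r u)"
proof -
  have "continuous_on {0..t} ((\<lambda>p. U (fst p) (snd p) u) \<circ> (\<lambda>r. (t, r)))"
    by (intro continuous_on_compose continuous_intros continuous_on_subset[OF continuous_Delta])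
      (auto simp: Delta_def)
  then show ?thesis by (simp add: o_def)
qed

lemma continuous_end: "0 \<le> s \<Longrightarrow> continuous_on {s..} (\<lambda>t. U t s u)"
proof -
  assume "0 \<le> s"
  then have "continuous_on {s..} ((\<lambda>p. U (fst p) (snd p) u) \<circ> (\<lambda>t. (t, s)))"
    by (intro continuous_on_compose continuous_intros continuous_on_subset[OF continuous_Delta])
      (auto simp: Delta_def)
  then show ?thesis by (simp add: o_def)
qed

lemma strongly_measurable_start:
  assumes "strongly_measurable (lebesgue_on S) f" "S \<in> sets lebesgue" "S \<subseteq> {0..t}"
  shows "strongly_measurable (lebesgue_on S) (\<lambda>r. U t r (f r))"
  using assms(3) by (intro strongly_measurable_operator[OF assms(2) _ _ assms(1)] linear
      continuous_on_subset[OF continuous_start]) auto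

lemma strongly_measurable_shift:
  assumes "strongly_measurable halfline f" "0 \<le> h"
  shows "strongly_measurable halfline (\<lambda>s. U (s + h) s (f s))"
  using assms(2) by (intro strongly_measurable_operator[OF _ _ _ assms(1)] linear continuous_shift) auto

lemma strongly_measurable_Delta_operator:
  assumes "strongly_measurable (lebesgue_on Delta) f"
  shows "strongly_measurable (lebesgue_on Delta) (\<lambda>p. U (fst p) (snd p) (f p))"
  by (intro strongly_measurable_operator[OF Delta_lebesgue _ continuous_Delta assms] linear) (auto simp: Delta_def)

text \<open>
  How far \<open>f\<close> is from being transported along by \<open>U\<close>. For the family of identity operators this is the
  modulus of continuity of translation in \<open>L\<^sup>1\<close>.
\<close>

definition drift :: "(real \<Rightarrow> 'a) \<Rightarrow> real \<Rightarrow> ennreal" where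
  "drift f h = (nint halfline (\<lambda>s. U (s + h) s (f s) - f (s + h)))"

lemma strongly_measurable_drift:
  assumes "strongly_measurable halfline f" "0 \<le> h"
  shows "strongly_measurable halfline (\<lambda>s. U (s + h) s (f s) - f (s + h))"
  by (intro strongly_measurable_diff strongly_measurable_shift strongly_measurable_halfline_shift assms)

lemma drift_add_le:
  assumes f: "strongly_measurable halfline f" and g: "strongly_measurable halfline g" and h: "0 \<le> h"
  shows "drift (\<lambda>s. f s + g s) h \<le> drift f h + drift g h"
proof -
  interpret H: complete_measure halfline by (rule complete_halfline)
  have "drift (\<lambda>s. f s + g s) h
    = (nint halfline (\<lambda>s. (U (s + h) s (f s) - f (s + h)) + (U (s + h) s (g s) - g (s + h))))"
    unfolding drift_def
  proof (rule nn_integral_cong)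
    fix s assume "s \<in> space halfline"
    then have "U (s + h) s (f s + g s) = U (s + h) s (f s) + U (s + h) s (g s)"
      using h by (intro linear_add bounded_linear.linear linear) auto
    then show "ennreal (norm (U (s + h) s (f s + g s) - (f (s + h) + g (s + h))))
      = ennreal (norm ((U (s + h) s (f s) - f (s + h)) + (U (s + h) s (g s) - g (s + h))))"
      by (simp add: algebra_simps)
  qed
  also have "\<dots> \<le> drift f h + drift g h"
    unfolding drift_def by (intro H.nn_integral_norm_add_le strongly_measurable_drift f g h)
  finally show ?thesis .
qed

lemma drift_le:
  assumes f: "strongly_measurable halfline f" and h: "0 \<le> h"
  shows "drift f h \<le> ennreal (K + 1) * L1_norm f"
proof -
  interpret H: complete_measure halfline by (rule complete_halfline)
  have fm [measurable]: "(\<lambda>s. ennreal (norm (f s))) \<in> borel_measurable halfline"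
    using H.strongly_measurable_norm[OF f] by simp
  have [measurable]: "(\<lambda>s. ennreal (norm (f (s + h)))) \<in> borel_measurable halfline"
    by (rule borel_measurable_halfline_shift[OF fm h])
  have "drift f h \<le> (\<integral>\<^sup>+s. ennreal K * ennreal (norm (f s)) + ennreal (norm (f (s + h))) \<partial>halfline)"
    unfolding drift_def
  proof (rule nn_integral_mono)
    fix s assume s: "s \<in> space halfline"
    have "norm (U (s + h) s (f s) - f (s + h)) \<le> K * norm (f s) + norm (f (s + h))"
      using s h norm_triangle_ineq4[of "U (s + h) s (f s)" "f (s + h)"] norm_le[of s "s + h" "f s"] by simp
    then show "ennreal (norm (U (s + h) s (f s) - f (s + h)))
        \<le> ennreal K * ennreal (norm (f s)) + ennreal (norm (f (s + h)))"
      using K_ge_1 by (simp add: ennreal_leI flip: ennreal_mult ennreal_plus)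
  qed
  also have "\<dots> = ennreal K * L1_norm f + (nint halfline (\<lambda>s. f (s + h)))"
    unfolding L1_norm_def nn_integral_cmult[OF fm, symmetric] by (rule nn_integral_add) measurable
  also have "\<dots> \<le> ennreal K * L1_norm f + L1_norm f"
    unfolding L1_norm_def
    by (intro add_left_mono nn_integral_halfline_shift_le[of "\<lambda>s. ennreal (norm (f s))"] h) measurable
  also have "\<dots> = ennreal (K + 1) * L1_norm f"
    using K_ge_1 by (simp add: ennreal_plus distrib_right)
  finally show ?thesis .
qed

text \<open>
  The drift of \<open>indicator A s *\<^sub>R c\<close> splits into \<open>U (s + h) s c - c\<close> on \<open>A\<close>, which tends to 0 by strong continuity
  and domination, and into \<open>c\<close> times the difference between the indicator of \<open>A\<close> and its translate.
\<close>

lemma drift_indicator_tendsto_0: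
  assumes A: "A \<in> sets lebesgue" and fin: "emeasure lebesgue A < \<infinity>"
  shows "(drift (\<lambda>s. indicator A s *\<^sub>R c) \<longlongrightarrow> 0) (at_right 0)"
proof (rule ennreal_tendsto_zero_mono)
  interpret H: complete_measure halfline by (rule complete_halfline)
  note A[measurable]
  have Am: "(indicator A :: real \<Rightarrow> ennreal) \<in> borel_measurable halfline"
    by (rule measurable_restrict_space1) simp
  let ?u = "\<lambda>h s. indicator A s * ennreal (norm (U (s + h) s c - c))"
  have um: "?u h \<in> borel_measurable halfline" if "0 < h" for h
  proof -
    have "(\<lambda>s. norm (U (s + h) s c - c)) \<in> borel_measurable halfline"
      using that by (intro H.strongly_measurable_norm strongly_measurable_diff strongly_measurable_const
          strongly_measurable_shift) auto
    then show ?thesis using Am by (intro borel_measurable_times_ennreal) auto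
  qed
  have 1: "((\<lambda>h. \<integral>\<^sup>+s. ?u h s \<partial>halfline) \<longlongrightarrow> 0) (at_right 0)"
  proof (rule nn_integral_dominated_convergence_at_right[OF um, where w = "\<lambda>s. indicator A s * ennreal ((K + 1) * norm c)"])
    show "(\<lambda>s. indicator A s * ennreal ((K + 1) * norm c)) \<in> borel_measurable halfline"
      using Am by (intro borel_measurable_times_ennreal) auto
    show "AE s in halfline. ?u h s \<le> indicator A s * ennreal ((K + 1) * norm c)" if "0 < h" for h
    proof (rule AE_I2)
      fix s assume "s \<in> space halfline"
      then have "norm (U (s + h) s c - c) \<le> (K + 1) * norm c"
        using that norm_triangle_ineq4[of "U (s + h) s c" c] norm_le[of s "s + h" c] by (simp add: algebra_simps)
      then show "?u h s \<le> indicator A s * ennreal ((K + 1) * norm c)"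
        by (intro mult_left_mono ennreal_leI) auto
    qed
    have "(\<integral>\<^sup>+s. indicator A s * ennreal ((K + 1) * norm c) \<partial>halfline)
        \<le> (\<integral>\<^sup>+s. indicator A s * ennreal ((K + 1) * norm c) \<partial>lebesgue)"
      using nn_integral_lebesgue_on_mono_set[of "{0..}" UNIV "\<lambda>s. indicator A s * ennreal ((K + 1) * norm c)"] by (simp add: lebesgue_on_UNIV_eq)
    also have "\<dots> < \<infinity>"
      using fin by (simp add: nn_integral_multc ennreal_mult_less_top)
    finally show "(\<integral>\<^sup>+s. indicator A s * ennreal ((K + 1) * norm c) \<partial>halfline) < \<infinity>" .
    show "AE s in halfline. ((\<lambda>h. ?u h s) \<longlongrightarrow> 0) (at_right 0)"
    proof (rule AE_I2)
      fix s assume "s \<in> space halfline"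
      then have s: "0 \<le> s" by simp
      have "((\<lambda>t. U t s c) \<longlongrightarrow> U s s c) (at s within {s..})"
        using continuous_end[OF s, of c] by (simp add: continuous_on_def)
      then have "((\<lambda>h. U (s + h) s c) \<longlongrightarrow> U s s c) (at_right 0)"
      proof (rule filterlim_compose)
        show "filterlim (\<lambda>h. s + h) (at s within {s..}) (at_right 0)"
          unfolding filterlim_at
        proof
          show "\<forall>\<^sub>F h in at_right 0. s + h \<in> {s..} \<and> s + h \<noteq> s"
            by (auto simp: eventually_at_right_field intro!: exI[of _ 1])
          have "((\<lambda>h. s + h) \<longlongrightarrow> s + 0) (at_right 0)" by (intro tendsto_intros)
          then show "((\<lambda>h. s + h) \<longlongrightarrow> s) (at_right 0)" by simp
        qed
      qed
      then have "((\<lambda>h. ennreal (norm (U (s + h) s c - c))) \<longlongrightarrow> ennreal (norm (U s s c - c))) (at_right 0)"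
        by (intro tendsto_intros)
      then have "((\<lambda>h. ennreal (norm (U (s + h) s c - c))) \<longlongrightarrow> 0) (at_right 0)"
        using refl[OF s] by simp
      from ennreal_tendsto_cmult[OF _ this, of "indicator A s"]
      show "((\<lambda>h. ?u h s) \<longlongrightarrow> 0) (at_right 0)" by (auto simp: indicator_def)
    qed
  qed
  let ?v = "\<lambda>h s. ennreal \<bar>indicator A s - indicator A (s + h)\<bar>"
  have vm: "?v h \<in> borel_measurable lebesgue" for h
  proof -
    have [measurable]: "(\<lambda>x::real. x + h) \<in> lebesgue \<rightarrow>\<^sub>M lebesgue"
      using nonsingular_translation[of h] by (simp add: nonsingular_def)
    show ?thesis by measurable
  qed
  have 2: "((\<lambda>h. (\<integral>\<^sup>+s. ?u h s \<partial>halfline) + ennreal (norm c) * (\<integral>\<^sup>+s. ?v h s \<partial>lebesgue))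
      \<longlongrightarrow> 0 + ennreal (norm c) * 0) (at_right 0)"
    by (intro tendsto_add 1 ennreal_tendsto_cmult indicator_translation_continuous A fin) auto
  then show "((\<lambda>h. (\<integral>\<^sup>+s. ?u h s \<partial>halfline) + ennreal (norm c) * (\<integral>\<^sup>+s. ?v h s \<partial>lebesgue)) \<longlongrightarrow> 0) (at_right 0)"
    by simp
  show "\<forall>\<^sub>F h in at_right 0. drift (\<lambda>s. indicator A s *\<^sub>R c) h
      \<le> (\<integral>\<^sup>+s. ?u h s \<partial>halfline) + ennreal (norm c) * (\<integral>\<^sup>+s. ?v h s \<partial>lebesgue)"
    using eventually_at_right_less
  proof eventually_elim
    case (elim h)
    have "drift (\<lambda>s. indicator A s *\<^sub>R c) h \<le> (\<integral>\<^sup>+s. ?u h s + ennreal (norm c) * ?v h s \<partial>halfline)"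
      unfolding drift_def
    proof (rule nn_integral_mono)
      fix s assume "s \<in> space halfline"
      then interpret L: bounded_linear "U (s + h) s" using elim by (intro linear) auto
      have "norm (U (s + h) s (indicator A s *\<^sub>R c) - indicator A (s + h) *\<^sub>R c)
        = norm (indicator A s *\<^sub>R (U (s + h) s c - c) + (indicator A s - indicator A (s + h)) *\<^sub>R c)"
        unfolding L.scaleR by (simp add: scaleR_diff_left scaleR_diff_right)
      also have "\<dots> \<le> indicator A s * norm (U (s + h) s c - c) + norm c * \<bar>indicator A s - indicator A (s + h)\<bar>"
        by (rule order_trans[OF norm_triangle_ineq]) (simp add: mult.commute)
      finally have "ennreal (norm (U (s + h) s (indicator A s *\<^sub>R c) - indicator A (s + h) *\<^sub>R c))
        \<le> ennreal (indicator A s * norm (U (s + h) s c - c) + norm c * \<bar>indicator A s - indicator A (s + h)\<bar>)"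
        by (rule ennreal_leI)
      also have "\<dots> = ?u h s + ennreal (norm c) * ?v h s"
        by (simp add: ennreal_mult ennreal_indicator)
      finally show "ennreal (norm (U (s + h) s (indicator A s *\<^sub>R c) - indicator A (s + h) *\<^sub>R c))
        \<le> ?u h s + ennreal (norm c) * ?v h s" .
    qed
    also have "\<dots> = (\<integral>\<^sup>+s. ?u h s \<partial>halfline) + ennreal (norm c) * (\<integral>\<^sup>+s. ?v h s \<partial>halfline)"
      using measurable_restrict_space1[OF vm[of h], of "{0..}"] um[OF elim]
      by (simp add: nn_integral_add nn_integral_cmult)
    also have "\<dots> \<le> (\<integral>\<^sup>+s. ?u h s \<partial>halfline) + ennreal (norm c) * (\<integral>\<^sup>+s. ?v h s \<partial>lebesgue)"
      using nn_integral_lebesgue_on_mono_set[of "{0..}" UNIV "?v h"]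
      by (intro add_left_mono mult_left_mono) (auto simp: lebesgue_on_UNIV_eq)
    finally show ?case .
  qed
qed

lemma drift_simple_tendsto_0:
  assumes "finite C" "\<And>c. c \<in> C \<Longrightarrow> A c \<in> sets lebesgue" "\<And>c. c \<in> C \<Longrightarrow> emeasure lebesgue (A c) < \<infinity>"
  shows "(drift (\<lambda>s. \<Sum>c\<in>C. indicator (A c) s *\<^sub>R c) \<longlongrightarrow> 0) (at_right 0)"
  using assms
proof (induction C)
  case empty
  have "drift (\<lambda>s. 0) h = 0" if "0 < h" for h
  proof -
    have "drift (\<lambda>s. 0) h = (\<integral>\<^sup>+s. 0 \<partial>halfline)"
      unfolding drift_def
      using linear_0[OF bounded_linear.linear[OF linear]] that by (intro nn_integral_cong) simp
    then show ?thesis by simp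
  qed
  then have "\<forall>\<^sub>F h in at_right 0. drift (\<lambda>s. 0) h = 0"
    using eventually_at_right_less[of "0::real"] by (rule eventually_mono[rotated])
  then show ?case by (simp add: tendsto_eventually)
next
  case (insert c C)
  have m: "strongly_measurable halfline (\<lambda>s. indicator (A d) s *\<^sub>R d)" if "d \<in> insert c C" for d
    using insert.prems(1)[OF that]
    by (intro strongly_measurable_scaleR strongly_measurable_const) (auto intro: measurable_restrict_space1)
  have lim: "((\<lambda>h. drift (\<lambda>s. indicator (A c) s *\<^sub>R c) h + drift (\<lambda>s. \<Sum>c\<in>C. indicator (A c) s *\<^sub>R c) h)
      \<longlongrightarrow> 0 + 0) (at_right 0)"
    using insert by (intro tendsto_add drift_indicator_tendsto_0) auto
  show ?case
  proof (rule ennreal_tendsto_zero_mono)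
    show "((\<lambda>h. drift (\<lambda>s. indicator (A c) s *\<^sub>R c) h + drift (\<lambda>s. \<Sum>c\<in>C. indicator (A c) s *\<^sub>R c) h)
      \<longlongrightarrow> 0) (at_right 0)" using lim by simp
    show "\<forall>\<^sub>F h in at_right 0. drift (\<lambda>s. \<Sum>c\<in>insert c C. indicator (A c) s *\<^sub>R c) h
      \<le> drift (\<lambda>s. indicator (A c) s *\<^sub>R c) h + drift (\<lambda>s. \<Sum>c\<in>C. indicator (A c) s *\<^sub>R c) h"
      using eventually_at_right_less
    proof eventually_elim
      case (elim h)
      then show ?case
        unfolding sum.insert[OF insert(1,2)]
        by (intro drift_add_le strongly_measurable_sum m) auto
    qed
  qed
qed

text \<open>
  The drift is subadditive in \<open>f\<close> and bounded by a multiple of the \<open>L\<^sup>1\<close> norm, so that the limit extends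
  from simple functions to all integrable ones.
\<close>

lemma drift_tendsto_0:
  assumes f: "f \<in> L1"
  shows "(drift f \<longlongrightarrow> 0) (at_right 0)"
proof (rule ennreal_tendsto_zero_approx)
  interpret H: complete_measure halfline by (rule complete_halfline)
  fix e :: real assume e: "0 < e"
  obtain \<sigma> where fm: "strongly_measurable halfline f" and \<sigma>: "\<And>i::nat. sb_integrable halfline (\<sigma> i)"
    and lim: "(\<lambda>i. nint halfline (\<lambda>x. f x - \<sigma> i x)) \<longlonglongrightarrow> 0"
    using H.has_strong_integral_exists[of f] f unfolding has_strong_integral_def L1_iff by blast
  have "0 < e / (K + 1)" using e K_ge_1 by simp
  then have "\<forall>\<^sub>F i in sequentially. (nint halfline (\<lambda>x. f x - \<sigma> i x)) < ennreal (e / (K + 1))"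
    by (intro order_tendstoD[OF lim]) auto
  then obtain i where i: "(nint halfline (\<lambda>x. f x - \<sigma> i x)) < ennreal (e / (K + 1))"
    by (auto simp: eventually_sequentially)
  define \<tau> where "\<tau> s = (\<Sum>c\<in>\<sigma> i ` {0..} - {0}. indicator (\<sigma> i -` {c} \<inter> {0..}) s *\<^sub>R c)" for s
  have sf: "simple_function halfline (\<sigma> i)" and fin: "emeasure halfline {y\<in>space halfline. \<sigma> i y \<noteq> 0} \<noteq> \<infinity>"
    using \<sigma>[of i] by (auto simp: simple_bochner_integrable.simps)
  have fC: "finite (\<sigma> i ` {0..} - {0})" using simple_functionD(1)[OF sf] by simp
  have \<tau>: "\<tau> s = \<sigma> i s" if "0 \<le> s" for s
  proof -
    have "\<tau> s = (\<Sum>c\<in>\<sigma> i ` {0..} - {0}. if \<sigma> i s = c then c else 0)"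
      unfolding \<tau>_def using that by (intro sum.cong) (auto simp: indicator_def)
    also have "\<dots> = \<sigma> i s" using fC that by (auto simp: sum.delta')
    finally show ?thesis .
  qed
  have "(drift \<tau> \<longlongrightarrow> 0) (at_right 0)"
    unfolding \<tau>_def
  proof (rule drift_simple_tendsto_0[OF fC])
    fix c assume c: "c \<in> \<sigma> i ` {0..} - {0}"
    have s: "\<sigma> i -` {c} \<inter> {0..} \<in> sets halfline" using simple_functionD(2)[OF sf, of "{c}"] by simp
    then show "\<sigma> i -` {c} \<inter> {0..} \<in> sets lebesgue"
      by (simp add: sets_restrict_space_iff)
    have "emeasure lebesgue (\<sigma> i -` {c} \<inter> {0..}) = emeasure halfline (\<sigma> i -` {c} \<inter> {0..})"
      by (subst emeasure_restrict_space) auto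
    also have "\<dots> \<le> emeasure halfline {y\<in>space halfline. \<sigma> i y \<noteq> 0}"
    proof (rule emeasure_mono)
      have "{y\<in>space halfline. \<sigma> i y \<noteq> 0} = space halfline - \<sigma> i -` {0} \<inter> space halfline" by auto
      then show "{y\<in>space halfline. \<sigma> i y \<noteq> 0} \<in> sets halfline"
        using simple_functionD(2)[OF sf, of "{0}"] by auto
    qed (use c in auto)
    finally show "emeasure lebesgue (\<sigma> i -` {c} \<inter> {0..}) < \<infinity>"
      using fin by (simp add: le_less_trans top.not_eq_extremum)
  qed
  moreover have "\<forall>\<^sub>F h in at_right 0. drift f h \<le> drift \<tau> h + ennreal e"
    using eventually_at_right_less
  proof eventually_elim
    case (elim h)
    have \<tau>m: "strongly_measurable halfline \<tau>"
      by (rule strongly_measurable_cong_AE[OF strongly_measurable_simple[OF sf]]) (auto intro!: AE_I2 simp: \<tau>)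
    have dm: "strongly_measurable halfline (\<lambda>s. f s - \<tau> s)"
      by (rule strongly_measurable_diff[OF fm \<tau>m])
    have "drift f h = drift (\<lambda>s. \<tau> s + (f s - \<tau> s)) h" by simp
    also have "\<dots> \<le> drift \<tau> h + drift (\<lambda>s. f s - \<tau> s) h"
      using elim by (intro drift_add_le \<tau>m dm) simp
    also have "drift (\<lambda>s. f s - \<tau> s) h \<le> ennreal (K + 1) * L1_norm (\<lambda>s. f s - \<tau> s)"
      using elim by (intro drift_le dm) simp
    also have "L1_norm (\<lambda>s. f s - \<tau> s) = (nint halfline (\<lambda>x. f x - \<sigma> i x))"
      unfolding L1_norm_def by (intro nn_integral_cong) (simp add: \<tau>)
    also have "ennreal (K + 1) * \<dots> \<le> ennreal (K + 1) * ennreal (e / (K + 1))"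
      using i by (intro mult_left_mono) auto
    also have "\<dots> = ennreal e" using K_ge_1 e by (subst ennreal_mult[symmetric]) auto
    finally show ?case by (simp add: add_left_mono)
  qed
  ultimately show "\<exists>\<Psi>. (\<Psi> \<longlongrightarrow> 0) (at_right 0) \<and> (\<forall>\<^sub>F h in at_right 0. drift f h \<le> \<Psi> h + ennreal e)"
    by blast
qed

end

section \<open>Averages and evolution semigroups\<close>

text \<open>
  Smallness is assumed for almost every \<open>x\<close> only, since it will be known only for those delays at which the
  operators \<open>B\<close> can be applied.
\<close>

lemma average_tendsto_0:
  assumes "\<And>e::real. 0 < e \<Longrightarrow> \<exists>d>0. AE x in lebesgue. 0 < x \<and> x < d \<longrightarrow> \<Phi> x \<le> ennreal e"
  shows "((\<lambda>h. ennreal (1 / h) * (\<integral>\<^sup>+x. \<Phi> x \<partial>lebesgue_on {0..h})) \<longlongrightarrow> 0) (at_right (0::real))"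
proof (rule ennreal_tendsto_zero_approx)
  fix e :: real assume e: "0 < e"
  then obtain d where d: "0 < d" "AE x in lebesgue. 0 < x \<and> x < d \<longrightarrow> \<Phi> x \<le> ennreal e"
    using assms by blast
  have "\<forall>\<^sub>F h in at_right 0. 0 < h \<and> h < d"
    using d(1) by (auto simp: eventually_at_right_field)
  then have "\<forall>\<^sub>F h in at_right 0. ennreal (1 / h) * (\<integral>\<^sup>+x. \<Phi> x \<partial>lebesgue_on {0..h}) \<le> 0 + ennreal e"
  proof eventually_elim
    case (elim h)
    have "AE x in lebesgue. x \<noteq> (0::real)"
      by (rule AE_completion) (rule AE_lborel_singleton)
    then have "AE x in lebesgue. x \<in> {0..h} \<longrightarrow> \<Phi> x \<le> ennreal e"
      using d(2) by eventually_elim (use elim in auto)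
    then have "AE x in lebesgue_on {0..h}. \<Phi> x \<le> ennreal e"
      by (simp add: AE_restrict_space_iff)
    then have "(\<integral>\<^sup>+x. \<Phi> x \<partial>lebesgue_on {0..h}) \<le> (\<integral>\<^sup>+x. ennreal e \<partial>lebesgue_on {0..h})"
      by (rule nn_integral_mono_AE)
    also have "\<dots> = ennreal e * ennreal h"
      using elim by (simp add: emeasure_restrict_space)
    finally have "ennreal (1 / h) * (\<integral>\<^sup>+x. \<Phi> x \<partial>lebesgue_on {0..h}) \<le> ennreal (1 / h) * (ennreal e * ennreal h)"
      by (rule mult_left_mono) simp
    also have "\<dots> = ennreal e" using elim e by (simp flip: ennreal_mult)
    finally show ?case by simp
  qed
  then show "\<exists>\<Psi>. (\<Psi> \<longlongrightarrow> 0) (at_right 0) \<and> (\<forall>\<^sub>F h in at_right 0.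
      ennreal (1 / h) * (\<integral>\<^sup>+x. \<Phi> x \<partial>lebesgue_on {0..h}) \<le> \<Psi> h + ennreal e)"
    by (intro exI[of _ "\<lambda>_. 0"] conjI tendsto_const)
qed

lemma average_tendsto_0':
  assumes "(\<Phi> \<longlongrightarrow> (0::ennreal)) (at_right (0::real))"
  shows "((\<lambda>h. ennreal (1 / h) * (\<integral>\<^sup>+x. \<Phi> x \<partial>lebesgue_on {0..h})) \<longlongrightarrow> 0) (at_right 0)"
proof (rule average_tendsto_0)
  fix e :: real assume "0 < e"
  then have "\<forall>\<^sub>F x in at_right 0. \<Phi> x < ennreal e"
    using assms by (intro order_tendstoD) auto
  then obtain d where "0 < d" "\<And>x. 0 < x \<Longrightarrow> x < d \<Longrightarrow> \<Phi> x < ennreal e"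
    by (auto simp: eventually_at_right_field)
  then show "\<exists>d>0. AE x in lebesgue. 0 < x \<and> x < d \<longrightarrow> \<Phi> x \<le> ennreal e"
    by (intro exI[of _ d]) (auto intro!: AE_I2 less_imp_le)
qed

lemma nn_integral_small_interval_tendsto_0:
  assumes g: "g \<in> borel_measurable halfline" and fin: "(\<integral>\<^sup>+r. g r \<partial>halfline) < \<infinity>" and s: "0 \<le> s"
  shows "((\<lambda>h. \<integral>\<^sup>+r. g r \<partial>lebesgue_on {s..s + h}) \<longlongrightarrow> (0::ennreal)) (at_right 0)"
proof -
  have eq: "(\<integral>\<^sup>+r. g r \<partial>lebesgue_on {s..s + h}) = (\<integral>\<^sup>+r. g r * indicator {s..s + h} r \<partial>halfline)" for h
  proof -
    have "(\<integral>\<^sup>+r. g r * indicator {s..s + h} r \<partial>halfline)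
      = (\<integral>\<^sup>+r. g r * indicator {s..s + h} r * indicator {0..} r \<partial>lebesgue)"
      by (simp add: nn_integral_restrict_space)
    also have "\<dots> = (\<integral>\<^sup>+r. g r * indicator {s..s + h} r \<partial>lebesgue)"
      using s by (intro nn_integral_cong) (auto simp: indicator_def)
    finally show ?thesis by (simp add: nn_integral_restrict_space)
  qed
  show ?thesis
    unfolding eq
  proof (rule nn_integral_dominated_convergence_at_right[where w = g])
    show "(\<lambda>r. g r * indicator {s..s + h} r) \<in> borel_measurable halfline" for h
      by (intro borel_measurable_times_ennreal g borel_measurable_indicator) (simp add: sets_restrict_space_iff s)
    show "AE r in halfline. g r * indicator {s..s + h} r \<le> g r" for h
      by (intro AE_I2) (auto simp: indicator_def)
    have "AE r in lebesgue. r \<noteq> s"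
      by (rule AE_completion) (rule AE_lborel_singleton)
    then have "AE r in halfline. r \<noteq> s"
      unfolding AE_halfline_iff by eventually_elim simp
    then show "AE r in halfline. ((\<lambda>h. g r * indicator {s..s + h} r) \<longlongrightarrow> 0) (at_right 0)"
    proof eventually_elim
      case (elim r)
      have "\<forall>\<^sub>F h in at_right 0. r \<notin> {s..s + h}"
      proof (cases "r < s")
        case False
        then have "0 < r - s" using elim by simp
        then show ?thesis by (auto simp: eventually_at_right_field intro!: exI[of _ "r - s"])
      qed simp
      then have "\<forall>\<^sub>F h in at_right 0. g r * indicator {s..s + h} r = 0"
        by eventually_elim simp
      then show ?case by (rule tendsto_eventually)
    qed
  qed (use g fin in auto)
qed

lemma L1_norm_add_le:
  "strongly_measurable halfline f \<Longrightarrow> strongly_measurable halfline g \<Longrightarrow>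
    L1_norm (\<lambda>s. f s + g s) \<le> L1_norm f + L1_norm g"
  unfolding L1_norm_def by (rule complete_measure.nn_integral_norm_add_le[OF complete_halfline])

lemma L1_norm_scaleR:
  assumes "strongly_measurable halfline f"
  shows "L1_norm (\<lambda>s. c *\<^sub>R f s) = ennreal \<bar>c\<bar> * L1_norm f"
  using complete_measure.strongly_measurable_norm[OF complete_halfline assms]
  by (simp add: L1_norm_def ennreal_mult nn_integral_cmult)

lemma nn_integral_halfline_split:
  fixes g :: "real \<Rightarrow> ennreal"
  assumes g: "g \<in> borel_measurable halfline" and h: "0 \<le> h"
  shows "(\<integral>\<^sup>+s. g s \<partial>halfline) = (\<integral>\<^sup>+s. g s \<partial>lebesgue_on {0..<h}) + (\<integral>\<^sup>+s. g (s + h) \<partial>halfline)"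
proof -
  have m: "(\<lambda>s. g s * indicator {0..} s) \<in> borel_measurable lebesgue"
    using g by (simp add: borel_measurable_restrict_space_iff_ennreal)
  have m1: "(\<lambda>s. g s * indicator {0..} s * indicator {0..<h} s) \<in> borel_measurable lebesgue"
    and m2: "(\<lambda>s. g s * indicator {0..} s * indicator {h..} s) \<in> borel_measurable lebesgue"
    by (intro borel_measurable_times_ennreal[OF m borel_measurable_indicator]; simp)+
  have "(\<integral>\<^sup>+s. g s \<partial>halfline) = (\<integral>\<^sup>+s. g s * indicator {0..} s * indicator {0..<h} s
      + g s * indicator {0..} s * indicator {h..} s \<partial>lebesgue)"
    by (simp add: nn_integral_restrict_space, rule nn_integral_cong) (auto simp: indicator_def)
  also have "\<dots> = (\<integral>\<^sup>+s. g s * indicator {0..} s * indicator {0..<h} s \<partial>lebesgue)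
      + (\<integral>\<^sup>+s. g s * indicator {0..} s * indicator {h..} s \<partial>lebesgue)"
    by (rule nn_integral_add[OF m1 m2])
  also have "(\<integral>\<^sup>+s. g s * indicator {0..} s * indicator {0..<h} s \<partial>lebesgue) = (\<integral>\<^sup>+s. g s \<partial>lebesgue_on {0..<h})"
    by (simp add: nn_integral_restrict_space, rule nn_integral_cong) (auto simp: indicator_def)
  also have "(\<integral>\<^sup>+s. g s * indicator {0..} s * indicator {h..} s \<partial>lebesgue) = (\<integral>\<^sup>+s. g s \<partial>lebesgue_on {h..})"
    using h by (simp add: nn_integral_restrict_space, intro nn_integral_cong) (auto simp: indicator_def)
  also have "\<dots> = (\<integral>\<^sup>+s. g (s + h) \<partial>halfline)"
    by (rule nn_integral_halfline_shift[OF g h, symmetric])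
  finally show ?thesis .
qed

lemma strongly_measurable_snd:
  assumes "strongly_measurable halfline f"
  shows "strongly_measurable (lebesgue_on Delta) (\<lambda>p. f (snd p))"
  by (rule strongly_measurable_pullback[OF nonsingular_snd assms _ Delta_lebesgue]) (auto simp: Delta_def)

lemma strongly_measurable_fst:
  assumes "strongly_measurable halfline f"
  shows "strongly_measurable (lebesgue_on Delta) (\<lambda>p. f (fst p))"
  by (rule strongly_measurable_pullback[OF nonsingular_fst assms _ Delta_lebesgue]) (auto simp: Delta_def)

context bounded_evolution
begin

lemma strongly_measurable_evolution_semigroup:
  assumes f: "strongly_measurable halfline f" and h: "0 \<le> h"
  shows "strongly_measurable halfline (evolution_semigroup U h f)"
proof -
  have "strongly_measurable (lebesgue_on {h..}) (\<lambda>s. f (s + - h))"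
    by (rule strongly_measurable_pullback[OF nonsingular_translation f]) auto
  then have fm: "strongly_measurable (lebesgue_on {h..}) (\<lambda>s. f (s - h))" by simp
  have cont: "continuous_on {h..} (\<lambda>s. U s (s - h) c)" for c
  proof -
    have "continuous_on {h..} ((\<lambda>p. U (fst p) (snd p) c) \<circ> (\<lambda>s. (s, s - h)))"
      using h by (intro continuous_on_compose continuous_intros continuous_on_subset[OF continuous_Delta])
        (auto simp: Delta_def)
    then show ?thesis by (simp add: o_def)
  qed
  have "strongly_measurable (lebesgue_on {h..}) (\<lambda>s. U s (s - h) (f (s - h)))"
    using h by (intro strongly_measurable_operator[OF _ _ cont fm] linear) auto
  from strongly_measurable_extend_zero[OF this, of "{0..}"]
  show ?thesis by (simp add: evolution_semigroup_def[abs_def])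
qed

lemma L1_norm_evolution_semigroup:
  assumes f: "strongly_measurable halfline f" and h: "0 \<le> h"
  shows "L1_norm (evolution_semigroup U h f) = (nint halfline (\<lambda>s. U (s + h) s (f s)))"
proof -
  let ?g = "\<lambda>s. ennreal (norm (evolution_semigroup U h f s))"
  have g: "?g \<in> borel_measurable halfline"
    using complete_measure.strongly_measurable_norm[OF complete_halfline strongly_measurable_evolution_semigroup[OF f h]]
    by simp
  have "L1_norm (evolution_semigroup U h f) = (\<integral>\<^sup>+s. ?g s \<partial>lebesgue_on {0..<h}) + (\<integral>\<^sup>+s. ?g (s + h) \<partial>halfline)"
    unfolding L1_norm_def by (rule nn_integral_halfline_split[OF g h])
  also have "(\<integral>\<^sup>+s. ?g s \<partial>lebesgue_on {0..<h}) = (\<integral>\<^sup>+s. 0 \<partial>lebesgue_on {0..<h})"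
    by (intro nn_integral_cong) (auto simp: evolution_semigroup_def)
  also have "(\<integral>\<^sup>+s. ?g (s + h) \<partial>halfline) = (nint halfline (\<lambda>s. U (s + h) s (f s)))"
    by (intro nn_integral_cong) (auto simp: evolution_semigroup_def)
  finally show ?thesis by simp
qed

lemma L1_norm_evolution_semigroup_le:
  assumes f: "strongly_measurable halfline f" and h: "0 \<le> h"
  shows "L1_norm (evolution_semigroup U h f) \<le> ennreal K * L1_norm f"
proof -
  have fm: "(\<lambda>s. ennreal (norm (f s))) \<in> borel_measurable halfline"
    using complete_measure.strongly_measurable_norm[OF complete_halfline f] by simp
  have "L1_norm (evolution_semigroup U h f) \<le> (\<integral>\<^sup>+s. ennreal K * ennreal (norm (f s)) \<partial>halfline)"
    unfolding L1_norm_evolution_semigroup[OF assms]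
  proof (rule nn_integral_mono)
    fix s assume "s \<in> space halfline"
    then show "ennreal (norm (U (s + h) s (f s))) \<le> ennreal K * ennreal (norm (f s))"
      using norm_le[of s "s + h" "f s"] h K_ge_1 by (subst ennreal_mult[symmetric]) (auto intro: ennreal_leI)
  qed
  then show ?thesis unfolding L1_norm_def nn_integral_cmult[OF fm] .
qed

text \<open>
  The semigroup law, in the form \<open>T(k+d) f - f = T(k) (T(d) f - f) + (T(k) f - f)\<close>, which makes it
  possible to telescope.
\<close>

lemma evolution_semigroup_iterate:
  assumes k: "0 \<le> k" and d: "0 \<le> d" and s: "0 \<le> s"
  shows "evolution_semigroup U (k + d) f s - f s
    = evolution_semigroup U k (\<lambda>s. evolution_semigroup U d f s - f s) s + (evolution_semigroup U k f s - f s)"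
proof (cases "k \<le> s")
  case False
  then show ?thesis using d by (simp add: evolution_semigroup_def)
next
  case True
  then interpret L: bounded_linear "U s (s - k)" using k by (intro linear) auto
  show ?thesis
  proof (cases "k + d \<le> s")
    case True
    then have "U s (s - k) (U (s - k) (s - k - d) (f (s - k - d))) = U s (s - k - d) (f (s - k - d))"
      using k d by (intro cocycle) auto
    then show ?thesis using True \<open>k \<le> s\<close> by (simp add: evolution_semigroup_def L.diff diff_diff_eq)
  next
    case False
    then show ?thesis using \<open>k \<le> s\<close> by (simp add: evolution_semigroup_def L.diff L.zero L.neg)
  qed
qed

text \<open>
  An increment of size \<open>o(d)\<close> over time \<open>d\<close> adds up to \<open>o(1)\<close> over \<open>n = t/d\<close> steps, because the
  semigroup is bounded. So \<open>T(t) f = f\<close> for every \<open>t > 0\<close>; but \<open>T(t) f\<close> vanishes on \<open>[0,t)\<close>.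
\<close>

lemma stationary_imp_zero:
  assumes f: "strongly_measurable halfline f"
    and lim: "((\<lambda>d. L1_norm (\<lambda>s. (evolution_semigroup U d f s - f s) /\<^sub>R d)) \<longlongrightarrow> 0) (at_right 0)"
  shows "AE s in halfline. f s = 0"
proof -
  let ?D = "\<lambda>d. L1_norm (\<lambda>s. evolution_semigroup U d f s - f s)"
  have dm: "strongly_measurable halfline (\<lambda>s. evolution_semigroup U d f s - f s)" if "0 \<le> d" for d
    by (intro strongly_measurable_diff strongly_measurable_evolution_semigroup f that)
  have step: "?D (real n * d) \<le> of_nat n * (ennreal K * ?D d)" if d: "0 \<le> d" for n d
  proof (induction n)
    case 0
    have "?D 0 = (\<integral>\<^sup>+s. 0 \<partial>halfline)"
      unfolding L1_norm_def by (intro nn_integral_cong) (simp add: evolution_semigroup_def refl)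
    then show ?case by simp
  next
    case (Suc n)
    have "?D (real (Suc n) * d) = L1_norm (\<lambda>s. evolution_semigroup U (real n * d) (\<lambda>s. evolution_semigroup U d f s - f s) s
        + (evolution_semigroup U (real n * d) f s - f s))"
      unfolding L1_norm_def
    proof (rule nn_integral_cong)
      fix s assume "s \<in> space halfline"
      then show "ennreal (norm (evolution_semigroup U (real (Suc n) * d) f s - f s)) =
        ennreal (norm (evolution_semigroup U (real n * d) (\<lambda>s. evolution_semigroup U d f s - f s) s
        + (evolution_semigroup U (real n * d) f s - f s)))"
        using evolution_semigroup_iterate[of "real n * d" d s f] d by (simp add: algebra_simps)
    qed
    also have "\<dots> \<le> L1_norm (evolution_semigroup U (real n * d) (\<lambda>s. evolution_semigroup U d f s - f s))
        + ?D (real n * d)"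
      using d by (intro L1_norm_add_le strongly_measurable_evolution_semigroup dm) auto
    also have "\<dots> \<le> ennreal K * ?D d + of_nat n * (ennreal K * ?D d)"
      using d by (intro add_mono L1_norm_evolution_semigroup_le Suc.IH dm) auto
    finally show ?case by (simp add: distrib_right)
  qed
  have D0: "?D t = 0" if t: "0 < t" for t
  proof -
    have le: "?D t \<le> ennreal (K * t) * L1_norm (\<lambda>s. (evolution_semigroup U (t / real (Suc n)) f s - f s) /\<^sub>R (t / real (Suc n)))" for n
    proof -
      let ?d = "t / real (Suc n)"
      have "?D t = ?D (real (Suc n) * ?d)" by simp
      also have "\<dots> \<le> of_nat (Suc n) * (ennreal K * ?D ?d)"
        by (rule step) (use t in simp)
      also have "\<dots> = ennreal (K * t) * (ennreal (1 / ?d) * ?D ?d)"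
      proof -
        have "of_nat (Suc n) * ennreal K = ennreal (K * t) * ennreal (1 / ?d)"
          using t K_ge_1 by (simp add: ennreal_of_nat_eq_real_of_nat mult.commute del: of_nat_Suc flip: ennreal_mult)
        then show ?thesis by (simp add: mult.assoc[symmetric] del: of_nat_Suc)
      qed
      also have "ennreal (1 / ?d) * ?D ?d = L1_norm (\<lambda>s. (evolution_semigroup U ?d f s - f s) /\<^sub>R ?d)"
        using t by (subst L1_norm_scaleR) (auto simp: dm divide_inverse simp del: of_nat_Suc)
      finally show ?thesis .
    qed
    have "filterlim (\<lambda>n. t / real (Suc n)) (at_right 0) sequentially"
      unfolding filterlim_at
      using t by (auto intro!: always_eventually LIMSEQ_Suc[OF lim_const_over_n] simp del: of_nat_Suc)
    from ennreal_tendsto_cmult[OF _ filterlim_compose[OF lim this], of "ennreal (K * t)"]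
    have "(\<lambda>n. ennreal (K * t) * L1_norm (\<lambda>s. (evolution_semigroup U (t / real (Suc n)) f s - f s) /\<^sub>R (t / real (Suc n)))) \<longlonglongrightarrow> 0"
      by simp
    then have "?D t \<le> 0"
      by (rule LIMSEQ_le_const) (use le in blast)
    then show ?thesis by simp
  qed
  have "AE s in halfline. s < real (Suc n) \<longrightarrow> f s = 0" for n
  proof -
    have m: "(\<lambda>s. ennreal (norm (evolution_semigroup U (real (Suc n)) f s - f s))) \<in> borel_measurable halfline"
      using complete_measure.strongly_measurable_norm[OF complete_halfline dm[of "real (Suc n)"]] by simp
    have "AE s in halfline. ennreal (norm (evolution_semigroup U (real (Suc n)) f s - f s)) = 0"
      using D0[of "real (Suc n)"] unfolding L1_norm_def nn_integral_0_iff_AE[OF m] by simp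
    then show ?thesis
      by eventually_elim (auto simp: evolution_semigroup_def)
  qed
  then have "AE s in halfline. \<forall>n. s < real (Suc n) \<longrightarrow> f s = 0"
    unfolding AE_all_countable by (rule allI)
  then show ?thesis
  proof eventually_elim
    case (elim s)
    obtain n where "s < real n" using reals_Archimedean2 by blast
    then show ?case using elim[rule_format, of n] by simp
  qed
qed

end

section \<open>Mild solutions\<close>

lemma strong_integral_const:
  fixes c :: "'a::banach"
  assumes "a \<le> b"
  shows "strong_integral (lebesgue_on {a..b::real}) (\<lambda>_. c) = (b - a) *\<^sub>R c"
proof -
  interpret complete_measure "lebesgue_on {a..b}" by (rule complete_lebesgue_on) simp
  have fin: "emeasure (lebesgue_on {a..b}) {a..b} = ennreal (b - a)"
    using assms by (simp add: emeasure_restrict_space)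
  have sb: "sb_integrable (lebesgue_on {a..b}) (\<lambda>_. c)"
  proof (rule simple_bochner_integrable.intros)
    show "emeasure (lebesgue_on {a..b}) {y \<in> space (lebesgue_on {a..b}). c \<noteq> 0} \<noteq> \<infinity>"
    proof (cases "c = 0")
      case False
      then have "{y \<in> space (lebesgue_on {a..b}). c \<noteq> 0} = {a..b}" by auto
      then show ?thesis using fin by simp
    qed simp
  qed simp
  have "sb_integral (lebesgue_on {a..b}) (\<lambda>_. c) = (b - a) *\<^sub>R c"
  proof -
    have "(\<lambda>_. c) ` {a..b} = {c}" "{x. a \<le> x \<and> x \<le> b} = {a..b}" using assms by auto
    then show ?thesis
      using assms fin by (simp add: Bochner_Integration.simple_bochner_integral_def measure_def)
  qed
  then have "has_strong_integral (lebesgue_on {a..b}) (\<lambda>_. c) ((b - a) *\<^sub>R c)"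
    unfolding has_strong_integral_def
    by (intro conjI strongly_measurable_const exI[of _ "\<lambda>_ _. c"]) (auto simp: sb)
  then show ?thesis by (rule strong_integral_eq)
qed

lemma strongly_integrable_const: "strongly_integrable (lebesgue_on {a..b::real}) (\<lambda>_. c)"
  by (simp add: strongly_integrable_def strongly_measurable_const emeasure_restrict_space emeasure_lborel_Icc_eq
      ennreal_mult_less_top)

lemma borel_measurable_norm_halfline:
  "strongly_measurable halfline f \<Longrightarrow> (\<lambda>s. ennreal (norm (f s))) \<in> borel_measurable halfline"
  using complete_measure.strongly_measurable_norm[OF complete_halfline, of f] by simp

text \<open>
  Sampling \<open>f\<close> at the next larger multiple of \<open>1/(n+1)\<close> gives step functions that converge pointwise.
  The sampling points are strictly larger than \<open>s\<close>, so that a limit from the right suffices.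
\<close>

lemma strongly_measurable_right_continuous:
  fixes f :: "real \<Rightarrow> 'a::real_normed_vector"
  assumes "\<And>s. 0 \<le> s \<Longrightarrow> (f \<longlongrightarrow> f s) (at_right s)"
  shows "strongly_measurable halfline f"
  unfolding strongly_measurable_def
proof (intro exI[of _ "\<lambda>n s. f (if s < real n then (of_int \<lfloor>(real n + 1) * s\<rfloor> + 1) / (real n + 1) else 0)"] conjI allI)
  fix n :: nat
  let ?k = "\<lambda>s. if s < real n then (of_int \<lfloor>(real n + 1) * s\<rfloor> + 1) / (real n + 1) else 0 :: real"
  have "simple_function halfline ?k"
  proof (rule simple_function_borel_measurable)
    have "?k \<in> borel_measurable lebesgue"
      by (rule measurable_completion) measurable
    then show "?k \<in> borel_measurable halfline" by (rule measurable_restrict_space1)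
    have "?k ` space halfline \<subseteq> insert 0 ((\<lambda>k::int. (of_int k + 1) / (real n + 1)) ` {0..int ((n + 1) * n)})"
    proof
      fix y assume "y \<in> ?k ` space halfline"
      then obtain s where y: "y = ?k s" and "s \<in> space halfline" by (elim imageE)
      then have s: "0 \<le> s" "y = ?k s" by simp_all
      show "y \<in> insert 0 ((\<lambda>k::int. (of_int k + 1) / (real n + 1)) ` {0..int ((n + 1) * n)})"
      proof (cases "s < real n")
        case True
        then have "(real n + 1) * s \<le> (real n + 1) * real n" by (intro mult_left_mono) auto
        then have "\<lfloor>(real n + 1) * s\<rfloor> \<le> int ((n + 1) * n)"
          by (intro floor_le_iff[THEN iffD2]) (simp add: algebra_simps)
        moreover have "0 \<le> \<lfloor>(real n + 1) * s\<rfloor>" using s by simp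
        ultimately show ?thesis using s True by auto
      qed (use s in simp)
    qed
    then show "finite (?k ` space halfline)" by (rule finite_subset) simp
  qed
  then show "simple_function halfline (\<lambda>s. f (?k s))"
    by (rule simple_function_compose1)
next
  show "AE s in halfline. (\<lambda>n. f (if s < real n then (of_int \<lfloor>(real n + 1) * s\<rfloor> + 1) / (real n + 1) else 0)) \<longlonglongrightarrow> f s"
  proof (rule AE_I2)
    fix s assume "s \<in> space halfline"
    then have s: "0 \<le> s" by simp
    let ?t = "\<lambda>n. (of_int \<lfloor>(real n + 1) * s\<rfloor> + 1) / (real n + 1) :: real"
    have gt: "s < ?t n" and le: "?t n \<le> s + 1 / (real n + 1)" for n
    proof -
      have "(real n + 1) * s < of_int \<lfloor>(real n + 1) * s\<rfloor> + 1"
        "of_int \<lfloor>(real n + 1) * s\<rfloor> \<le> (real n + 1) * s" by linarith+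
      then have "s < ?t n" "?t n \<le> ((real n + 1) * s + 1) / (real n + 1)"
        by (simp_all add: pos_less_divide_eq divide_right_mono mult.commute)
      then show "s < ?t n" "?t n \<le> s + 1 / (real n + 1)"
        by (simp_all add: add_divide_distrib)
    qed
    have "(\<lambda>n. s + 1 / real (Suc n)) \<longlonglongrightarrow> s + 0"
      by (intro tendsto_add tendsto_const LIMSEQ_Suc[OF lim_const_over_n])
    then have lim: "(\<lambda>n. s + 1 / (real n + 1)) \<longlonglongrightarrow> s" by (simp add: add.commute)
    have "?t \<longlonglongrightarrow> s"
      by (rule tendsto_sandwich[OF _ _ tendsto_const lim]) (use gt le in \<open>auto intro!: always_eventually less_imp_le\<close>)
    then have "filterlim ?t (at_right s) sequentially"
      unfolding filterlim_at using gt by (auto intro!: always_eventually simp: less_imp_neq[symmetric])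
    from filterlim_compose[OF assms[OF s] this]
    have "(\<lambda>n. f (?t n)) \<longlonglongrightarrow> f s" .
    moreover have "\<forall>\<^sub>F n in sequentially. f (?t n) = f (if s < real n then ?t n else 0)"
    proof -
      obtain m where "s < real m" using reals_Archimedean2 by blast
      then show ?thesis by (intro eventually_sequentiallyI[of m]) auto
    qed
    ultimately show "(\<lambda>n. f (if s < real n then ?t n else 0)) \<longlonglongrightarrow> f s"
      by (rule Lim_transform_eventually)
  qed
qed

context bounded_evolution
begin

lemma strongly_integrable_row:
  assumes g: "g \<in> L1" and S: "S \<in> sets lebesgue" "S \<subseteq> {0..t}"
  shows "strongly_integrable (lebesgue_on S) (\<lambda>r. U t r (g r))"
    and "(nint (lebesgue_on S) (\<lambda>r. U t r (g r)))
      \<le> ennreal K * (nint (lebesgue_on S) g)"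
proof -
  have "strongly_measurable (lebesgue_on S) g"
    by (rule strongly_measurable_lebesgue_on_subset[of "{0..}"]) (use g S in \<open>auto simp: L1_def\<close>)
  then have m: "strongly_measurable (lebesgue_on S) (\<lambda>r. U t r (g r))"
    by (rule strongly_measurable_start[OF _ S])
  have gm: "(\<lambda>r. ennreal (norm (g r))) \<in> borel_measurable (lebesgue_on S)"
    using complete_measure.strongly_measurable_norm[OF complete_lebesgue_on[OF S(1)] \<open>strongly_measurable (lebesgue_on S) g\<close>]
    by simp
  have "(nint (lebesgue_on S) (\<lambda>r. U t r (g r)))
      \<le> (\<integral>\<^sup>+r. ennreal K * ennreal (norm (g r)) \<partial>lebesgue_on S)"
  proof (rule nn_integral_mono)
    fix r assume "r \<in> space (lebesgue_on S)"
    then show "ennreal (norm (U t r (g r))) \<le> ennreal K * ennreal (norm (g r))"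
      using norm_le[of r t "g r"] S K_ge_1 by (subst ennreal_mult[symmetric]) (auto intro: ennreal_leI)
  qed
  also have "\<dots> = ennreal K * (nint (lebesgue_on S) g)"
    by (rule nn_integral_cmult[OF gm])
  finally show le: "(nint (lebesgue_on S) (\<lambda>r. U t r (g r)))
      \<le> ennreal K * (nint (lebesgue_on S) g)" .
  have "(nint (lebesgue_on S) g) \<le> L1_norm g"
    unfolding L1_norm_def by (rule nn_integral_lebesgue_on_mono_set) (use S in auto)
  then have "ennreal K * (nint (lebesgue_on S) g) < \<infinity>"
    using g by (auto simp: L1_def ennreal_mult_less_top intro: le_less_trans)
  then show "strongly_integrable (lebesgue_on S) (\<lambda>r. U t r (g r))"
    using m le_less_trans[OF le] by (simp add: strongly_integrable_def)
qed

text \<open>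
  The mild solution of \<open>v'(t) = A(t) v(t) + g(t)\<close>, \<open>v(0) = 0\<close>, when \<open>A(t)\<close> generates \<open>U\<close>. On the level of the
  evolution semigroup, \<open>mild g\<close> is a preimage of \<open>-g\<close> under the generator.
\<close>

definition mild :: "(real \<Rightarrow> 'a) \<Rightarrow> real \<Rightarrow> 'a" where
  "mild g t = strong_integral (lebesgue_on {0..t}) (\<lambda>r. U t r (g r))"

lemma mild_split:
  assumes g: "g \<in> L1" and r: "0 \<le> r" "r \<le> t"
  shows "mild g t = U t r (mild g r) + strong_integral (lebesgue_on {r..t}) (\<lambda>q. U t q (g q))"
proof -
  interpret R: complete_measure "lebesgue_on {0..r}" by (rule complete_lebesgue_on) simp
  have "strong_integral (lebesgue_on {0..r}) (\<lambda>q. U t q (g q))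
    = strong_integral (lebesgue_on {0..r}) (\<lambda>q. U t r (U r q (g q)))"
    using r by (intro R.strong_integral_cong_AE AE_I2) (simp add: cocycle)
  also have "\<dots> = U t r (mild g r)"
    unfolding mild_def using r by (intro R.strong_integral_bounded_linear linear strongly_integrable_row g) auto
  finally show ?thesis
    unfolding mild_def[of g t]
    using strong_integral_combine[OF r strongly_integrable_row(1)[OF g, of "{0..t}" t]] by simp
qed

lemma norm_mild_remainder_le:
  assumes g: "g \<in> L1" and r: "0 \<le> r"
  shows "ennreal (norm (strong_integral (lebesgue_on {r..t}) (\<lambda>q. U t q (g q))))
    \<le> ennreal K * (nint (lebesgue_on {r..t}) g)"
proof -
  interpret R: complete_measure "lebesgue_on {r..t}" by (rule complete_lebesgue_on) simp
  show ?thesis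
    using r by (intro order_trans[OF R.norm_strong_integral_le strongly_integrable_row(2)] strongly_integrable_row(1) g) auto
qed

lemma mild_right_continuous:
  assumes g: "g \<in> L1" and s: "0 \<le> s"
  shows "(mild g \<longlongrightarrow> mild g s) (at_right s)"
proof -
  have gm: "(\<lambda>r. ennreal (norm (g r))) \<in> borel_measurable halfline"
    using g by (intro borel_measurable_norm_halfline) (simp add: L1_def)
  have "((\<lambda>h. ennreal K * (nint (lebesgue_on {s..s + h}) g)) \<longlongrightarrow> ennreal K * 0) (at_right 0)"
    using g s by (intro ennreal_tendsto_cmult nn_integral_small_interval_tendsto_0 gm) (auto simp: L1_def L1_norm_def)
  then have lim: "((\<lambda>h. ennreal K * (nint (lebesgue_on {s..s + h}) g)) \<longlongrightarrow> 0) (at_right 0)"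
    by simp
  have "((\<lambda>h. ennreal (norm (strong_integral (lebesgue_on {s..s + h}) (\<lambda>q. U (s + h) q (g q))))) \<longlongrightarrow> ennreal 0) (at_right 0)"
    unfolding ennreal_0
    by (rule ennreal_tendsto_zero_mono[OF lim]) (intro always_eventually allI norm_mild_remainder_le g s)
  then have rest: "((\<lambda>h. strong_integral (lebesgue_on {s..s + h}) (\<lambda>q. U (s + h) q (g q))) \<longlongrightarrow> 0) (at_right 0)"
    by (rule tendsto_norm_zero_cancel[OF tendsto_ennrealD]) simp_all
  have "((\<lambda>t. U t s (mild g s)) \<longlongrightarrow> U s s (mild g s)) (at s within {s..})"
    using continuous_end[OF s, of "mild g s"] by (simp add: continuous_on_def)
  then have "((\<lambda>t. U t s (mild g s)) \<longlongrightarrow> mild g s) (at_right s)"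
    unfolding refl[OF s] by (rule tendsto_within_subset) auto
  then have "((\<lambda>h. U (s + h) s (mild g s)) \<longlongrightarrow> mild g s) (at_right 0)"
    by (simp add: filterlim_at_right_to_0[of _ _ s] add.commute)
  from tendsto_add[OF this rest]
  have "((\<lambda>h. U (s + h) s (mild g s) + strong_integral (lebesgue_on {s..s + h}) (\<lambda>q. U (s + h) q (g q)))
      \<longlongrightarrow> mild g s) (at_right 0)" by simp
  moreover have "\<forall>\<^sub>F h in at_right 0. U (s + h) s (mild g s)
      + strong_integral (lebesgue_on {s..s + h}) (\<lambda>q. U (s + h) q (g q)) = mild g (s + h)"
    using eventually_at_right_less
  proof eventually_elim
    case (elim h)
    then have "s \<le> s + h" by simp
    from mild_split[OF g s this] show ?case by (rule sym)
  qed
  ultimately have "((\<lambda>h. mild g (s + h)) \<longlongrightarrow> mild g s) (at_right 0)"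
    by (rule Lim_transform_eventually)
  then show ?thesis by (simp add: filterlim_at_right_to_0[of _ _ s] add.commute)
qed

lemma strongly_measurable_mild: "g \<in> L1 \<Longrightarrow> strongly_measurable halfline (mild g)"
  by (rule strongly_measurable_right_continuous) (rule mild_right_continuous)

lemma mild_increment:
  assumes g: "g \<in> L1" and s: "0 \<le> s" and h: "0 \<le> h"
  shows "mild g s - evolution_semigroup U h (mild g) s
    = strong_integral (lebesgue_on {max 0 (s - h)..s}) (\<lambda>r. U s r (g r))"
proof (cases "h \<le> s")
  case True
  then show ?thesis using mild_split[OF g, of "s - h" s] h by (simp add: evolution_semigroup_def)
next
  case False
  then show ?thesis by (simp add: evolution_semigroup_def mild_def)
qed

lemma drift_strip:
  assumes g: "strongly_measurable halfline g" and h: "0 \<le> h"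
  shows "(\<integral>\<^sup>+t. nint (lebesgue_on {max 0 (t - h)..t}) (\<lambda>r. U t r (g r) - g t) \<partial>halfline)
      = (\<integral>\<^sup>+d. drift g d \<partial>lebesgue_on {0..h})" (is ?a)
    and "(\<lambda>t. nint (lebesgue_on {max 0 (t - h)..t}) (\<lambda>r. U t r (g r) - g t)) \<in> borel_measurable halfline" (is ?b)
proof -
  have "strongly_measurable (lebesgue_on Delta) (\<lambda>p. U (fst p) (snd p) (g (snd p)) - g (fst p))"
    by (intro strongly_measurable_diff strongly_measurable_Delta_operator strongly_measurable_snd strongly_measurable_fst g)
  from complete_measure.strongly_measurable_norm[OF complete_lebesgue_on[OF Delta_lebesgue] this]
  have F: "(\<lambda>p. ennreal (norm (U (fst p) (snd p) (g (snd p)) - g (fst p)))) \<in> borel_measurable (lebesgue_on Delta)"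
    by simp
  show ?a using nn_integral_strip(2)[OF F h] by (simp add: drift_def)
  show ?b using nn_integral_strip(4)[OF F h] by simp
qed

text \<open>
  The increment of \<open>mild g\<close> along the semigroup is the integral of \<open>U s r (g r)\<close> over a window of
  length \<open>h\<close>. Subtracting \<open>g s\<close> under the integral and integrating over \<open>s\<close> leaves the mean of the drift of
  \<open>g\<close> over delays up to \<open>h\<close>, plus an error from \<open>s \<le> h\<close>, where the window is cut off at 0.
\<close>

lemma generator_mild:
  assumes g: "g \<in> L1"
  shows "((\<lambda>h. L1_norm (\<lambda>s. (mild g s - evolution_semigroup U h (mild g) s) /\<^sub>R h - g s)) \<longlongrightarrow> 0) (at_right 0)"
proof (rule ennreal_tendsto_zero_mono)
  have gm: "(\<lambda>r. ennreal (norm (g r))) \<in> borel_measurable halfline" and gs: "strongly_measurable halfline g"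
    using g borel_measurable_norm_halfline[of g] unfolding L1_def by blast+
  have "((\<lambda>h. ennreal (1 / h) * (\<integral>\<^sup>+d. drift g d \<partial>lebesgue_on {0..h})
      + (nint (lebesgue_on {0..0 + h}) g)) \<longlongrightarrow> 0 + 0) (at_right 0)"
    using g by (intro tendsto_add average_tendsto_0' drift_tendsto_0 nn_integral_small_interval_tendsto_0 gm)
      (auto simp: L1_def L1_norm_def)
  then show "((\<lambda>h. ennreal (1 / h) * (\<integral>\<^sup>+d. drift g d \<partial>lebesgue_on {0..h})
      + (nint (lebesgue_on {0..h}) g)) \<longlongrightarrow> 0) (at_right 0)" by simp
  show "\<forall>\<^sub>F h in at_right 0. L1_norm (\<lambda>s. (mild g s - evolution_semigroup U h (mild g) s) /\<^sub>R h - g s)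
      \<le> ennreal (1 / h) * (\<integral>\<^sup>+d. drift g d \<partial>lebesgue_on {0..h})
      + (nint (lebesgue_on {0..h}) g)"
    using eventually_at_right_less
  proof eventually_elim
    case (elim h)
    let ?I = "\<lambda>s. nint (lebesgue_on {max 0 (s - h)..s}) (\<lambda>r. U s r (g r) - g s)"
    have Im: "?I \<in> borel_measurable halfline" using elim by (intro drift_strip gs) simp
    have im: "(\<lambda>s. ennreal (norm (g s)) * indicator {0..h} s) \<in> borel_measurable halfline"
      by (intro borel_measurable_times_ennreal gm borel_measurable_indicator) (auto simp: sets_restrict_space_iff)
    have "L1_norm (\<lambda>s. (mild g s - evolution_semigroup U h (mild g) s) /\<^sub>R h - g s)
      \<le> (\<integral>\<^sup>+s. ennreal (1 / h) * ?I s + ennreal (norm (g s)) * indicator {0..h} s \<partial>halfline)"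
      unfolding L1_norm_def
    proof (rule nn_integral_mono)
      fix s assume "s \<in> space halfline"
      then have s: "0 \<le> s" by simp
      let ?a = "max 0 (s - h)"
      interpret R: complete_measure "lebesgue_on {?a..s}" by (rule complete_lebesgue_on) simp
      have a: "0 \<le> ?a" "?a \<le> s" using s elim by auto
      have int: "strongly_integrable (lebesgue_on {?a..s}) (\<lambda>r. U s r (g r))"
        by (rule strongly_integrable_row(1)[OF g]) auto
      have sub: "strong_integral (lebesgue_on {?a..s}) (\<lambda>r. U s r (g r) - g s)
        = (mild g s - evolution_semigroup U h (mild g) s) - (s - ?a) *\<^sub>R g s"
        using R.strong_integral_lincomb[OF int strongly_integrable_const[of ?a s "g s"], of 1 "-1"]
        using mild_increment[OF g s, of h] elim by (simp add: strong_integral_const[OF a(2)] scaleR_diff_left)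
      have int': "strongly_integrable (lebesgue_on {?a..s}) (\<lambda>r. U s r (g r) - g s)"
        using R.strongly_integrable_lincomb[OF int strongly_integrable_const[of ?a s "g s"], of 1 "-1"] by simp
      have le1: "ennreal (norm (strong_integral (lebesgue_on {?a..s}) (\<lambda>r. U s r (g r) - g s))) \<le> ?I s"
        by (rule R.norm_strong_integral_le[OF int'])
      have "(mild g s - evolution_semigroup U h (mild g) s) /\<^sub>R h - g s
        = (1 / h) *\<^sub>R strong_integral (lebesgue_on {?a..s}) (\<lambda>r. U s r (g r) - g s) + ((s - ?a) / h - 1) *\<^sub>R g s"
        unfolding sub by (simp add: algebra_simps divide_inverse)
      also have "ennreal (norm \<dots>) \<le> ennreal (norm ((1 / h) *\<^sub>R strong_integral (lebesgue_on {?a..s}) (\<lambda>r. U s r (g r) - g s)))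
          + ennreal (norm (((s - ?a) / h - 1) *\<^sub>R g s))"
        by (rule ennreal_norm_triangle)
      also have "\<dots> \<le> ennreal (1 / h) * ?I s + ennreal (norm (g s)) * indicator {0..h} s"
      proof (rule add_mono)
        show "ennreal (norm ((1 / h) *\<^sub>R strong_integral (lebesgue_on {?a..s}) (\<lambda>r. U s r (g r) - g s)))
          \<le> ennreal (1 / h) * ?I s"
          using elim mult_left_mono[OF le1, of "ennreal (1 / h)"] by (simp add: ennreal_mult flip: ennreal_mult)
        show "ennreal (norm (((s - ?a) / h - 1) *\<^sub>R g s)) \<le> ennreal (norm (g s)) * indicator {0..h} s"
        proof (cases "h < s")
          case True
          then show ?thesis using elim by simp
        next
          case False
          then have "\<bar>(s - ?a) / h - 1\<bar> \<le> 1" using s elim by (auto simp: abs_le_iff field_simps)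
          from mult_right_mono[OF this norm_ge_zero[of "g s"]]
          show ?thesis using False s by (simp add: ennreal_leI)
        qed
      qed
      finally show "ennreal (norm ((mild g s - evolution_semigroup U h (mild g) s) /\<^sub>R h - g s))
        \<le> ennreal (1 / h) * ?I s + ennreal (norm (g s)) * indicator {0..h} s" .
    qed
    also have "\<dots> = ennreal (1 / h) * (\<integral>\<^sup>+s. ?I s \<partial>halfline) + (\<integral>\<^sup>+s. ennreal (norm (g s)) * indicator {0..h} s \<partial>halfline)"
      unfolding nn_integral_cmult[OF Im, symmetric]
      by (intro nn_integral_add borel_measurable_times_ennreal borel_measurable_const Im im)
    also have "(\<integral>\<^sup>+s. ?I s \<partial>halfline) = (\<integral>\<^sup>+d. drift g d \<partial>lebesgue_on {0..h})"
      using elim by (intro drift_strip gs) simp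
    also have "(\<integral>\<^sup>+s. ennreal (norm (g s)) * indicator {0..h} s \<partial>halfline) = (nint (lebesgue_on {0..h}) g)"
      by (simp add: nn_integral_restrict_space, rule nn_integral_cong) (auto simp: indicator_def)
    finally show ?case .
  qed
qed

end

section \<open>Positive splitting and damping\<close>

text \<open>
  A bounded decomposition \<open>u = P u - Q u\<close> can be chosen pointwise but not measurably. So \<open>g\<close> is written
  as a series of simple functions whose norms are summable in \<open>L\<^sup>1\<close>: applied to a simple function \<open>P\<close> and \<open>Q\<close>
  are measurable for trivial reasons, and the two series of positive terms converge.
\<close>

lemma L1_cone_decomposition:
  fixes g :: "real \<Rightarrow> 'a::{banach, ordered_real_vector}"
  assumes closed: "closed {u::'a. 0 \<le> u}"
    and dec: "\<And>u::'a. \<exists>v w. 0 \<le> v \<and> 0 \<le> w \<and> u = v - w \<and> norm v \<le> K * norm u \<and> norm w \<le> K * norm u"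
    and g: "g \<in> L1"
  shows "\<exists>g1 g2. g1 \<in> L1 \<and> g2 \<in> L1 \<and> (\<forall>s. 0 \<le> g1 s \<and> 0 \<le> g2 s) \<and> (AE s in halfline. g s = g1 s - g2 s)"
proof -
  interpret H: complete_measure halfline by (rule complete_halfline)
  obtain P Q where PQ: "\<And>u::'a. 0 \<le> P u" "\<And>u. 0 \<le> Q u" "\<And>u. u = P u - Q u"
    "\<And>u. norm (P u) \<le> K * norm u" "\<And>u. norm (Q u) \<le> K * norm u"
    using dec by metis
  obtain \<sigma> where gm: "strongly_measurable halfline g" and \<sigma>: "\<And>i::nat. sb_integrable halfline (\<sigma> i)"
    and lim: "(\<lambda>i. nint halfline (\<lambda>x. g x - \<sigma> i x)) \<longlonglongrightarrow> 0"
    using H.has_strong_integral_exists[of g] g unfolding has_strong_integral_def L1_iff by blast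
  have "\<exists>i. (nint halfline (\<lambda>x. g x - \<sigma> i x)) < ennreal ((1/2) ^ k)" for k
  proof -
    have "\<forall>\<^sub>F i in sequentially. (nint halfline (\<lambda>x. g x - \<sigma> i x)) < ennreal ((1/2) ^ k)"
      by (intro order_tendstoD[OF lim]) auto
    then show ?thesis by (auto simp: eventually_sequentially)
  qed
  then obtain i where i: "\<And>k. (nint halfline (\<lambda>x. g x - \<sigma> (i k) x)) < ennreal ((1/2) ^ k)"
    by metis
  define \<tau> where "\<tau> k = \<sigma> (i k)" for k
  have \<tau>s: "simple_function halfline (\<tau> k)" for k
    using \<sigma>[of "i k"] by (auto simp: \<tau>_def simple_bochner_integrable.simps)
  define \<delta> where "\<delta> k s = (case k of 0 \<Rightarrow> \<tau> 0 s | Suc j \<Rightarrow> \<tau> (Suc j) s - \<tau> j s)" for k s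
  have \<delta>0: "\<delta> 0 s = \<tau> 0 s" and \<delta>S: "\<delta> (Suc j) s = \<tau> (Suc j) s - \<tau> j s" for s j
    by (simp_all add: \<delta>_def)
  have \<delta>s: "simple_function halfline (\<delta> k)" for k
    by (cases k) (auto simp: \<delta>0[abs_def] \<delta>S[abs_def] intro: \<tau>s simple_function_compose2)
  have \<delta>sum: "(\<Sum>k<Suc n. \<delta> k s) = \<tau> n s" for n s
    by (induction n) (simp_all add: \<delta>0 \<delta>S)
  have dm: "strongly_measurable halfline (\<lambda>x. g x - \<tau> k x)" for k
    by (intro strongly_measurable_diff gm strongly_measurable_simple \<tau>s)
  have half: "(\<Sum>k. ennreal (c * (1/2) ^ k)) < \<infinity>" if "0 \<le> c" for c :: real
    using that by (subst suminf_ennreal2) (auto intro!: summable_mult summable_geometric)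
  have sum_dist: "(\<integral>\<^sup>+x. (\<Sum>k. ennreal (norm (g x - \<tau> k x))) \<partial>halfline) < \<infinity>"
  proof -
    have "(\<integral>\<^sup>+x. (\<Sum>k. ennreal (norm (g x - \<tau> k x))) \<partial>halfline)
      = (\<Sum>k. nint halfline (\<lambda>x. g x - \<tau> k x))"
      by (intro nn_integral_suminf borel_measurable_norm_halfline dm)
    also have "\<dots> \<le> (\<Sum>k. ennreal (1 * (1/2) ^ k))"
      using i by (intro suminf_le) (auto simp: \<tau>_def intro: less_imp_le)
    also have "\<dots> < \<infinity>" by (rule half) simp
    finally show ?thesis .
  qed
  have L\<tau>: "L1_norm (\<tau> 0) < \<infinity>"
  proof -
    have "L1_norm (\<tau> 0) = L1_norm (\<lambda>x. g x + (-1) *\<^sub>R (g x - \<tau> 0 x))" by simp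
    also have "\<dots> \<le> L1_norm g + L1_norm (\<lambda>x. (-1) *\<^sub>R (g x - \<tau> 0 x))"
      by (intro L1_norm_add_le gm strongly_measurable_scaleR dm) auto
    also have "\<dots> = L1_norm g + L1_norm (\<lambda>x. g x - \<tau> 0 x)"
      by (subst L1_norm_scaleR[OF dm]) simp
    also have "\<dots> < \<infinity>"
      using g i[of 0] by (auto simp: L1_def L1_norm_def \<tau>_def less_top[symmetric] intro: less_imp_neq order.strict_trans)
    finally show ?thesis .
  qed
  have L\<delta>: "L1_norm (\<delta> (Suc k)) \<le> ennreal (2 * (1/2) ^ k)" for k
  proof -
    have "L1_norm (\<delta> (Suc k)) = L1_norm (\<lambda>x. (g x - \<tau> k x) + (-1) *\<^sub>R (g x - \<tau> (Suc k) x))"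
      by (simp add: \<delta>S[abs_def])
    also have "\<dots> \<le> L1_norm (\<lambda>x. g x - \<tau> k x) + L1_norm (\<lambda>x. (-1) *\<^sub>R (g x - \<tau> (Suc k) x))"
      by (intro L1_norm_add_le strongly_measurable_scaleR dm) auto
    also have "\<dots> = L1_norm (\<lambda>x. g x - \<tau> k x) + L1_norm (\<lambda>x. g x - \<tau> (Suc k) x)"
      by (subst L1_norm_scaleR[OF dm]) simp
    also have "\<dots> \<le> ennreal ((1/2) ^ k) + ennreal ((1/2) ^ Suc k)"
      using i[of k] i[of "Suc k"] unfolding L1_norm_def \<tau>_def by (intro add_mono less_imp_le)
    also have "\<dots> \<le> ennreal (2 * (1/2) ^ k)"
      by (subst ennreal_plus[symmetric]) (auto intro!: ennreal_leI)
    finally show ?thesis .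
  qed
  have sum_\<delta>: "(\<integral>\<^sup>+x. (\<Sum>k. ennreal (norm (\<delta> k x))) \<partial>halfline) < \<infinity>"
  proof -
    have "(\<integral>\<^sup>+x. (\<Sum>k. ennreal (norm (\<delta> k x))) \<partial>halfline) = (\<Sum>k. L1_norm (\<delta> k))"
      unfolding L1_norm_def
      by (intro nn_integral_suminf borel_measurable_norm_halfline strongly_measurable_simple \<delta>s)
    also have "\<dots> = L1_norm (\<delta> 0) + (\<Sum>k. L1_norm (\<delta> (Suc k)))"
      using suminf_offset[of "\<lambda>k. L1_norm (\<delta> k)" 1] by (simp add: summableI)
    also have "\<dots> \<le> L1_norm (\<delta> 0) + (\<Sum>k. ennreal (2 * (1/2) ^ k))"
      by (intro add_left_mono suminf_le L\<delta> summableI)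
    also have "\<dots> < \<infinity>"
    proof -
      have "L1_norm (\<delta> 0) < \<infinity>" using L\<tau> by (simp add: \<delta>0[abs_def])
      moreover have "(\<Sum>k. ennreal (2 * (1/2) ^ k)) < \<infinity>" by (rule half) simp
      ultimately show ?thesis by (simp only: ennreal_add_less_top infinity_ennreal_def simp_thms)
    qed
    finally show ?thesis .
  qed
  have ae1: "AE x in halfline. summable (\<lambda>k. norm (\<delta> k x))"
  proof -
    have "AE x in halfline. (\<Sum>k. ennreal (norm (\<delta> k x))) \<noteq> \<infinity>"
      using sum_\<delta> by (intro nn_integral_PInf_AE borel_measurable_suminf_order borel_measurable_norm_halfline
          strongly_measurable_simple \<delta>s) auto
    then show ?thesis by eventually_elim (auto intro: summable_suminf_not_top)
  qed
  have ae2: "AE x in halfline. (\<lambda>k. \<tau> k x) \<longlonglongrightarrow> g x"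
  proof -
    have "AE x in halfline. (\<Sum>k. ennreal (norm (g x - \<tau> k x))) \<noteq> \<infinity>"
      using sum_dist by (intro nn_integral_PInf_AE borel_measurable_suminf_order borel_measurable_norm_halfline dm) auto
    then show ?thesis
    proof eventually_elim
      case (elim x)
      then have "summable (\<lambda>k. norm (g x - \<tau> k x))" by (auto intro: summable_suminf_not_top)
      then have "(\<lambda>k. norm (g x - \<tau> k x)) \<longlonglongrightarrow> 0" by (rule summable_LIMSEQ_zero)
      then have "(\<lambda>k. g x - \<tau> k x) \<longlonglongrightarrow> 0" by (rule tendsto_norm_zero_cancel)
      from tendsto_diff[OF tendsto_const[of "g x"] this] show ?case by simp
    qed
  qed
  define G where "G R s = (if summable (\<lambda>k. norm (\<delta> k s)) then \<Sum>k. R (\<delta> k s) else 0)" for R :: "'a \<Rightarrow> 'a" and s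
  have sR: "summable (\<lambda>k. norm (R (\<delta> k s)))"
    if "\<And>u. norm (R u) \<le> K * norm u" "summable (\<lambda>k. norm (\<delta> k s))" for R :: "'a \<Rightarrow> 'a" and s
    by (rule summable_comparison_test[OF _ summable_mult[OF that(2), of K]]) (use that(1) in auto)
  have G: "G R \<in> L1 \<and> (\<forall>s. 0 \<le> G R s)"
    if R0: "\<And>u. 0 \<le> R u" and RK: "\<And>u. norm (R u) \<le> K * norm u" for R :: "'a \<Rightarrow> 'a"
  proof -
    have pos: "0 \<le> G R s" for s
      using suminf_nonneg_closed_cone[OF closed, of "\<lambda>k. R (\<delta> k s)"] sR[OF RK, of s] R0
      by (auto simp: G_def intro: summable_norm_cancel)
    have m: "strongly_measurable halfline (G R)"
    proof (rule H.strongly_measurable_LIMSEQ)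
      show "strongly_measurable halfline (\<lambda>s. \<Sum>k<n. R (\<delta> k s))" for n
        by (intro strongly_measurable_sum strongly_measurable_simple simple_function_compose1[OF \<delta>s])
      show "AE s in halfline. (\<lambda>n. \<Sum>k<n. R (\<delta> k s)) \<longlonglongrightarrow> G R s"
        using ae1
        by eventually_elim (simp add: G_def summable_LIMSEQ summable_norm_cancel[OF sR[OF RK]])
    qed
    have "L1_norm (G R) \<le> (\<integral>\<^sup>+s. ennreal \<bar>K\<bar> * (\<Sum>k. ennreal (norm (\<delta> k s))) \<partial>halfline)"
      unfolding L1_norm_def
    proof (rule nn_integral_mono)
      fix s
      show "ennreal (norm (G R s)) \<le> ennreal \<bar>K\<bar> * (\<Sum>k. ennreal (norm (\<delta> k s)))"
      proof (cases "summable (\<lambda>k. norm (\<delta> k s))")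
        case True
        have "norm (G R s) \<le> (\<Sum>k. norm (R (\<delta> k s)))"
          using True by (simp add: G_def summable_norm[OF sR[OF RK True]])
        also have "\<dots> \<le> (\<Sum>k. \<bar>K\<bar> * norm (\<delta> k s))"
          by (intro suminf_le sR[OF RK True] summable_mult True)
            (rule order_trans[OF RK], simp add: mult_right_mono)
        also have "\<dots> = \<bar>K\<bar> * (\<Sum>k. norm (\<delta> k s))" by (rule suminf_mult[OF True])
        finally have "ennreal (norm (G R s)) \<le> ennreal (\<bar>K\<bar> * (\<Sum>k. norm (\<delta> k s)))" by (rule ennreal_leI)
        also have "\<dots> = ennreal \<bar>K\<bar> * (\<Sum>k. ennreal (norm (\<delta> k s)))"
          using True by (simp add: ennreal_mult suminf_nonneg suminf_ennreal2)
        finally show ?thesis .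
      qed (simp add: G_def)
    qed
    also have "\<dots> = ennreal \<bar>K\<bar> * (\<integral>\<^sup>+s. (\<Sum>k. ennreal (norm (\<delta> k s))) \<partial>halfline)"
      by (intro nn_integral_cmult borel_measurable_suminf_order borel_measurable_norm_halfline
          strongly_measurable_simple \<delta>s)
    also have "\<dots> < \<infinity>" using sum_\<delta> by (simp add: ennreal_mult_less_top)
    finally show ?thesis using m pos by (simp add: L1_def)
  qed
  have "AE s in halfline. g s = G P s - G Q s"
    using ae1 ae2
  proof eventually_elim
    case (elim s)
    have "(\<lambda>n. \<Sum>k<Suc n. \<delta> k s) \<longlonglongrightarrow> g s" using elim(2) by (simp only: \<delta>sum)
    then have "(\<lambda>k. \<delta> k s) sums g s" unfolding sums_def by (rule LIMSEQ_imp_Suc)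
    moreover have "(\<lambda>k. P (\<delta> k s) - Q (\<delta> k s)) sums (G P s - G Q s)"
      using elim(1) by (auto simp: G_def intro!: sums_diff summable_sums
          summable_norm_cancel[OF sR] PQ(4,5))
    ultimately show ?case using PQ(3) by (auto intro: sums_unique2)
  qed
  then show ?thesis
    using G[OF PQ(1,4)] G[OF PQ(2,5)] by (rule_tac exI[of _ "G P"], rule_tac exI[of _ "G Q"]) simp
qed

lemma nn_integral_exp_le_1: "(\<integral>\<^sup>+d. ennreal (exp (- d)) \<partial>lebesgue_on {0..h::real}) \<le> 1"
proof (cases "0 \<le> h")
  case True
  have "(\<integral>\<^sup>+d. ennreal (exp (- d)) * indicator {0..h} d \<partial>lborel) = ennreal (- exp (- h) - (- exp (- 0)))"
    by (rule nn_integral_FTC_Icc) (use True in \<open>auto intro!: derivative_eq_intros\<close>)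
  also have "\<dots> \<le> 1" by (simp add: ennreal_le_1)
  finally show ?thesis by (simp add: nn_integral_restrict_space nn_integral_completion)
next
  case False
  then show ?thesis by (simp add: nn_integral_restrict_space)
qed

text \<open>
  Integrated over \<open>t\<close>, the bound \<open>exp (- d)\<close> at delay \<open>d = t - s\<close> contributes a factor at most 1. The identity
  for strips covers delays up to \<open>n\<close> only; Fatou's lemma removes this restriction.
\<close>

lemma (in bounded_evolution) mild_in_L1:
  assumes decay: "\<And>s t u. 0 \<le> s \<Longrightarrow> s \<le> t \<Longrightarrow> norm (U t s u) \<le> K * exp (s - t) * norm u"
    and g: "g \<in> L1"
  shows "mild g \<in> L1"
proof -
  have gs: "strongly_measurable halfline g" using g by (simp add: L1_def)
  have "strongly_measurable (lebesgue_on Delta) (\<lambda>p. U (fst p) (snd p) (g (snd p)))"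
    by (intro strongly_measurable_Delta_operator strongly_measurable_snd gs)
  from complete_measure.strongly_measurable_norm[OF complete_lebesgue_on[OF Delta_lebesgue] this]
  have F: "(\<lambda>p. ennreal (norm (U (fst p) (snd p) (g (snd p))))) \<in> borel_measurable (lebesgue_on Delta)"
    by simp
  \<comment> \<open>for each \<open>t\<close> this is eventually the integral over all of \<open>[0,t]\<close>\<close>
  let ?\<phi> = "\<lambda>n t. nint (lebesgue_on {max 0 (t - real n)..t}) (\<lambda>r. U t r (g r))"
  have bound: "(\<integral>\<^sup>+t. ?\<phi> n t \<partial>halfline) \<le> ennreal K * L1_norm g" for n
  proof -
    have "(\<integral>\<^sup>+t. ?\<phi> n t \<partial>halfline)
      = (\<integral>\<^sup>+d. nint halfline (\<lambda>s. U (s + d) s (g s)) \<partial>lebesgue_on {0..real n})"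
      using nn_integral_strip(2)[OF F, of "real n"] by simp
    also have "\<dots> \<le> (\<integral>\<^sup>+d. (ennreal K * L1_norm g) * ennreal (exp (- d)) \<partial>lebesgue_on {0..real n})"
    proof (rule nn_integral_mono)
      fix d assume "d \<in> space (lebesgue_on {0..real n})"
      then have d: "0 \<le> d" by simp
      have "(nint halfline (\<lambda>s. U (s + d) s (g s)))
        \<le> (\<integral>\<^sup>+s. ennreal (K * exp (- d)) * ennreal (norm (g s)) \<partial>halfline)"
      proof (rule nn_integral_mono)
        fix s assume "s \<in> space halfline"
        then show "ennreal (norm (U (s + d) s (g s))) \<le> ennreal (K * exp (- d)) * ennreal (norm (g s))"
          using decay[of s "s + d" "g s"] d K_ge_1 by (subst ennreal_mult[symmetric]) (auto intro: ennreal_leI)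
      qed
      also have "\<dots> = ennreal (K * exp (- d)) * L1_norm g"
        unfolding L1_norm_def by (rule nn_integral_cmult[OF borel_measurable_norm_halfline[OF gs]])
      also have "\<dots> = (ennreal K * L1_norm g) * ennreal (exp (- d))"
        using K_ge_1 by (simp add: ennreal_mult mult_ac)
      finally show "(nint halfline (\<lambda>s. U (s + d) s (g s)))
        \<le> (ennreal K * L1_norm g) * ennreal (exp (- d))" .
    qed
    also have "\<dots> = (ennreal K * L1_norm g) * (\<integral>\<^sup>+d. ennreal (exp (- d)) \<partial>lebesgue_on {0..real n})"
      by (rule nn_integral_cmult) (intro measurable_restrict_space1 measurable_completion, measurable)
    also have "\<dots> \<le> (ennreal K * L1_norm g) * 1"
      by (intro mult_left_mono nn_integral_exp_le_1) simp
    finally show ?thesis by simp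
  qed
  have "L1_norm (mild g) \<le> (\<integral>\<^sup>+t. liminf (\<lambda>n. ?\<phi> n t) \<partial>halfline)"
    unfolding L1_norm_def
  proof (rule nn_integral_mono)
    fix t assume "t \<in> space halfline"
    then have t: "0 \<le> t" by simp
    interpret R: complete_measure "lebesgue_on {0..t}" by (rule complete_lebesgue_on) simp
    let ?c = "nint (lebesgue_on {0..t}) (\<lambda>r. U t r (g r))"
    obtain m where "t < real m" using reals_Archimedean2 by blast
    then have "\<forall>\<^sub>F n in sequentially. ?\<phi> n t = ?c"
      by (intro eventually_sequentiallyI[of m]) (simp add: max_absorb1)
    then have "(\<lambda>n. ?\<phi> n t) \<longlonglongrightarrow> ?c" by (rule tendsto_eventually)
    then have "liminf (\<lambda>n. ?\<phi> n t) = ?c" by (intro lim_imp_Liminf) auto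
    then show "ennreal (norm (mild g t)) \<le> liminf (\<lambda>n. ?\<phi> n t)"
      using R.norm_strong_integral_le[OF strongly_integrable_row(1)[OF g, of "{0..t}" t]]
      by (simp add: mild_def)
  qed
  also have "\<dots> \<le> liminf (\<lambda>n. \<integral>\<^sup>+t. ?\<phi> n t \<partial>halfline)"
    using nn_integral_strip(4)[OF F] by (intro nn_integral_liminf) simp
  also have "\<dots> \<le> liminf (\<lambda>n. ennreal K * L1_norm g)"
    by (intro Liminf_mono always_eventually allI bound)
  also have "\<dots> = ennreal K * L1_norm g" by (simp add: Liminf_const)
  also have "\<dots> < \<infinity>" using g by (simp add: L1_def ennreal_mult_less_top)
  finally show ?thesis using strongly_measurable_mild[OF g] by (simp add: L1_def)
qed

text \<open>
  Damping subtracts 1 from the generator \<open>\<Z>\<close> of the evolution semigroup. The gain is that the mild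
  solutions of the damped family are integrable: they represent the resolvent of \<open>\<Z>\<close> at 1.
\<close>

definition damped :: "(real \<Rightarrow> real \<Rightarrow> 'a \<Rightarrow> 'a::real_normed_vector) \<Rightarrow> real \<Rightarrow> real \<Rightarrow> 'a \<Rightarrow> 'a" where
  "damped U t s u = exp (s - t) *\<^sub>R U t s u"

lemma (in bounded_evolution) norm_damped_le:
  assumes "0 \<le> s" "s \<le> t"
  shows "norm (damped U t s u) \<le> K * exp (s - t) * norm u"
  using mult_left_mono[OF norm_le[OF assms, of u], of "exp (s - t)"] by (simp add: damped_def mult_ac)

lemma (in bounded_evolution) bounded_evolution_damped: "bounded_evolution (damped U) K"
proof (intro bounded_evolution.intro)
  show "1 \<le> K" by (rule K_ge_1)
  show le: "norm (damped U t s u) \<le> K * norm u" if "0 \<le> s" "s \<le> t" for s t u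
  proof -
    have "K * exp (s - t) * norm u \<le> K * 1 * norm u"
      using that K_ge_1 by (intro mult_right_mono mult_left_mono) auto
    then show ?thesis using norm_damped_le[OF that, of u] by simp
  qed
  show "evolution_family (damped U)"
    unfolding evolution_family_def
  proof (intro conjI allI impI)
    fix t s :: real assume "0 \<le> s \<and> s \<le> t"
    then show "bounded_linear (damped U t s)"
      unfolding damped_def by (intro bounded_linear_const_scaleR linear) auto
  next
    fix u
    show "continuous_on Delta (\<lambda>(t, s). damped U t s u)"
      unfolding damped_def case_prod_beta by (intro continuous_intros continuous_Delta)
  next
    fix t r s :: real assume *: "0 \<le> s \<and> s \<le> r \<and> r \<le> t"
    then interpret L: bounded_linear "U t r" by (intro linear) auto
    show "damped U t s = damped U t r \<circ> damped U r s"
    proof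
      fix u
      have "exp (s - t) = exp (r - t) * exp (s - r)" by (simp flip: exp_add)
      then show "damped U t s u = (damped U t r \<circ> damped U r s) u"
        using cocycle[of s r t u] * by (simp add: damped_def L.scaleR)
    qed
  next
    fix t :: real assume "0 \<le> t"
    then show "damped U t t = id" by (auto simp: damped_def refl)
  next
    show "\<exists>C>0. \<exists>\<beta>>0. \<forall>t s. 0 \<le> s \<and> s \<le> t \<longrightarrow> onorm (damped U t s) \<le> C * exp (\<beta> * (t - s))"
    proof (intro exI[of _ K] conjI allI impI)
      fix t s :: real assume *: "0 \<le> s \<and> s \<le> t"
      have "onorm (damped U t s) \<le> K" using K_ge_1 le * by (intro onorm_bound) auto
      also have "K \<le> K * exp (K * (t - s))" using K_ge_1 * by simp
      finally show "onorm (damped U t s) \<le> K * exp (K * (t - s))" .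
    qed (use K_ge_1 in auto)
  qed
qed

section \<open>The perturbation and potentials of positive functions\<close>

text \<open>
  In the coordinates \<open>(d, s)\<close> with \<open>t = s + d\<close>, which are obtained by a shear, the lines of slope 1 become
  slices.
\<close>

lemma AE_Delta_diagonal:
  assumes "AE p in lebesgue_on Delta. P (fst p) (snd p)"
  shows "AE d in lebesgue. 0 \<le> d \<longrightarrow> (AE s in halfline. P (s + d) s)"
proof -
  have "AE p in lebesgue. p \<in> Delta \<longrightarrow> P (fst p) (snd p)"
    using assms Delta_lebesgue by (simp add: AE_restrict_space_iff)
  from AE_lebesgue_slices(1)[OF nonsingular_AE[OF nonsingular_shear this]]
  show ?thesis
  proof eventually_elim
    case (elim d)
    show ?case
    proof
      assume d: "0 \<le> d"
      show "AE s in halfline. P (s + d) s"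
        unfolding AE_halfline_iff using elim
        by eventually_elim (use d in \<open>auto simp: Delta_def add.commute\<close>)
    qed
  qed
qed

lemma strongly_measurable_Delta_diagonal:
  assumes F: "strongly_measurable (lebesgue_on Delta) F"
  shows "AE d in lebesgue. 0 \<le> d \<longrightarrow> strongly_measurable halfline (\<lambda>s. F (s + d, s))"
proof -
  have "strongly_measurable lebesgue (\<lambda>p. indicator Delta p *\<^sub>R F p)"
    using F strongly_measurable_restrict_space_iff[OF Delta_lebesgue, of F] by simp
  from strongly_measurable_slice[OF nonsingular_strongly_measurable[OF nonsingular_shear this]]
  show ?thesis
  proof eventually_elim
    case (elim d)
    show ?case
    proof
      assume d: "0 \<le> d"
      have "strongly_measurable (lebesgue_on UNIV) (\<lambda>s. indicator Delta (d + s, s) *\<^sub>R F (d + s, s))"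
        using elim by (simp add: lebesgue_on_UNIV_eq)
      from strongly_measurable_lebesgue_on_subset[OF this, of "{0..}"]
      have "strongly_measurable halfline (\<lambda>s. indicator Delta (d + s, s) *\<^sub>R F (d + s, s))" by simp
      then show "strongly_measurable halfline (\<lambda>s. F (s + d, s))"
        by (rule strongly_measurable_cong_AE) (use d in \<open>auto intro!: AE_I2 simp: Delta_def add.commute\<close>)
    qed
  qed
qed

lemma AE_halfline_unshift:
  assumes "AE s in halfline. P (s + d)" "0 \<le> d"
  shows "AE x in halfline. d \<le> x \<longrightarrow> P x"
  using nonsingular_AE[OF nonsingular_translation[of "- d"] assms(1)[unfolded AE_halfline_iff]]
  unfolding AE_halfline_iff by eventually_elim simp

lemma strongly_measurable_halfline_unshift:
  assumes f: "strongly_measurable halfline (\<lambda>s. F (s + d))" and d: "0 \<le> d"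
  shows "strongly_measurable halfline (\<lambda>x. if d \<le> x then F x else 0)"
proof -
  have "strongly_measurable (lebesgue_on {d..}) (\<lambda>x. F (x + - d + d))"
    by (rule strongly_measurable_pullback[OF nonsingular_translation f]) auto
  from strongly_measurable_extend_zero[OF this, of "{0..}"] show ?thesis by (simp cong: if_cong)
qed

lemma AE_interval_exists:
  assumes "AE x in lebesgue. P x" "a < (b::real)"
  shows "\<exists>x. a < x \<and> x < b \<and> P x"
proof (rule ccontr)
  assume n: "\<not> ?thesis"
  have "AE x in lebesgue. x \<notin> {a<..<b}"
    using assms(1) by eventually_elim (use n in auto)
  then have "{a<..<b} \<in> null_sets lebesgue"
    by (rule AE_iff_null_sets[THEN iffD2, rotated]) simp
  from null_setsD1[OF this] show False using assms(2) by simp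
qed

lemma L1_norm_le_add_diff:
  assumes f: "strongly_measurable halfline f" and g: "strongly_measurable halfline g"
  shows "L1_norm f \<le> L1_norm g + L1_norm (\<lambda>s. f s - g s)"
  using L1_norm_add_le[OF g strongly_measurable_diff[OF f g]] by simp

lemma ennreal_norm_lincomb_le:
  assumes "0 \<le> a" "0 \<le> b"
  shows "ennreal (norm (a *\<^sub>R x + b *\<^sub>R y)) \<le> ennreal a * ennreal (norm x) + ennreal b * ennreal (norm y)"
proof -
  have "ennreal (norm (a *\<^sub>R x + b *\<^sub>R y)) \<le> ennreal (a * norm x) + ennreal (b * norm y)"
    using ennreal_norm_triangle[of "a *\<^sub>R x" "b *\<^sub>R y"] assms by simp
  then show ?thesis using assms by (simp add: ennreal_mult)
qed

text \<open>
  That the cone is generating enters in its quantitative form, with the constant \<open>K\<close> of bounded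
  decompositions.
\<close>

locale positive_perturbation =
  fixes U :: "real \<Rightarrow> real \<Rightarrow> 'a \<Rightarrow> 'a::{banach, ordered_real_vector}"
    and B :: "real \<Rightarrow> 'a \<Rightarrow> 'a"
    and D :: "real \<Rightarrow> 'a set"
    and K :: real
  assumes cone_closed: "closed {u::'a. 0 \<le> u}"
    and norm_additive: "\<And>u v::'a. 0 \<le> u \<Longrightarrow> 0 \<le> v \<Longrightarrow> norm (u + v) = norm u + norm v"
    and evolution: "evolution_family U"
    and B_linear: "\<And>t. 0 \<le> t \<Longrightarrow> linear_on_domain (D t) (B t)"
    and U_positive: "\<And>t s u. 0 \<le> s \<Longrightarrow> s \<le> t \<Longrightarrow> 0 \<le> u \<Longrightarrow> 0 \<le> U t s u"
    and U_contractive: "\<And>t s u. 0 \<le> s \<Longrightarrow> s \<le> t \<Longrightarrow> 0 \<le> u \<Longrightarrow> norm (U t s u) \<le> norm u"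
    and B_positive: "\<And>t u. 0 \<le> t \<Longrightarrow> u \<in> D t \<Longrightarrow> 0 \<le> u \<Longrightarrow> 0 \<le> B t u"
    and BU_defined: "\<And>s u. 0 \<le> s \<Longrightarrow> AE t in lebesgue_on {s..}. U t s u \<in> D t"
    and BU_measurable:
      "\<And>s u. 0 \<le> s \<Longrightarrow> strongly_measurable (lebesgue_on {s..}) (\<lambda>t. B t (U t s u))"
    and BU_integral:
      "\<And>t s u. 0 \<le> s \<Longrightarrow> s \<le> t \<Longrightarrow> 0 \<le> u \<Longrightarrow>
         (nint (lebesgue_on {s..t}) (\<lambda>\<tau>. B \<tau> (U \<tau> s u)))
           \<le> ennreal (norm u - norm (U t s u))"
    and BUf_defined:
      "\<And>f. f \<in> L1 \<Longrightarrow> AE (t, s) in lebesgue_on Delta. U t s (f s) \<in> D t"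
    and BUf_measurable:
      "\<And>f. f \<in> L1 \<Longrightarrow>
         strongly_measurable (lebesgue_on Delta) (\<lambda>(t, s). B t (U t s (f s)))"
    and B_increasingly_closed: "\<And>t. 0 \<le> t \<Longrightarrow> increasingly_closed (D t) (B t)"
    and decomposition_constant: "1 \<le> K"
    and decomposition: "\<And>u::'a. \<exists>v w. 0 \<le> v \<and> 0 \<le> w \<and> u = v - w \<and> norm v \<le> K * norm u \<and> norm w \<le> K * norm u"
begin

text \<open>
  Contractivity is known on the cone only; decomposing \<open>u\<close> costs the factor \<open>2 * K\<close>.
\<close>

lemma linear_contractive_norm_le:
  fixes T :: "'a \<Rightarrow> 'a"
  assumes T: "linear T" and le: "\<And>u. 0 \<le> u \<Longrightarrow> norm (T u) \<le> norm u"
  shows "norm (T u) \<le> 2 * K * norm u"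
proof -
  obtain v w where vw: "0 \<le> v" "0 \<le> w" "u = v - w" "norm v \<le> K * norm u" "norm w \<le> K * norm u"
    using decomposition by blast
  have "norm (T u) \<le> norm (T v) + norm (T w)"
    unfolding vw(3) linear_diff[OF T] by (rule norm_triangle_ineq4)
  then show ?thesis using le[OF vw(1)] le[OF vw(2)] vw(4,5) by simp
qed

sublocale bounded_evolution U "2 * K"
proof (rule bounded_evolution.intro[OF evolution])
  show "1 \<le> 2 * K" using decomposition_constant by simp
  show "norm (U t s u) \<le> 2 * K * norm u" if "0 \<le> s" "s \<le> t" for s t u
    using evolution that by (intro linear_contractive_norm_le U_contractive bounded_linear.linear)
      (simp_all add: evolution_family_def)
qed

sublocale E: bounded_evolution "damped U" "2 * K"
  by (rule bounded_evolution_damped)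

text \<open>
  Additivity of the norm on the cone, applied to \<open>v = u + (v - u)\<close>.
\<close>

lemma norm_diff_positive: "0 \<le> u \<Longrightarrow> u \<le> v \<Longrightarrow> norm (v - u) = norm v - norm (u::'a)"
  using norm_additive[of u "v - u"] by simp

lemma norm_mono: "0 \<le> u \<Longrightarrow> u \<le> v \<Longrightarrow> norm u \<le> norm (v::'a)"
  using norm_diff_positive[of u v] norm_ge_zero[of "v - u"] by linarith

lemma E_positive: "0 \<le> s \<Longrightarrow> s \<le> t \<Longrightarrow> 0 \<le> u \<Longrightarrow> 0 \<le> damped U t s u"
  by (simp add: damped_def U_positive scaleR_nonneg_nonneg)

lemma E_mono:
  assumes "0 \<le> s" "s \<le> t" "u \<le> v"
  shows "damped U t s u \<le> damped U t s v"
  using E_positive[OF assms(1,2), of "v - u"] assms(3)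
    linear_diff[OF bounded_linear.linear[OF E.linear[OF assms(1,2)]], of v u] by simp

lemma norm_E_le_U: "0 \<le> s \<Longrightarrow> s \<le> t \<Longrightarrow> norm (damped U t s u) \<le> norm (U t s u)"
  by (simp add: damped_def mult_left_le_one_le)

lemma D_zero: "0 \<le> t \<Longrightarrow> 0 \<in> D t"
  and B_zero: "0 \<le> t \<Longrightarrow> B t 0 = 0"
  and D_scaleR: "0 \<le> t \<Longrightarrow> u \<in> D t \<Longrightarrow> c *\<^sub>R u \<in> D t"
  and B_scaleR: "0 \<le> t \<Longrightarrow> u \<in> D t \<Longrightarrow> B t (c *\<^sub>R u) = c *\<^sub>R B t u"
  and D_diff: "0 \<le> t \<Longrightarrow> u \<in> D t \<Longrightarrow> v \<in> D t \<Longrightarrow> u - v \<in> D t"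
  and B_diff: "0 \<le> t \<Longrightarrow> u \<in> D t \<Longrightarrow> v \<in> D t \<Longrightarrow> B t (u - v) = B t u - B t v"
proof -
  assume t: "0 \<le> t"
  have D: "subspace (D t)" and add: "\<And>u v. u \<in> D t \<Longrightarrow> v \<in> D t \<Longrightarrow> B t (u + v) = B t u + B t v"
    and scale: "\<And>u c. u \<in> D t \<Longrightarrow> B t (c *\<^sub>R u) = c *\<^sub>R B t u"
    using B_linear[OF t] by (auto simp: linear_on_domain_def)
  show 0: "0 \<in> D t" by (rule subspace_0[OF D])
  show "B t 0 = 0" using scale[OF 0, of 0] by simp
  show "u \<in> D t \<Longrightarrow> c *\<^sub>R u \<in> D t" by (rule subspace_scale[OF D])
  show "u \<in> D t \<Longrightarrow> B t (c *\<^sub>R u) = c *\<^sub>R B t u" by (rule scale)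
  show "u \<in> D t \<Longrightarrow> v \<in> D t \<Longrightarrow> u - v \<in> D t" by (rule subspace_diff[OF D])
  show "B t (u - v) = B t u - B t v" if "u \<in> D t" "v \<in> D t"
    using add[OF that(1) subspace_scale[OF D that(2), of "-1"]] scale[OF that(2), of "-1"] by simp
qed

lemma B_mono:
  assumes "0 \<le> t" "u \<in> D t" "v \<in> D t" "u \<le> v"
  shows "B t u \<le> B t v"
  using B_positive[OF assms(1) D_diff[OF assms(1,3,2)]] assms by (simp add: B_diff)

lemma B_damped: "0 \<le> t \<Longrightarrow> U t s u \<in> D t \<Longrightarrow> B t (damped U t s u) = exp (s - t) *\<^sub>R B t (U t s u)"
  and damped_in_D: "0 \<le> t \<Longrightarrow> U t s u \<in> D t \<Longrightarrow> damped U t s u \<in> D t"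
  by (simp_all add: damped_def B_scaleR D_scaleR)

lemma BEf_defined:
  assumes "f \<in> L1"
  shows "AE p in lebesgue_on Delta. U (fst p) (snd p) (f (snd p)) \<in> D (fst p)"
  using BUf_defined[OF assms] by (simp add: case_prod_beta)

lemma BEf_measurable:
  assumes f: "f \<in> L1"
  shows "strongly_measurable (lebesgue_on Delta) (\<lambda>p. B (fst p) (damped U (fst p) (snd p) (f (snd p))))"
proof (rule strongly_measurable_cong_AE)
  have "(\<lambda>p::real \<times> real. exp (snd p - fst p)) \<in> borel_measurable (lebesgue_on Delta)"
    by (rule continuous_imp_measurable_on_sets_lebesgue[OF _ Delta_lebesgue]) (intro continuous_intros)
  then show "strongly_measurable (lebesgue_on Delta)
      (\<lambda>p. exp (snd p - fst p) *\<^sub>R B (fst p) (U (fst p) (snd p) (f (snd p))))"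
    using BUf_measurable[OF f] by (intro strongly_measurable_scaleR) (simp_all add: case_prod_beta')
  show "AE p in lebesgue_on Delta. exp (snd p - fst p) *\<^sub>R B (fst p) (U (fst p) (snd p) (f (snd p)))
      = B (fst p) (damped U (fst p) (snd p) (f (snd p)))"
    using BEf_defined[OF f] AE_space
    by eventually_elim (auto simp: B_damped Delta_def)
qed

context
  fixes g :: "real \<Rightarrow> 'a"
  assumes g: "g \<in> L1" and g_pos: "\<And>s. 0 \<le> g s"
begin

text \<open>
  The potential of \<open>g\<close>, and its values delayed by \<open>d\<close> and transported back to the present.
\<close>

abbreviation (input) "pot \<equiv> E.mild g"
abbreviation (input) "lag d \<equiv> evolution_semigroup (damped U) d (E.mild g)"

lemma pot_L1: "pot \<in> L1"
  by (rule E.mild_in_L1[OF norm_damped_le g])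

lemma pot_strongly_measurable: "strongly_measurable halfline pot"
  using pot_L1 by (simp add: L1_def)

lemma pot_remainder_nonneg:
  assumes "0 \<le> r"
  shows "0 \<le> strong_integral (lebesgue_on {r..t}) (\<lambda>q. damped U t q (g q))"
proof -
  interpret R: complete_measure "lebesgue_on {r..t}" by (rule complete_lebesgue_on) simp
  show ?thesis
    using assms by (intro R.strong_integral_nonneg[OF cone_closed E.strongly_integrable_row(1)[OF g]] AE_I2)
      (auto intro: E_positive g_pos)
qed

lemma pot_nonneg: "0 \<le> pot s"
  unfolding E.mild_def by (rule pot_remainder_nonneg) simp

text \<open>
  What is lost by the delay is the integral of positive values over the last stretch of time.
\<close>

lemma E_pot_le: "0 \<le> s \<Longrightarrow> s \<le> t \<Longrightarrow> damped U t s (pot s) \<le> pot t"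
  using E.mild_split[OF g, of s t] pot_remainder_nonneg[of s t] by simp

lemma lag_nonneg: "0 \<le> d \<Longrightarrow> 0 \<le> lag d x"
  by (auto simp: evolution_semigroup_def intro: E_positive pot_nonneg)

lemma lag_le_pot: "0 \<le> d \<Longrightarrow> lag d x \<le> pot x"
  using E_pot_le[of "x - d" x] pot_nonneg by (auto simp: evolution_semigroup_def)

lemma lag_antimono:
  assumes "0 \<le> d'" "d' \<le> d"
  shows "lag d x \<le> lag d' x"
proof (cases "d \<le> x")
  case True
  have "damped U x (x - d) (pot (x - d)) = damped U x (x - d') (damped U (x - d') (x - d) (pot (x - d)))"
    using True assms by (simp add: E.cocycle)
  also have "\<dots> \<le> damped U x (x - d') (pot (x - d'))"
    using True assms by (intro E_mono E_pot_le) auto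
  finally show ?thesis using True assms by (simp add: evolution_semigroup_def)
next
  case False
  then show ?thesis using lag_nonneg[OF assms(1)] by (simp add: evolution_semigroup_def)
qed

lemma lag_tendsto_pot:
  assumes x: "0 < x" and d: "d \<longlonglongrightarrow> 0" "\<And>n::nat. 0 < d n" "decseq d"
  shows "(\<lambda>n. lag (d n) x) \<longlonglongrightarrow> pot x"
proof -
  let ?g = "\<lambda>r. ennreal (norm (g r))"
  have gm: "?g \<in> borel_measurable halfline"
    using g by (intro borel_measurable_norm_halfline) (simp add: L1_def)
  have eq: "(\<integral>\<^sup>+r. ?g r \<partial>lebesgue_on {max 0 (x - h)..x}) = (\<integral>\<^sup>+r. ?g r * indicator {x - h..x} r \<partial>halfline)" for h
    by (simp add: nn_integral_restrict_space, rule nn_integral_cong) (auto simp: indicator_def)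
  have "(\<lambda>n. \<integral>\<^sup>+r. ?g r * indicator {x - d n..x} r \<partial>halfline) \<longlonglongrightarrow> (\<integral>\<^sup>+r. 0 \<partial>halfline)"
  proof (rule nn_integral_dominated_convergence[where w = ?g])
    have "{0..} \<inter> {x - d n..x} \<in> sets lebesgue" for n by simp
    then show "(\<lambda>r. ?g r * indicator {x - d n..x} r) \<in> borel_measurable halfline" for n
      by (intro borel_measurable_times_ennreal gm measurable_restrict_space1 borel_measurable_indicator) simp
    show "AE r in halfline. ?g r * indicator {x - d n..x} r \<le> ?g r" for n
      by (intro AE_I2) (auto simp: indicator_def)
    show "(\<integral>\<^sup>+r. ?g r \<partial>halfline) < \<infinity>" using g by (simp add: L1_def L1_norm_def)
    have "AE r in lebesgue. r \<noteq> x" by (rule AE_completion) (rule AE_lborel_singleton)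
    then have "AE r in halfline. r \<noteq> x" unfolding AE_halfline_iff by eventually_elim simp
    then show "AE r in halfline. (\<lambda>n. ?g r * indicator {x - d n..x} r) \<longlonglongrightarrow> 0"
    proof eventually_elim
      case (elim r)
      have "\<forall>\<^sub>F n in sequentially. ?g r * indicator {x - d n..x} r = 0"
      proof (cases "r < x")
        case True
        then have "\<forall>\<^sub>F n in sequentially. d n < x - r" using d(1) by (intro order_tendstoD) auto
        then show ?thesis by eventually_elim (auto simp: indicator_def)
      next
        case False
        then show ?thesis using elim by (auto simp: indicator_def)
      qed
      then show ?case by (rule tendsto_eventually)
    qed
  qed (use gm in auto)
  then have "(\<lambda>n. ennreal (2 * K) * (\<integral>\<^sup>+r. ?g r \<partial>lebesgue_on {max 0 (x - d n)..x})) \<longlonglongrightarrow> ennreal (2 * K) * 0"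
    unfolding eq by (intro ennreal_tendsto_cmult) auto
  then have lim: "(\<lambda>n. ennreal (2 * K) * (\<integral>\<^sup>+r. ?g r \<partial>lebesgue_on {max 0 (x - d n)..x})) \<longlonglongrightarrow> 0" by simp
  have "(\<lambda>n. ennreal (norm (pot x - lag (d n) x))) \<longlonglongrightarrow> ennreal 0"
    unfolding ennreal_0
  proof (rule tendsto_sandwich[OF _ _ tendsto_const lim])
    show "\<forall>\<^sub>F n in sequentially. ennreal (norm (pot x - lag (d n) x))
      \<le> ennreal (2 * K) * (\<integral>\<^sup>+r. ?g r \<partial>lebesgue_on {max 0 (x - d n)..x})"
      using x d(2) by (intro always_eventually allI)
        (simp add: E.mild_increment[OF g] less_imp_le E.norm_mild_remainder_le[OF g])
  qed simp
  then have "(\<lambda>n. pot x - lag (d n) x) \<longlonglongrightarrow> 0"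
    by (rule tendsto_norm_zero_cancel[OF tendsto_ennrealD]) simp_all
  from tendsto_diff[OF tendsto_const[of "pot x"] this] show ?thesis by simp
qed

text \<open>
  The delays \<open>d\<close> for which \<open>B\<close> may be applied to \<open>lag d\<close>. By Tonelli's theorem almost every delay is
  admissible, but a given one need not be.
\<close>

definition admissible :: "real \<Rightarrow> bool" where
  "admissible d \<longleftrightarrow> 0 < d \<and> (AE x in halfline. lag d x \<in> D x) \<and> strongly_measurable halfline (\<lambda>x. B x (lag d x))"

lemma AE_admissible: "AE d in lebesgue. 0 < d \<longrightarrow> admissible d"
  using AE_Delta_diagonal[OF BEf_defined[OF pot_L1]] strongly_measurable_Delta_diagonal[OF BEf_measurable[OF pot_L1]]
proof eventually_elim
  case (elim d)
  show ?case
  proof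
    assume d: "0 < d"
    have ae: "AE x in halfline. d \<le> x \<longrightarrow> U x (x - d) (pot (x - d)) \<in> D x"
      using elim d by (intro AE_halfline_unshift) simp_all
    have "AE x in halfline. lag d x \<in> D x"
      using ae AE_space
      by eventually_elim (auto simp: evolution_semigroup_def damped_in_D D_zero)
    moreover have "strongly_measurable halfline (\<lambda>x. B x (lag d x))"
    proof (rule strongly_measurable_cong_AE)
      show "strongly_measurable halfline (\<lambda>x. if d \<le> x then B x (damped U x (x - d) (pot (x - d))) else 0)"
        using elim d by (intro strongly_measurable_halfline_unshift) simp_all
    qed (auto intro!: AE_I2 simp: evolution_semigroup_def B_zero)
    ultimately show "admissible d" using d by (simp add: admissible_def)
  qed
qed

text \<open>
  The norm of \<open>B\<close> applied to \<open>lag d\<close>, as an integral over the starting point \<open>s\<close> instead of the end point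
  \<open>s + d\<close>. In this form it is the integral along a line of slope 1 and makes sense for every \<open>d\<close>.
\<close>

definition B_lag_norm :: "real \<Rightarrow> ennreal" where
  "B_lag_norm d = (nint halfline (\<lambda>s. B (s + d) (damped U (s + d) s (pot s))))"

lemma L1_norm_B_lag:
  assumes "admissible d"
  shows "L1_norm (\<lambda>x. B x (lag d x)) = B_lag_norm d"
proof -
  have d: "0 \<le> d" using assms by (simp add: admissible_def)
  have "L1_norm (\<lambda>x. B x (lag d x)) = (nint (lebesgue_on {0..<d}) (\<lambda>x. B x (lag d x)))
      + (nint halfline (\<lambda>s. B (s + d) (lag d (s + d))))"
    unfolding L1_norm_def using assms d
    by (intro nn_integral_halfline_split borel_measurable_norm_halfline) (simp_all add: admissible_def)
  also have "(nint (lebesgue_on {0..<d}) (\<lambda>x. B x (lag d x))) = (\<integral>\<^sup>+x. 0 \<partial>lebesgue_on {0..<d})"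
    by (intro nn_integral_cong) (auto simp: evolution_semigroup_def B_zero)
  also have "(nint halfline (\<lambda>s. B (s + d) (lag d (s + d)))) = B_lag_norm d"
    unfolding B_lag_norm_def by (intro nn_integral_cong) (auto simp: evolution_semigroup_def)
  finally show ?thesis by simp
qed

text \<open>
  The assumed bound on \<open>B t (U t s u)\<close>, with \<open>u = pot s\<close>, integrated over \<open>s\<close>. Damping only decreases the norms
  on the left-hand side.
\<close>

lemma B_lag_norm_integral:
  assumes h: "0 \<le> h"
  shows "(\<integral>\<^sup>+d. B_lag_norm d \<partial>lebesgue_on {0..h}) + L1_norm (lag h) \<le> L1_norm pot"
proof -
  let ?F = "\<lambda>p. ennreal (norm (B (fst p) (damped U (fst p) (snd p) (pot (snd p)))))"
  have F: "?F \<in> borel_measurable (lebesgue_on Delta)"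
    using complete_measure.strongly_measurable_norm[OF complete_lebesgue_on[OF Delta_lebesgue] BEf_measurable[OF pot_L1]]
    by simp
  let ?a = "\<lambda>s. \<integral>\<^sup>+t. ?F (t, s) \<partial>lebesgue_on {s..s + h}"
  have "(\<integral>\<^sup>+d. B_lag_norm d \<partial>lebesgue_on {0..h}) = (\<integral>\<^sup>+s. ?a s \<partial>halfline)"
    unfolding B_lag_norm_def using nn_integral_strip(1)[OF F h] by simp
  then have "(\<integral>\<^sup>+d. B_lag_norm d \<partial>lebesgue_on {0..h}) + L1_norm (lag h)
    = (\<integral>\<^sup>+s. ?a s \<partial>halfline) + (nint halfline (\<lambda>s. damped U (s + h) s (pot s)))"
    by (simp add: E.L1_norm_evolution_semigroup[OF pot_strongly_measurable h])
  also have "\<dots> = (\<integral>\<^sup>+s. ?a s + ennreal (norm (damped U (s + h) s (pot s))) \<partial>halfline)"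
    by (intro nn_integral_add[symmetric] nn_integral_strip(3)[OF F h] borel_measurable_norm_halfline
        E.strongly_measurable_shift pot_strongly_measurable h)
  also have "\<dots> \<le> L1_norm pot"
    unfolding L1_norm_def
  proof (rule nn_integral_mono)
    fix s assume "s \<in> space halfline"
    then have s: "0 \<le> s" by simp
    have "AE t in lebesgue_on {s..s + h}. U t s (pot s) \<in> D t"
    proof -
      have "AE t in lebesgue. t \<in> {s..} \<longrightarrow> U t s (pot s) \<in> D t"
        using BU_defined[OF s, of "pot s"] by (simp add: AE_restrict_space_iff)
      then have "AE t in lebesgue. t \<in> {s..s + h} \<longrightarrow> U t s (pot s) \<in> D t" by eventually_elim simp
      then show ?thesis by (simp add: AE_restrict_space_iff)
    qed
    then have "AE t in lebesgue_on {s..s + h}. ?F (t, s) \<le> ennreal (norm (B t (U t s (pot s))))"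
      using AE_space
    proof eventually_elim
      case (elim t)
      then have "norm (B t (damped U t s (pot s))) \<le> norm (B t (U t s (pot s)))"
        using s by (simp add: B_damped mult_left_le_one_le)
      then show ?case by (simp add: ennreal_leI)
    qed
    then have "?a s \<le> (nint (lebesgue_on {s..s + h}) (\<lambda>t. B t (U t s (pot s))))"
      by (rule nn_integral_mono_AE)
    also have "\<dots> \<le> ennreal (norm (pot s) - norm (U (s + h) s (pot s)))"
      using s h by (intro BU_integral pot_nonneg) auto
    finally have "?a s + ennreal (norm (damped U (s + h) s (pot s)))
      \<le> ennreal (norm (pot s) - norm (U (s + h) s (pot s))) + ennreal (norm (U (s + h) s (pot s)))"
      using s h by (intro add_mono ennreal_leI norm_E_le_U) auto
    also have "\<dots> = ennreal (norm (pot s))"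
      using U_contractive[of s "s + h" "pot s"] s h pot_nonneg by (subst ennreal_plus[symmetric]) auto
    finally show "?a s + ennreal (norm (damped U (s + h) s (pot s))) \<le> ennreal (norm (pot s))" .
  qed
  finally show ?thesis .
qed

lemma B_lag_mono:
  assumes "admissible d" "admissible d'" "d' \<le> d"
  shows "AE x in halfline. 0 \<le> B x (lag d x) \<and> B x (lag d x) \<le> B x (lag d' x)"
proof -
  have "AE x in halfline. lag d x \<in> D x \<and> lag d' x \<in> D x"
    using assms by (simp add: admissible_def)
  then show ?thesis
    using AE_space
    by eventually_elim (use assms in \<open>auto simp: admissible_def intro!: B_positive B_mono lag_nonneg lag_antimono\<close>)
qed

text \<open>
  By \<open>B_lag_norm_integral\<close> the mean of \<open>B_lag_norm\<close> over \<open>[0,d]\<close> is at most the norm of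
  \<open>(pot - lag d) / d\<close>, and this quotient tends to \<open>g\<close>. As \<open>B_lag_norm\<close> increases when the delay decreases, its
  value at \<open>d\<close> is at most that mean.
\<close>

lemma B_lag_norm_bounded: "\<exists>h>0. \<forall>d. admissible d \<and> d < h \<longrightarrow> B_lag_norm d \<le> L1_norm g + 1"
proof -
  have gs: "strongly_measurable halfline g" using g by (simp add: L1_def)
  have "\<forall>\<^sub>F h in at_right 0. L1_norm (\<lambda>s. (pot s - lag h s) /\<^sub>R h - g s) < 1"
    by (intro order_tendstoD[OF E.generator_mild[OF g]]) simp
  then obtain b where b: "0 < b" "\<And>h. 0 < h \<Longrightarrow> h < b \<Longrightarrow> L1_norm (\<lambda>s. (pot s - lag h s) /\<^sub>R h - g s) < 1"
    by (auto simp: eventually_at_right_field)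
  have "B_lag_norm d \<le> L1_norm g + 1" if d: "admissible d" "d < b" for d
  proof -
    have d0: "0 < d" using d by (simp add: admissible_def)
    have vm: "strongly_measurable halfline (lag d)"
      using d0 by (intro E.strongly_measurable_evolution_semigroup pot_strongly_measurable) simp
    have qm: "strongly_measurable halfline (\<lambda>s. (pot s - lag d s) /\<^sub>R d)"
      by (intro strongly_measurable_scaleR strongly_measurable_diff pot_strongly_measurable vm) simp
    have L: "L1_norm (\<lambda>s. (pot s - lag d s) /\<^sub>R d) \<le> L1_norm g + 1"
      using L1_norm_le_add_diff[OF qm gs] b(2)[OF d0 d(2)]
      by (meson add_left_mono less_imp_le order_trans)
    have "L1_norm (\<lambda>s. pot s - lag d s) = L1_norm (\<lambda>s. d *\<^sub>R ((pot s - lag d s) /\<^sub>R d))"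
      using d0 by simp
    also have "\<dots> = ennreal d * L1_norm (\<lambda>s. (pot s - lag d s) /\<^sub>R d)"
      using d0 by (subst L1_norm_scaleR[OF qm]) simp
    also have "\<dots> \<le> ennreal d * (L1_norm g + 1)" by (intro mult_left_mono L) simp
    finally have fv: "L1_norm (\<lambda>s. pot s - lag d s) \<le> ennreal d * (L1_norm g + 1)" .
    have "(\<integral>\<^sup>+d. B_lag_norm d \<partial>lebesgue_on {0..d}) + L1_norm (lag d) \<le> ennreal d * (L1_norm g + 1) + L1_norm (lag d)"
    proof -
      have "L1_norm pot \<le> L1_norm (lag d) + ennreal d * (L1_norm g + 1)"
        by (rule order_trans[OF L1_norm_le_add_diff[OF pot_strongly_measurable vm] add_left_mono[OF fv]])
      with B_lag_norm_integral[OF less_imp_le[OF d0]] show ?thesis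
        unfolding add.commute[of "ennreal d * _"] by (rule order_trans)
    qed
    moreover have "L1_norm (lag d) < \<infinity>"
      using E.L1_norm_evolution_semigroup_le[OF pot_strongly_measurable, of d] d0 pot_L1 K_ge_1
      by (auto simp: L1_def ennreal_mult_less_top intro: le_less_trans)
    ultimately have int: "(\<integral>\<^sup>+d. B_lag_norm d \<partial>lebesgue_on {0..d}) \<le> ennreal d * (L1_norm g + 1)"
      by (auto simp: ennreal_add_left_cancel_le add.commute)
    have "AE e in lebesgue. e \<noteq> (0::real)" by (rule AE_completion) (rule AE_lborel_singleton)
    then have "AE e in lebesgue. e \<in> {0..d} \<longrightarrow> B_lag_norm d \<le> B_lag_norm e"
      using AE_admissible
    proof eventually_elim
      case (elim e)
      show ?case
      proof
        assume e: "e \<in> {0..d}"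
        then have ge: "admissible e" using elim by simp
        have "L1_norm (\<lambda>x. B x (lag d x)) \<le> L1_norm (\<lambda>x. B x (lag e x))"
          unfolding L1_norm_def
        proof (rule nn_integral_mono_AE)
          have "e \<le> d" using e by simp
          from B_lag_mono[OF d(1) ge this]
          show "AE x in halfline. ennreal (norm (B x (lag d x))) \<le> ennreal (norm (B x (lag e x)))"
            by eventually_elim (simp add: norm_mono ennreal_leI)
        qed
        then show "B_lag_norm d \<le> B_lag_norm e" by (simp add: L1_norm_B_lag d(1) ge)
      qed
    qed
    then have "AE e in lebesgue_on {0..d}. B_lag_norm d \<le> B_lag_norm e" by (simp add: AE_restrict_space_iff)
    then have "(\<integral>\<^sup>+e. B_lag_norm d \<partial>lebesgue_on {0..d}) \<le> (\<integral>\<^sup>+e. B_lag_norm e \<partial>lebesgue_on {0..d})"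
      by (rule nn_integral_mono_AE)
    then have "B_lag_norm d * ennreal d \<le> ennreal d * (L1_norm g + 1)"
      using int d0 by (simp add: emeasure_restrict_space)
    then show ?thesis
      using d0 unfolding mult.commute[of "B_lag_norm d"] by (subst (asm) ennreal_mult_le_mult_iff) auto
  qed
  then show ?thesis using b(1) by blast
qed

lemma admissible_sequence:
  assumes "0 < h"
  shows "\<exists>d. (\<forall>n::nat. admissible (d n) \<and> d n < h) \<and> decseq d \<and> d \<longlonglongrightarrow> 0"
proof -
  have "\<exists>x. h / real (Suc (Suc n)) < x \<and> x < h / real (Suc n) \<and> (0 < x \<longrightarrow> admissible x)" for n
    using assms by (intro AE_interval_exists[OF AE_admissible] divide_strict_left_mono) auto
  then obtain d where d: "\<And>n. h / real (Suc (Suc n)) < d n" "\<And>n. d n < h / real (Suc n)"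
    "\<And>n. 0 < d n \<longrightarrow> admissible (d n)" by metis
  have pos: "0 < d n" for n
    using d(1)[of n] assms by (meson divide_pos_pos less_trans of_nat_0_less_iff zero_less_Suc)
  have "d n < h" for n
  proof -
    have "h / real (Suc n) \<le> h / 1" using assms by (intro divide_left_mono) auto
    then show ?thesis using d(2)[of n] by simp
  qed
  moreover have "decseq d"
    using d(1,2) by (intro decseq_SucI) (meson less_imp_le less_trans)
  moreover have "d \<longlonglongrightarrow> 0"
  proof (rule tendsto_sandwich[OF _ _ tendsto_const LIMSEQ_Suc[OF lim_const_over_n[of h]]])
    show "\<forall>\<^sub>F n in sequentially. d n \<le> h / real (Suc n)" by (intro always_eventually allI less_imp_le d(2))
  qed (intro always_eventually allI less_imp_le pos)
  ultimately show ?thesis using d(3) pos by blast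
qed

text \<open>
  Along a decreasing sequence of admissible delays the functions \<open>B x (lag d x)\<close> increase, with bounded
  \<open>L\<^sup>1\<close> norms. By monotone convergence the supremum of their norms is finite almost everywhere, which is
  the boundedness that increasing closedness asks for.
\<close>

lemma B_lag_limit:
  "\<exists>d. (\<forall>n::nat. admissible (d n) \<and> B_lag_norm (d n) \<le> L1_norm g + 1) \<and> decseq d \<and> d \<longlonglongrightarrow> 0 \<and>
     (AE x in halfline. pot x \<in> D x \<and> (\<lambda>n. B x (lag (d n) x)) \<longlonglongrightarrow> B x (pot x))"
proof -
  obtain h where h: "0 < h" "\<And>d. admissible d \<Longrightarrow> d < h \<Longrightarrow> B_lag_norm d \<le> L1_norm g + 1"
    using B_lag_norm_bounded by blast
  obtain d where d: "\<And>n::nat. admissible (d n)" "\<And>n. d n < h" "decseq d" "d \<longlonglongrightarrow> 0"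
    using admissible_sequence[OF h(1)] by blast
  have pos: "0 < d n" for n using d(1)[of n] by (simp add: admissible_def)
  have psi_le: "B_lag_norm (d n) \<le> L1_norm g + 1" for n by (rule h(2)[OF d(1,2)])
  let ?b = "\<lambda>n x. ennreal (norm (B x (lag (d n) x)))"
  have bm: "?b n \<in> borel_measurable halfline" for n
    using d(1)[of n] by (intro borel_measurable_norm_halfline) (simp add: admissible_def)
  have mono: "AE x in halfline. 0 \<le> B x (lag (d n) x) \<and> B x (lag (d n) x) \<le> B x (lag (d (Suc n)) x)" for n
    by (rule B_lag_mono[OF d(1) d(1) decseq_SucD[OF d(3)]])
  have "(\<integral>\<^sup>+x. (SUP n. ?b n x) \<partial>halfline) = (SUP n. \<integral>\<^sup>+x. ?b n x \<partial>halfline)"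
  proof (rule nn_integral_monotone_convergence_SUP_AE[OF _ bm])
    show "AE x in halfline. ?b n x \<le> ?b (Suc n) x" for n
      using mono[of n] by eventually_elim (simp add: norm_mono ennreal_leI)
  qed
  also have "\<dots> \<le> L1_norm g + 1"
  proof (rule SUP_least)
    show "(\<integral>\<^sup>+x. ?b n x \<partial>halfline) \<le> L1_norm g + 1" for n
      using L1_norm_B_lag[OF d(1)[of n]] psi_le[of n] by (simp add: L1_norm_def)
  qed
  also have "\<dots> < \<infinity>" using g by (simp add: L1_def)
  finally have fin: "AE x in halfline. (SUP n. ?b n x) \<noteq> \<infinity>"
    using bm by (intro nn_integral_PInf_AE borel_measurable_SUP) auto
  have inD: "AE x in halfline. \<forall>n. lag (d n) x \<in> D x"
    unfolding AE_all_countable using d(1) by (simp add: admissible_def)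
  have "AE x in lebesgue. x \<noteq> (0::real)" by (rule AE_completion) (rule AE_lborel_singleton)
  then have "AE x in halfline. x \<noteq> 0" unfolding AE_halfline_iff by eventually_elim simp
  then have "AE x in halfline. pot x \<in> D x \<and> (\<lambda>n. B x (lag (d n) x)) \<longlonglongrightarrow> B x (pot x)"
    using fin inD AE_space
  proof eventually_elim
    case (elim x)
    then have x: "0 < x" by simp
    have "bdd_above (range (\<lambda>n. norm (B x (lag (d n) x))))"
    proof -
      obtain c where c: "(SUP n. ?b n x) = ennreal c" "0 \<le> c"
        using elim(2) by (cases "SUP n. ?b n x") auto
      have "norm (B x (lag (d n) x)) \<le> c" for n
      proof -
        have "?b n x \<le> (SUP n. ?b n x)" by (rule SUP_upper) simp
        then show ?thesis using c by simp
      qed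
      then show ?thesis by (rule bdd_aboveI2)
    qed
    moreover have "incseq (\<lambda>n. lag (d n) x)"
      using d(3) pos by (intro incseq_SucI lag_antimono) (auto intro: less_imp_le decseq_SucD)
    moreover have "(\<lambda>n. lag (d n) x) \<longlonglongrightarrow> pot x" by (rule lag_tendsto_pot[OF x d(4) pos d(3)])
    moreover have "\<forall>n. lag (d n) x \<in> D x \<and> 0 \<le> lag (d n) x"
      using elim(3) pos by (auto intro: lag_nonneg less_imp_le)
    ultimately show ?case
      using B_increasingly_closed[OF less_imp_le[OF x]] pot_nonneg[of x]
      unfolding increasingly_closed_def by (elim allE[of _ "\<lambda>n. lag (d n) x"] allE[of _ "pot x"]) simp
  qed
  then show ?thesis using d psi_le by (intro exI[of _ d]) simp
qed

lemma pot_in_D: "AE x in halfline. pot x \<in> D x"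
proof -
  obtain d where "AE x in halfline. pot x \<in> D x \<and> (\<lambda>n::nat. B x (lag (d n) x)) \<longlonglongrightarrow> B x (pot x)"
    using B_lag_limit by blast
  then show ?thesis by eventually_elim simp
qed

lemma B_pot_L1: "(\<lambda>x. B x (pot x)) \<in> L1"
proof -
  interpret H: complete_measure halfline by (rule complete_halfline)
  obtain d where d: "\<And>n::nat. admissible (d n)" "\<And>n. B_lag_norm (d n) \<le> L1_norm g + 1"
    and lim: "AE x in halfline. pot x \<in> D x \<and> (\<lambda>n::nat. B x (lag (d n) x)) \<longlonglongrightarrow> B x (pot x)"
    using B_lag_limit by blast
  have sm: "strongly_measurable halfline (\<lambda>x. B x (lag (d n) x))" for n
    using d(1)[of n] by (simp add: admissible_def)
  have lim': "AE x in halfline. (\<lambda>n::nat. B x (lag (d n) x)) \<longlonglongrightarrow> B x (pot x)"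
    using lim by eventually_elim simp
  have "L1_norm (\<lambda>x. B x (pot x)) = (\<integral>\<^sup>+x. liminf (\<lambda>n. ennreal (norm (B x (lag (d n) x)))) \<partial>halfline)"
    unfolding L1_norm_def
  proof (rule nn_integral_cong_AE, use lim' in eventually_elim)
    case (elim x)
    then have "(\<lambda>n. ennreal (norm (B x (lag (d n) x)))) \<longlonglongrightarrow> ennreal (norm (B x (pot x)))"
      by (intro tendsto_ennrealI tendsto_norm)
    then show ?case by (intro lim_imp_Liminf[symmetric]) auto
  qed
  also have "\<dots> \<le> liminf (\<lambda>n. nint halfline (\<lambda>x. B x (lag (d n) x)))"
    by (intro nn_integral_liminf borel_measurable_norm_halfline sm)
  also have "\<dots> \<le> liminf (\<lambda>n::nat. L1_norm g + 1)"
  proof (intro Liminf_mono always_eventually allI)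
    show "(nint halfline (\<lambda>x. B x (lag (d n) x))) \<le> L1_norm g + 1" for n
      using L1_norm_B_lag[OF d(1)[of n]] d(2)[of n] by (simp add: L1_norm_def)
  qed
  also have "\<dots> = L1_norm g + 1" by (simp add: Liminf_const)
  also have "\<dots> < \<infinity>" using g by (simp add: L1_def)
  finally show ?thesis using H.strongly_measurable_LIMSEQ[OF sm lim'] by (simp add: L1_def)
qed

lemma B_lag_le_B_pot:
  assumes "admissible d"
  shows "AE x in halfline. 0 \<le> B x (lag d x) \<and> B x (lag d x) \<le> B x (pot x)"
proof -
  have "AE x in halfline. lag d x \<in> D x" using assms by (simp add: admissible_def)
  then show ?thesis
    using pot_in_D AE_space
    by eventually_elim (use assms in \<open>auto simp: admissible_def intro!: B_positive B_mono lag_nonneg lag_le_pot\<close>)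
qed

text \<open>
  Dominated convergence gives the limit along one sequence of delays; by monotonicity one member
  of the sequence controls all smaller admissible delays.
\<close>

lemma B_lag_tendsto_B_pot:
  assumes e: "0 < (e::real)"
  shows "\<exists>h>0. \<forall>d. admissible d \<and> d < h \<longrightarrow> L1_norm (\<lambda>x. B x (lag d x) - B x (pot x)) \<le> ennreal e"
proof -
  obtain d where d: "\<And>n::nat. admissible (d n)"
    and lim: "AE x in halfline. pot x \<in> D x \<and> (\<lambda>n::nat. B x (lag (d n) x)) \<longlonglongrightarrow> B x (pot x)"
    using B_lag_limit by blast
  have sm: "strongly_measurable halfline (\<lambda>x. B x (lag (d n) x) - B x (pot x))" for n
    using d(1)[of n] B_pot_L1 by (intro strongly_measurable_diff) (simp_all add: admissible_def L1_def)
  have "(\<lambda>n. nint halfline (\<lambda>x. B x (lag (d n) x) - B x (pot x))) \<longlonglongrightarrow> (\<integral>\<^sup>+x. 0 \<partial>halfline)"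
  proof (rule nn_integral_dominated_convergence[where w = "\<lambda>x. ennreal (norm (B x (pot x)))"])
    show "(\<lambda>x. ennreal (norm (B x (lag (d n) x) - B x (pot x)))) \<in> borel_measurable halfline" for n
      by (rule borel_measurable_norm_halfline[OF sm])
    show "(\<lambda>x. ennreal (norm (B x (pot x)))) \<in> borel_measurable halfline"
      using B_pot_L1 by (intro borel_measurable_norm_halfline) (simp add: L1_def)
    show "(nint halfline (\<lambda>x. B x (pot x))) < \<infinity>"
      using B_pot_L1 by (simp add: L1_def L1_norm_def)
    show "AE x in halfline. ennreal (norm (B x (lag (d n) x) - B x (pot x))) \<le> ennreal (norm (B x (pot x)))" for n
      using B_lag_le_B_pot[OF d(1)[of n]]
    proof eventually_elim
      case (elim x)
      then show ?case
        using norm_diff_positive[of "B x (lag (d n) x)" "B x (pot x)"]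
        by (simp add: norm_minus_commute ennreal_leI)
    qed
    show "AE x in halfline. (\<lambda>n. ennreal (norm (B x (lag (d n) x) - B x (pot x)))) \<longlonglongrightarrow> 0"
      using lim
    proof eventually_elim
      case (elim x)
      then have "(\<lambda>n. ennreal (norm (B x (lag (d n) x) - B x (pot x)))) \<longlonglongrightarrow> ennreal (norm (B x (pot x) - B x (pot x)))"
        by (intro tendsto_intros) simp
      then show ?case by simp
    qed
  qed simp
  then have "(\<lambda>n. L1_norm (\<lambda>x. B x (lag (d n) x) - B x (pot x))) \<longlonglongrightarrow> 0" by (simp add: L1_norm_def)
  then have "\<forall>\<^sub>F n in sequentially. L1_norm (\<lambda>x. B x (lag (d n) x) - B x (pot x)) < ennreal e"
    using e by (intro order_tendstoD) auto
  then obtain n where n: "L1_norm (\<lambda>x. B x (lag (d n) x) - B x (pot x)) < ennreal e"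
    by (auto simp: eventually_sequentially)
  show ?thesis
  proof (intro exI[of _ "d n"] conjI allI impI)
    show "0 < d n" using d[of n] by (simp add: admissible_def)
    fix c assume c: "admissible c \<and> c < d n"
    have "L1_norm (\<lambda>x. B x (lag c x) - B x (pot x)) \<le> L1_norm (\<lambda>x. B x (lag (d n) x) - B x (pot x))"
      unfolding L1_norm_def
    proof (rule nn_integral_mono_AE)
      have "AE x in halfline. 0 \<le> B x (lag (d n) x) \<and> B x (lag (d n) x) \<le> B x (lag c x)"
        using c by (intro B_lag_mono d) auto
      then show "AE x in halfline. ennreal (norm (B x (lag c x) - B x (pot x))) \<le> ennreal (norm (B x (lag (d n) x) - B x (pot x)))"
        using B_lag_le_B_pot[OF conjunct1[OF c]]
      proof eventually_elim
        case (elim x)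
        have "norm (B x (pot x) - B x (lag c x)) \<le> norm (B x (pot x) - B x (lag (d n) x))"
          using elim by (intro norm_mono) auto
        then show ?case by (simp add: norm_minus_commute ennreal_leI)
      qed
    qed
    then show "L1_norm (\<lambda>x. B x (lag c x) - B x (pot x)) \<le> ennreal e" using n by simp
  qed
qed

text \<open>
  The preceding limit with the damping taken off: it amounts to a factor \<open>exp d\<close>, which tends to 1.
\<close>

lemma BU_tendsto_B_pot:
  assumes e: "0 < (e::real)"
  shows "\<exists>h>0. AE d in lebesgue. 0 < d \<and> d < h \<longrightarrow>
    (nint halfline (\<lambda>s. B (s + d) (U (s + d) s (pot s)) - B (s + d) (pot (s + d)))) \<le> ennreal e"
proof -
  let ?\<beta> = "\<lambda>x. B x (pot x)"
  have \<beta>m: "strongly_measurable halfline ?\<beta>" using B_pot_L1 by (simp add: L1_def)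
  obtain b where b: "L1_norm ?\<beta> = ennreal b" "0 \<le> b"
    using B_pot_L1 by (cases "L1_norm ?\<beta>") (auto simp: L1_def)
  obtain h1 where h1: "0 < h1" "\<And>d. admissible d \<Longrightarrow> d < h1 \<Longrightarrow> L1_norm (\<lambda>x. B x (lag d x) - ?\<beta> x) \<le> ennreal (e / 4)"
    using B_lag_tendsto_B_pot[of "e / 4"] e by auto
  have "((\<lambda>d. (exp d - 1) * b) \<longlongrightarrow> (exp 0 - 1) * b) (at_right (0::real))" by (intro tendsto_intros)
  then have "\<forall>\<^sub>F d in at_right 0. (exp d - 1) * b < e / 2" using e by (intro order_tendstoD) auto
  moreover have "((\<lambda>d. exp d) \<longlongrightarrow> exp 0) (at_right (0::real))" by (intro tendsto_intros)
  then have "\<forall>\<^sub>F d in at_right (0::real). exp d < 2" by (intro order_tendstoD) auto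
  ultimately have "\<forall>\<^sub>F d in at_right 0. (exp d - 1) * b < e / 2 \<and> exp d < 2" by (rule eventually_conj)
  then obtain h2 where h2: "0 < h2" "\<And>d. 0 < d \<Longrightarrow> d < h2 \<Longrightarrow> (exp d - 1) * b < e / 2 \<and> exp d < 2"
    by (auto simp: eventually_at_right_field)
  show ?thesis
  proof (intro exI[of _ "min h1 h2"] conjI)
    show "0 < min h1 h2" using h1 h2 by simp
    show "AE d in lebesgue. 0 < d \<and> d < min h1 h2 \<longrightarrow>
      (nint halfline (\<lambda>s. B (s + d) (U (s + d) s (pot s)) - ?\<beta> (s + d))) \<le> ennreal e"
      using AE_admissible AE_Delta_diagonal[OF BEf_defined[OF pot_L1]]
    proof eventually_elim
      case (elim d)
      show ?case
      proof
        assume "0 < d \<and> d < min h1 h2"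
        then have d: "0 < d" "d < h1" "d < h2" and gd: "admissible d" using elim by auto
        have inD: "AE s in halfline. U (s + d) s (pot s) \<in> D (s + d)" using elim d by simp
        have e1: "0 \<le> exp d - 1" using d by simp
        let ?k = "\<lambda>x. ennreal (exp d) * ennreal (norm (B x (lag d x) - ?\<beta> x)) + ennreal (exp d - 1) * ennreal (norm (?\<beta> x))"
        have dm: "strongly_measurable halfline (\<lambda>x. B x (lag d x) - ?\<beta> x)"
          using gd by (intro strongly_measurable_diff \<beta>m) (simp add: admissible_def)
        have m1: "(\<lambda>x. ennreal (exp d) * ennreal (norm (B x (lag d x) - ?\<beta> x))) \<in> borel_measurable halfline"
          and m2: "(\<lambda>x. ennreal (exp d - 1) * ennreal (norm (?\<beta> x))) \<in> borel_measurable halfline"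
          by (intro borel_measurable_times_ennreal borel_measurable_const borel_measurable_norm_halfline dm \<beta>m)+
        have "(nint halfline (\<lambda>s. B (s + d) (U (s + d) s (pot s)) - ?\<beta> (s + d)))
          \<le> (\<integral>\<^sup>+s. ?k (s + d) \<partial>halfline)"
        proof (rule nn_integral_mono_AE, use inD AE_space in eventually_elim)
          case (elim s)
          then have s: "0 \<le> s" by simp
          have "B (s + d) (lag d (s + d)) = exp (- d) *\<^sub>R B (s + d) (U (s + d) s (pot s))"
            using B_damped[OF _ elim(1)] s d by (simp add: evolution_semigroup_def)
          then have "B (s + d) (U (s + d) s (pot s)) = exp d *\<^sub>R B (s + d) (lag d (s + d))"
            by (simp flip: exp_add)
          then have "B (s + d) (U (s + d) s (pot s)) - ?\<beta> (s + d)
            = exp d *\<^sub>R (B (s + d) (lag d (s + d)) - ?\<beta> (s + d)) + (exp d - 1) *\<^sub>R ?\<beta> (s + d)"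
            by (simp add: algebra_simps)
          then show ?case
            using ennreal_norm_lincomb_le[OF exp_ge_zero e1] by (simp only:)
        qed
        also have "\<dots> \<le> (\<integral>\<^sup>+x. ?k x \<partial>halfline)"
          by (rule nn_integral_halfline_shift_le[OF borel_measurable_add[OF m1 m2] less_imp_le[OF d(1)]])
        also have "\<dots> = ennreal (exp d) * L1_norm (\<lambda>x. B x (lag d x) - ?\<beta> x) + ennreal (exp d - 1) * L1_norm ?\<beta>"
          unfolding L1_norm_def nn_integral_cmult[OF borel_measurable_norm_halfline[OF dm], symmetric]
            nn_integral_cmult[OF borel_measurable_norm_halfline[OF \<beta>m], symmetric]
          by (rule nn_integral_add[OF m1 m2])
        also have "\<dots> \<le> ennreal 2 * ennreal (e / 4) + ennreal ((exp d - 1) * b)"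
        proof (rule add_mono)
          show "ennreal (exp d) * L1_norm (\<lambda>x. B x (lag d x) - ?\<beta> x) \<le> ennreal 2 * ennreal (e / 4)"
            using h2(2)[OF d(1,3)] by (intro mult_mono h1(2)[OF gd d(2)] ennreal_leI) auto
          show "ennreal (exp d - 1) * L1_norm ?\<beta> \<le> ennreal ((exp d - 1) * b)"
            unfolding b(1) by (simp only: ennreal_mult[OF e1 b(2)] order_refl)
        qed
        also have "\<dots> \<le> ennreal 2 * ennreal (e / 4) + ennreal (e / 2)"
          using h2(2)[OF d(1,3)] by (intro add_left_mono ennreal_leI) simp
        also have "\<dots> = ennreal e"
          using e by (simp flip: ennreal_plus ennreal_mult del: ennreal_numeral)
        finally show "(nint halfline (\<lambda>s. B (s + d) (U (s + d) s (pot s)) - ?\<beta> (s + d))) \<le> ennreal e" .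
      qed
    qed
  qed
qed

end

section \<open>Dyson terms\<close>

lemma AE_row:
  assumes "AE r in lebesgue_on {s..}. P r"
  shows "AE r in lebesgue_on {s..t}. P (r::real)"
proof -
  have "AE r in lebesgue. r \<in> {s..} \<longrightarrow> P r" using assms by (simp add: AE_restrict_space_iff)
  then have "AE r in lebesgue. r \<in> {s..t} \<longrightarrow> P r" by eventually_elim simp
  then show ?thesis by (simp add: AE_restrict_space_iff)
qed

lemma U_lincomb: "0 \<le> s \<Longrightarrow> s \<le> t \<Longrightarrow> U t s (a *\<^sub>R v + b *\<^sub>R w) = a *\<^sub>R U t s v + b *\<^sub>R U t s w"
  using bounded_linear.linear[OF linear] by (simp add: linear_add linear_scale)

lemma BU_lincomb_AE:
  assumes s: "0 \<le> s"
  shows "AE r in lebesgue_on {s..t}. a *\<^sub>R B r (U r s v) + b *\<^sub>R B r (U r s w) = B r (U r s (a *\<^sub>R v + b *\<^sub>R w))"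
  using AE_row[OF BU_defined[OF s, of v], of t] AE_row[OF BU_defined[OF s, of w], of t] AE_space
proof eventually_elim
  case (elim r)
  then have r: "0 \<le> r" "s \<le> r" using s by auto
  show ?case
    using B_linear[OF r(1)] elim(1,2) s r
    by (simp add: U_lincomb linear_on_domain_def subspace_scale)
qed

lemma BU_nonneg_AE:
  assumes s: "0 \<le> s" and u: "0 \<le> u"
  shows "AE r in lebesgue_on {s..t}. 0 \<le> B r (U r s u)"
  using AE_row[OF BU_defined[OF s, of u], of t] AE_space
  by eventually_elim (use s u in \<open>auto intro!: B_positive U_positive\<close>)

lemma BU_integral_le:
  assumes "0 \<le> s" "s \<le> t" "0 \<le> u"
  shows "(nint (lebesgue_on {s..t}) (\<lambda>r. B r (U r s u))) + ennreal (norm (U t s u)) \<le> ennreal (norm u)"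
proof -
  have "(nint (lebesgue_on {s..t}) (\<lambda>r. B r (U r s u))) + ennreal (norm (U t s u))
    \<le> ennreal (norm u - norm (U t s u)) + ennreal (norm (U t s u))"
    by (intro add_right_mono BU_integral assms)
  also have "\<dots> = ennreal (norm u)"
    using U_contractive[OF assms] by (subst ennreal_plus[symmetric]) auto
  finally show ?thesis .
qed

lemma BU_integrable:
  assumes s: "0 \<le> s"
  shows "strongly_integrable (lebesgue_on {s..t}) (\<lambda>r. B r (U r s u))"
proof -
  interpret R: complete_measure "lebesgue_on {s..t}" by (rule complete_lebesgue_on) simp
  have pos: "strongly_integrable (lebesgue_on {s..t}) (\<lambda>r. B r (U r s v))" if v: "0 \<le> v" for v
  proof -
    have "(nint (lebesgue_on {s..t}) (\<lambda>r. B r (U r s v))) < \<infinity>"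
    proof (cases "s \<le> t")
      case True
      have "(nint (lebesgue_on {s..t}) (\<lambda>r. B r (U r s v))) \<le> ennreal (norm v - norm (U t s v))"
        by (rule BU_integral[OF s True v])
      also have "\<dots> < \<infinity>" by simp
      finally show ?thesis .
    next
      case False
      then show ?thesis by (simp add: nn_integral_restrict_space)
    qed
    moreover have "strongly_measurable (lebesgue_on {s..t}) (\<lambda>r. B r (U r s v))"
      by (rule strongly_measurable_lebesgue_on_subset[OF BU_measurable[OF s]]) auto
    ultimately show ?thesis by (simp add: strongly_integrable_def)
  qed
  obtain v w where vw: "0 \<le> v" "0 \<le> w" "u = v - w" using decomposition by blast
  have "AE r in lebesgue_on {s..t}. 1 *\<^sub>R B r (U r s v) + (-1) *\<^sub>R B r (U r s w) = B r (U r s u)"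
    using BU_lincomb_AE[OF s, where t = t and a = 1 and v = v and b = "-1" and w = w] vw(3) by simp
  then show ?thesis
    by (rule R.strongly_integrable_cong_AE[OF R.strongly_integrable_lincomb[OF pos[OF vw(1)] pos[OF vw(2)]]])
qed

text \<open>
  The properties of \<open>U\<close> that pass from one Dyson term to the next. They are what is needed for the
  integral that defines the next term to exist and to be linear and contractive again. The propagator law
  is not among them: it fails for the individual terms.
\<close>

definition regular :: "(real \<Rightarrow> real \<Rightarrow> 'a \<Rightarrow> 'a) \<Rightarrow> bool" where
  "regular W \<longleftrightarrow> (\<forall>s t. 0 \<le> s \<and> s \<le> t \<longrightarrow> linear (W t s)) \<and>
     (\<forall>s t u. 0 \<le> s \<and> s \<le> t \<and> 0 \<le> u \<longrightarrow> norm (W t s u) \<le> norm u) \<and>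
     (\<forall>t u. continuous_on {0..t} (\<lambda>s. W t s u))"

lemma regularD:
  assumes "regular W"
  shows "0 \<le> s \<Longrightarrow> s \<le> t \<Longrightarrow> linear (W t s)"
    and "0 \<le> s \<Longrightarrow> s \<le> t \<Longrightarrow> 0 \<le> u \<Longrightarrow> norm (W t s u) \<le> norm u"
    and "continuous_on {0..t} (\<lambda>s. W t s u)"
    and "0 \<le> s \<Longrightarrow> s \<le> t \<Longrightarrow> norm (W t s u) \<le> 2 * K * norm u"
    and "0 \<le> s \<Longrightarrow> s \<le> t \<Longrightarrow> bounded_linear (W t s)"
proof -
  show lin: "linear (W t s)" if "0 \<le> s" "s \<le> t" for s t using assms that by (simp add: regular_def)
  show le: "norm (W t s u) \<le> norm u" if "0 \<le> s" "s \<le> t" "0 \<le> u" for s t u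
    using assms that by (simp add: regular_def)
  show "continuous_on {0..t} (\<lambda>s. W t s u)" using assms by (simp add: regular_def)
  show le': "norm (W t s u) \<le> 2 * K * norm u" if "0 \<le> s" "s \<le> t" for s t u
    by (rule linear_contractive_norm_le[OF lin[OF that] le[OF that]])
  show "bounded_linear (W t s)" if "0 \<le> s" "s \<le> t"
  proof (rule bounded_linear_intro[of _ "2 * K"])
    show "norm (W t s x) \<le> norm x * (2 * K)" for x
      using le'[OF that, of x] unfolding mult.commute[of "norm x"] .
  qed (simp_all add: linear_add[OF lin[OF that]] linear_scale[OF lin[OF that]])
qed

lemma regular_U: "regular U"
  unfolding regular_def
  using U_contractive continuous_start bounded_linear.linear[OF linear] by simp

definition Duhamel :: "(real \<Rightarrow> real \<Rightarrow> 'a \<Rightarrow> 'a) \<Rightarrow> real \<Rightarrow> real \<Rightarrow> 'a \<Rightarrow> 'a" where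
  "Duhamel W t s u = strong_integral (lebesgue_on {s..t}) (\<lambda>r. W t r (B r (U r s u)))"

context
  fixes W :: "real \<Rightarrow> real \<Rightarrow> 'a \<Rightarrow> 'a"
  assumes W: "regular W"
begin

lemma Duhamel_integrable:
  assumes s: "0 \<le> s" and S: "S \<in> sets lebesgue" "S \<subseteq> {s..t}"
  shows "strongly_integrable (lebesgue_on S) (\<lambda>r. W t r (B r (U r s u)))"
proof -
  have int: "strongly_integrable (lebesgue_on S) (\<lambda>r. B r (U r s u))"
    by (rule strongly_integrable_lebesgue_on_subset[OF BU_integrable[OF s, of t u]]) (use S in auto)
  then have m: "strongly_measurable (lebesgue_on S) (\<lambda>r. B r (U r s u))" by (simp add: strongly_integrable_def)
  have "strongly_measurable (lebesgue_on S) (\<lambda>r. W t r (B r (U r s u)))"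
  proof (rule strongly_measurable_operator[OF S(1) _ _ m])
    show "bounded_linear (W t r)" if "r \<in> S" for r using that S s by (intro regularD[OF W]) auto
    have "S \<subseteq> {0..t}" using S s by auto
    then show "continuous_on S (\<lambda>r. W t r c)" for c by (rule continuous_on_subset[OF regularD(3)[OF W]])
  qed
  moreover have "(nint (lebesgue_on S) (\<lambda>r. W t r (B r (U r s u)))) < \<infinity>"
  proof -
    have nm: "(\<lambda>r. ennreal (norm (B r (U r s u)))) \<in> borel_measurable (lebesgue_on S)"
      using complete_measure.strongly_measurable_norm[OF complete_lebesgue_on[OF S(1)] m] by simp
    have "(nint (lebesgue_on S) (\<lambda>r. W t r (B r (U r s u))))
      \<le> (\<integral>\<^sup>+r. ennreal (2 * K) * ennreal (norm (B r (U r s u))) \<partial>lebesgue_on S)"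
    proof (rule nn_integral_mono)
      fix r assume "r \<in> space (lebesgue_on S)"
      then have "norm (W t r (B r (U r s u))) \<le> 2 * K * norm (B r (U r s u))"
        using S s by (intro regularD(4)[OF W]) auto
      then show "ennreal (norm (W t r (B r (U r s u)))) \<le> ennreal (2 * K) * ennreal (norm (B r (U r s u)))"
        using K_ge_1 by (subst ennreal_mult[symmetric]) (auto intro: ennreal_leI)
    qed
    also have "\<dots> = ennreal (2 * K) * (nint (lebesgue_on S) (\<lambda>r. B r (U r s u)))"
      by (rule nn_integral_cmult[OF nm])
    also have "\<dots> < \<infinity>" using int by (simp add: strongly_integrable_def ennreal_mult_less_top)
    finally show ?thesis .
  qed
  ultimately show ?thesis by (simp add: strongly_integrable_def)
qed

lemma Duhamel_lincomb:
  assumes s: "0 \<le> s"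
  shows "Duhamel W t s (a *\<^sub>R v + b *\<^sub>R w) = a *\<^sub>R Duhamel W t s v + b *\<^sub>R Duhamel W t s w"
proof -
  interpret R: complete_measure "lebesgue_on {s..t}" by (rule complete_lebesgue_on) simp
  have "AE r in lebesgue_on {s..t}. W t r (B r (U r s (a *\<^sub>R v + b *\<^sub>R w)))
      = a *\<^sub>R W t r (B r (U r s v)) + b *\<^sub>R W t r (B r (U r s w))"
    using BU_lincomb_AE[OF s, where t = t and a = a and v = v and b = b and w = w] AE_space
  proof eventually_elim
    case (elim r)
    then have "linear (W t r)" using s by (intro regularD[OF W]) auto
    then show ?case unfolding elim(1)[symmetric] by (simp add: linear_add linear_scale)
  qed
  from R.strong_integral_cong_AE[OF this] show ?thesis
    unfolding Duhamel_def using s by (simp add: R.strong_integral_lincomb Duhamel_integrable)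
qed

lemma Duhamel_diff: "0 \<le> s \<Longrightarrow> Duhamel W t s (v - w) = Duhamel W t s v - Duhamel W t s w"
  using Duhamel_lincomb[where s = s and t = t and a = 1 and v = v and b = "-1" and w = w] by simp

lemma Duhamel_norm_nn_integral_le:
  assumes s: "0 \<le> s" and u: "0 \<le> u" and q: "q \<le> t"
  shows "(nint (lebesgue_on {s..q}) (\<lambda>r. W t r (B r (U r s u))))
    \<le> (nint (lebesgue_on {s..q}) (\<lambda>r. B r (U r s u)))"
proof (rule nn_integral_mono_AE, use BU_nonneg_AE[OF s u, of q] AE_space in eventually_elim)
  case (elim r)
  then show ?case using s q by (intro ennreal_leI regularD(2)[OF W]) auto
qed

lemma Duhamel_norm_le:
  assumes s: "0 \<le> s" "s \<le> t" and u: "0 \<le> u"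
  shows "norm (Duhamel W t s u) \<le> norm u"
proof -
  interpret R: complete_measure "lebesgue_on {s..t}" by (rule complete_lebesgue_on) simp
  have "ennreal (norm (Duhamel W t s u)) \<le> (nint (lebesgue_on {s..t}) (\<lambda>r. W t r (B r (U r s u))))"
    unfolding Duhamel_def using s by (intro R.norm_strong_integral_le Duhamel_integrable) auto
  also have "\<dots> \<le> (nint (lebesgue_on {s..t}) (\<lambda>r. B r (U r s u)))"
    by (rule Duhamel_norm_nn_integral_le[OF s(1) u order_refl])
  also have "\<dots> \<le> ennreal (norm u - norm (U t s u))" by (rule BU_integral[OF s u])
  also have "\<dots> \<le> ennreal (norm u)" by (intro ennreal_leI) simp
  finally show ?thesis by simp
qed

lemma Duhamel_linear:
  assumes "0 \<le> s"
  shows "linear (Duhamel W t s)"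
proof (rule linearI)
  show "Duhamel W t s (v + w) = Duhamel W t s v + Duhamel W t s w" for v w
    using Duhamel_lincomb[OF assms, where t = t and a = 1 and v = v and b = 1 and w = w] by simp
  show "Duhamel W t s (c *\<^sub>R v) = c *\<^sub>R Duhamel W t s v" for c v
    using Duhamel_lincomb[OF assms, where t = t and a = c and v = v and b = 0 and w = v] by simp
qed

text \<open>
  By the propagator law for \<open>U\<close>, moving the lower limit from \<open>q\<close> to \<open>s\<close> changes the integral by a piece over
  \<open>[q,s]\<close>, of norm at most \<open>norm u - norm (U s q u)\<close>, and replaces \<open>u\<close> by \<open>U s q u\<close>. Both changes are
  controlled by \<open>U s q u - u\<close>, and so continuity in the starting time is inherited from \<open>U\<close> alone.
\<close>

lemma Duhamel_increment:
  assumes q: "0 \<le> q" "q \<le> s" "s \<le> t" and u: "0 \<le> u"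
  shows "norm (Duhamel W t q u - Duhamel W t s u) \<le> (2 * K + 1) * norm (U s q u - u)"
proof -
  interpret R: complete_measure "lebesgue_on {s..t}" by (rule complete_lebesgue_on) simp
  interpret Q: complete_measure "lebesgue_on {q..s}" by (rule complete_lebesgue_on) simp
  have s: "0 \<le> s" using q by simp
  let ?r = "strong_integral (lebesgue_on {q..s}) (\<lambda>r. W t r (B r (U r q u)))"
  have "strong_integral (lebesgue_on {s..t}) (\<lambda>r. W t r (B r (U r q u))) = Duhamel W t s (U s q u)"
    unfolding Duhamel_def using q by (intro R.strong_integral_cong_AE AE_I2) (simp add: cocycle)
  then have "Duhamel W t q u = ?r + Duhamel W t s (U s q u)"
    unfolding Duhamel_def[of W t q] using q
    by (subst strong_integral_combine[of q s t]) (auto intro!: Duhamel_integrable)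
  then have eq: "Duhamel W t q u - Duhamel W t s u = ?r + Duhamel W t s (U s q u - u)"
    by (simp add: Duhamel_diff[OF s])
  have "ennreal (norm ?r) \<le> (nint (lebesgue_on {q..s}) (\<lambda>r. W t r (B r (U r q u))))"
    using q by (intro Q.norm_strong_integral_le Duhamel_integrable) auto
  also have "\<dots> \<le> (nint (lebesgue_on {q..s}) (\<lambda>r. B r (U r q u)))"
    by (rule Duhamel_norm_nn_integral_le[OF q(1) u q(3)])
  also have "\<dots> \<le> ennreal (norm u - norm (U s q u))" by (rule BU_integral[OF q(1,2) u])
  finally have "norm ?r \<le> norm u - norm (U s q u)"
    using U_contractive[OF q(1,2) u] by (simp add: ennreal_le_iff)
  also have "\<dots> \<le> norm (U s q u - u)"
    using norm_triangle_ineq2[of u "U s q u"] by (simp add: norm_minus_commute)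
  finally have r: "norm ?r \<le> norm (U s q u - u)" .
  have "norm (Duhamel W t s (U s q u - u)) \<le> 2 * K * norm (U s q u - u)"
    by (rule linear_contractive_norm_le[OF Duhamel_linear[OF s] Duhamel_norm_le[OF s q(3)]])
  then show ?thesis
    unfolding eq using r norm_triangle_ineq[of ?r "Duhamel W t s (U s q u - u)"] by (simp add: algebra_simps)
qed

text \<open>
  The increment estimate compares an earlier with a later time; \<open>min\<close> and \<open>max\<close> cover the two one-sided
  limits at once.
\<close>

lemma Duhamel_continuous: "continuous_on {0..t} (\<lambda>s. Duhamel W t s u)"
proof -
  have pos: "continuous_on {0..t} (\<lambda>s. Duhamel W t s v)" if v: "0 \<le> v" for v
    unfolding continuous_on_def
  proof
    fix s assume s: "s \<in> {0..t}"
    have "continuous_on {0..t} ((\<lambda>p. U (fst p) (snd p) v) \<circ> (\<lambda>q. (max s q, min s q)))"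
      using s by (intro continuous_on_compose continuous_intros continuous_on_subset[OF continuous_Delta])
        (auto simp: Delta_def)
    then have "((\<lambda>q. U (max s q) (min s q) v) \<longlongrightarrow> U s s v) (at s within {0..t})"
      using s unfolding continuous_on_def by (auto simp: o_def dest!: bspec[of _ _ s])
    then have "((\<lambda>q. (2 * K + 1) * norm (U (max s q) (min s q) v - v)) \<longlongrightarrow> (2 * K + 1) * norm (U s s v - v)) (at s within {0..t})"
      by (intro tendsto_intros)
    then have lim: "((\<lambda>q. (2 * K + 1) * norm (U (max s q) (min s q) v - v)) \<longlongrightarrow> 0) (at s within {0..t})"
      using s by (simp add: refl)
    have "((\<lambda>q. Duhamel W t q v - Duhamel W t s v) \<longlongrightarrow> 0) (at s within {0..t})"
    proof (rule Lim_null_comparison[OF _ lim])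
      have "norm (Duhamel W t q v - Duhamel W t s v) \<le> (2 * K + 1) * norm (U (max s q) (min s q) v - v)"
        if q: "q \<in> {0..t}" for q
      proof (cases "q \<le> s")
        case True
        then show ?thesis using Duhamel_increment[of q s t v] q s v by (simp add: max_absorb1 min_absorb2)
      next
        case False
        then show ?thesis using Duhamel_increment[of s q t v] q s v
          by (simp add: max_absorb2 min_absorb1 norm_minus_commute)
      qed
      then show "\<forall>\<^sub>F q in at s within {0..t}. norm (Duhamel W t q v - Duhamel W t s v)
          \<le> (2 * K + 1) * norm (U (max s q) (min s q) v - v)"
        by (auto simp: eventually_at_filter)
    qed
    then show "((\<lambda>q. Duhamel W t q v) \<longlongrightarrow> Duhamel W t s v) (at s within {0..t})"
      by (simp add: LIM_zero_iff)
  qed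
  obtain v w where vw: "0 \<le> v" "0 \<le> w" "u = v - w" using decomposition by blast
  have "continuous_on {0..t} (\<lambda>s. Duhamel W t s v - Duhamel W t s w)"
    by (intro continuous_on_diff pos vw)
  then show ?thesis
    unfolding vw(3) by (rule continuous_on_eq) (simp add: Duhamel_diff)
qed

lemma regular_Duhamel: "regular (Duhamel W)"
  unfolding regular_def using Duhamel_linear Duhamel_norm_le Duhamel_continuous by simp

end

abbreviation "V \<equiv> Dyson_term U B"

lemma V_Suc: "V (Suc n) = Duhamel (V n)"
  by (simp add: Duhamel_def fun_eq_iff)

lemma regular_V: "regular (V n)"
proof (induction n)
  case 0
  then show ?case using regular_U by simp
next
  case (Suc n)
  then show ?case unfolding V_Suc by (rule regular_Duhamel)
qed

text \<open>
  The bound for the first \<open>N\<close> terms, applied under the integral to the positive vector \<open>B r (U r s u)\<close>.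
\<close>

lemma V_sum_Suc_le:
  assumes sum: "\<And>s t u. 0 \<le> s \<Longrightarrow> s \<le> t \<Longrightarrow> 0 \<le> u \<Longrightarrow> (\<Sum>n<N. ennreal (norm (V n t s u))) \<le> ennreal (norm u)"
    and s: "0 \<le> s" "s \<le> t" and u: "0 \<le> u"
  shows "(\<Sum>n<N. ennreal (norm (V (Suc n) t s u))) \<le> (nint (lebesgue_on {s..t}) (\<lambda>r. B r (U r s u)))"
proof -
  interpret R: complete_measure "lebesgue_on {s..t}" by (rule complete_lebesgue_on) simp
  have int: "strongly_integrable (lebesgue_on {s..t}) (\<lambda>r. V n t r (B r (U r s u)))" for n
    using s by (intro Duhamel_integrable regular_V) auto
  then have m: "(\<lambda>r. ennreal (norm (V n t r (B r (U r s u))))) \<in> borel_measurable (lebesgue_on {s..t})" for n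
    using R.strongly_measurable_norm[of "\<lambda>r. V n t r (B r (U r s u))"] by (simp add: strongly_integrable_def)
  have "(\<Sum>n<N. ennreal (norm (V (Suc n) t s u)))
      \<le> (\<Sum>n<N. nint (lebesgue_on {s..t}) (\<lambda>r. V n t r (B r (U r s u))))"
    unfolding V_Suc Duhamel_def by (intro sum_mono R.norm_strong_integral_le int)
  also have "\<dots> = (\<integral>\<^sup>+r. (\<Sum>n<N. ennreal (norm (V n t r (B r (U r s u))))) \<partial>lebesgue_on {s..t})"
    by (rule nn_integral_sum[symmetric]) (rule m)
  also have "\<dots> \<le> (nint (lebesgue_on {s..t}) (\<lambda>r. B r (U r s u)))"
  proof (rule nn_integral_mono_AE, use BU_nonneg_AE[OF s(1) u, of t] AE_space in eventually_elim)
    case (elim r)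
    then show ?case using s by (intro sum) auto
  qed
  finally show ?thesis .
qed

text \<open>
  Induction on the number of terms: what the terms after the first can contribute is exactly what the
  integral bound on \<open>B r (U r s u)\<close> says has been lost by \<open>U t s u\<close>.
\<close>

lemma V_sum_le:
  assumes "0 \<le> s" "s \<le> t" "0 \<le> u"
  shows "(\<Sum>n<N. ennreal (norm (V n t s u))) \<le> ennreal (norm u)"
  using assms
proof (induction N arbitrary: s t u)
  case 0
  then show ?case by simp
next
  case (Suc N)
  have "(\<Sum>n<Suc N. ennreal (norm (V n t s u))) = ennreal (norm (U t s u)) + (\<Sum>n<N. ennreal (norm (V (Suc n) t s u)))"
    by (simp only: sum.lessThan_Suc_shift Dyson_term.simps(1))
  also have "\<dots> \<le> ennreal (norm (U t s u)) + (nint (lebesgue_on {s..t}) (\<lambda>r. B r (U r s u)))"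
    by (intro add_left_mono V_sum_Suc_le Suc)
  also have "\<dots> \<le> ennreal (norm u)"
    using BU_integral_le[OF Suc.prems] by (simp add: add.commute)
  finally show ?case .
qed

lemma V_diff: "0 \<le> s \<Longrightarrow> s \<le> t \<Longrightarrow> V n t s (v - w) = V n t s v - V n t s w"
  by (rule linear_diff[OF regularD(1)[OF regular_V]])

lemma V_summable:
  assumes s: "0 \<le> s" "s \<le> t"
  shows "summable (\<lambda>n. norm (V n t s u))"
proof -
  have pos: "summable (\<lambda>n. norm (V n t s v))" if v: "0 \<le> v" for v
  proof (rule summableI_nonneg_bounded)
    fix N
    have "ennreal (\<Sum>n<N. norm (V n t s v)) \<le> ennreal (norm v)"
      using V_sum_le[OF s v, of N] by (subst sum_ennreal[symmetric]) auto
    then show "(\<Sum>n<N. norm (V n t s v)) \<le> norm v" by (simp add: sum_nonneg)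
  qed simp
  obtain v w where vw: "0 \<le> v" "0 \<le> w" "u = v - w" using decomposition by blast
  show ?thesis
  proof (rule summable_comparison_test[OF _ summable_add[OF pos[OF vw(1)] pos[OF vw(2)]]], intro exI allI impI)
    fix n
    show "norm (norm (V n t s u)) \<le> norm (V n t s v) + norm (V n t s w)"
      unfolding vw(3) V_diff[OF s] by (simp add: norm_triangle_ineq4)
  qed
qed

lemma Dyson_diff:
  assumes s: "0 \<le> s" "s \<le> t"
  shows "Dyson_series U B t s (v - w) = Dyson_series U B t s v - Dyson_series U B t s w"
  unfolding Dyson_series_def V_diff[OF s]
  by (rule suminf_diff[symmetric]; rule summable_norm_cancel[OF V_summable[OF s]])

text \<open>
  The left-hand side is bounded by the sum of the norms of all the terms after the zeroth.
\<close>

lemma Dyson_tail_le: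
  assumes s: "0 \<le> s" "s \<le> t" and u: "0 \<le> u"
  shows "ennreal (norm (Dyson_series U B t s u - U t s u - V 1 t s u)) + ennreal (norm (V 1 t s u))
    \<le> (nint (lebesgue_on {s..t}) (\<lambda>r. B r (U r s u)))"
proof -
  let ?a = "\<lambda>n. V n t s u"
  have sm: "summable (\<lambda>n. norm (?a n))" by (rule V_summable[OF s])
  have sm2: "summable (\<lambda>n. norm (?a (n + 2)))" using sm by (subst summable_iff_shift)
  have "Dyson_series U B t s u = (\<Sum>n. ?a (n + 2)) + (\<Sum>n<2. ?a n)"
    unfolding Dyson_series_def by (rule suminf_split_initial_segment[OF summable_norm_cancel[OF sm]])
  then have "Dyson_series U B t s u - U t s u - V 1 t s u = (\<Sum>n. ?a (n + 2))"
    by (simp add: numeral_2_eq_2 del: Dyson_term.simps(2))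
  then have "ennreal (norm (Dyson_series U B t s u - U t s u - V 1 t s u)) \<le> ennreal (\<Sum>n. norm (?a (n + 2)))"
    using summable_norm[OF sm2] by (simp add: ennreal_leI)
  also have "\<dots> = (\<Sum>n. ennreal (norm (?a (n + 2))))"
    using sm2 by (intro suminf_ennreal2[symmetric]) auto
  finally have "ennreal (norm (Dyson_series U B t s u - U t s u - V 1 t s u)) + ennreal (norm (V 1 t s u))
    \<le> (\<Sum>n. ennreal (norm (?a (n + 2)))) + ennreal (norm (V 1 t s u))"
    by (rule add_right_mono)
  also have "\<dots> = (\<Sum>n. ennreal (norm (?a (Suc n))))"
    using suminf_offset[OF summableI, of "\<lambda>n. ennreal (norm (?a (Suc n)))" 1]
    by (simp add: add.commute del: Dyson_term.simps(2))
  also have "\<dots> \<le> (nint (lebesgue_on {s..t}) (\<lambda>r. B r (U r s u)))"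
    by (rule suminf_le_const[OF summableI]) (rule V_sum_Suc_le[OF V_sum_le s u])
  finally show ?thesis .
qed

end

section \<open>The difference quotient of the perturbed semigroup\<close>

lemma bounded_evolution_id: "bounded_evolution (\<lambda>t s u :: 'a :: banach. u) 1"
proof (rule bounded_evolution.intro)
  have "onorm (\<lambda>u :: 'a. u) \<le> 1 * exp (1 * (t - s))" if "s \<le> t" for t s :: real
  proof -
    have "onorm (\<lambda>u :: 'a. u) \<le> 1" by (rule onorm_bound) auto
    also have "1 \<le> 1 * exp (1 * (t - s))" using that by simp
    finally show ?thesis .
  qed
  then show "evolution_family (\<lambda>t s u :: 'a. u)"
    unfolding evolution_family_def
    by (auto simp: bounded_linear_ident fun_eq_iff intro!: continuous_on_const exI[of _ 1])
qed auto

lemma borel_measurable_halfline_unshift: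
  fixes F :: "real \<Rightarrow> ennreal"
  assumes F: "F \<in> borel_measurable halfline" and d: "0 \<le> d"
  shows "(\<lambda>x. if d \<le> x then F (x - d) else 0) \<in> borel_measurable halfline"
proof -
  have "(\<lambda>s. F s * indicator {0..} s) \<in> borel_measurable lebesgue"
    using F by (simp add: borel_measurable_restrict_space_iff_ennreal)
  from nonsingular_measurable[OF nonsingular_translation[of "- d"] this]
  have "(\<lambda>x. F (x + - d) * indicator {0..} (x + - d)) \<in> borel_measurable halfline"
    by (rule measurable_restrict_space1)
  also have "(\<lambda>x. F (x + - d) * indicator {0..} (x + - d)) = (\<lambda>x. if d \<le> x then F (x - d) else 0)"
    by (auto simp: fun_eq_iff indicator_def)
  finally show ?thesis .
qed

lemma ennreal_le_diff_add: "(a::ennreal) \<le> (a - b) + b"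
  by (cases "b \<le> a") (simp_all add: diff_add_cancel_ennreal add_increasing)

text \<open>
  The quotients \<open>Q h\<close> may be nonmeasurable, and the integral of such a function, being a supremum over simple
  functions below it, is not subadditive. Therefore the distance of
  \<open>w\<close> and \<open>y\<close> is split into its truncated difference with \<open>\<Psi> h\<close> and \<open>\<Psi> h\<close> itself: both are measurable, and
  the first is at most the distance of \<open>Q h\<close> to \<open>w\<close>.
\<close>

lemma L1_limit_unique_dominated:
  fixes w y :: "real \<Rightarrow> 'a::real_normed_vector"
  assumes w: "strongly_measurable halfline w" and y: "strongly_measurable halfline y"
    and lim: "((\<lambda>h. L1_norm (\<lambda>s. Q h s - w s)) \<longlongrightarrow> 0) (at_right (0::real))"
    and m: "\<And>h. 0 < h \<Longrightarrow> \<Psi> h \<in> borel_measurable halfline"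
    and le: "\<And>h. 0 < h \<Longrightarrow> AE s in halfline. ennreal (norm (Q h s - y s)) \<le> \<Psi> h s"
    and lim': "((\<lambda>h. \<integral>\<^sup>+s. \<Psi> h s \<partial>halfline) \<longlongrightarrow> 0) (at_right 0)"
  shows "AE s in halfline. w s = y s"
proof -
  let ?N = "\<lambda>s. ennreal (norm (w s - y s))"
  have Nm: "?N \<in> borel_measurable halfline"
    by (intro borel_measurable_norm_halfline strongly_measurable_diff w y)
  have bound: "(\<integral>\<^sup>+s. ?N s \<partial>halfline) \<le> L1_norm (\<lambda>s. Q h s - w s) + (\<integral>\<^sup>+s. \<Psi> h s \<partial>halfline)" if h: "0 < h" for h
  proof -
    note m[OF h, measurable] and Nm[measurable]
    have "(\<integral>\<^sup>+s. ?N s \<partial>halfline) \<le> (\<integral>\<^sup>+s. (?N s - \<Psi> h s) + \<Psi> h s \<partial>halfline)"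
      by (intro nn_integral_mono ennreal_le_diff_add)
    also have "\<dots> = (\<integral>\<^sup>+s. ?N s - \<Psi> h s \<partial>halfline) + (\<integral>\<^sup>+s. \<Psi> h s \<partial>halfline)"
      by (rule nn_integral_add) measurable
    also have "(\<integral>\<^sup>+s. ?N s - \<Psi> h s \<partial>halfline) \<le> L1_norm (\<lambda>s. Q h s - w s)"
      unfolding L1_norm_def
    proof (rule nn_integral_mono_AE, use le[OF h] in eventually_elim)
      case (elim s)
      have "?N s = ennreal (norm ((Q h s - y s) + (- (Q h s - w s))))" by simp
      also have "\<dots> \<le> ennreal (norm (Q h s - y s)) + ennreal (norm (- (Q h s - w s)))"
        by (rule ennreal_norm_triangle)
      also have "\<dots> \<le> \<Psi> h s + ennreal (norm (Q h s - w s))"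
        unfolding norm_minus_cancel by (rule add_right_mono[OF elim])
      finally show ?case by (simp add: ennreal_minus_le_iff)
    qed
    finally show ?thesis by (simp add: add_right_mono)
  qed
  have "((\<lambda>h. L1_norm (\<lambda>s. Q h s - w s) + (\<integral>\<^sup>+s. \<Psi> h s \<partial>halfline)) \<longlongrightarrow> 0 + 0) (at_right 0)"
    by (intro tendsto_add lim lim')
  then have "(\<integral>\<^sup>+s. ?N s \<partial>halfline) \<le> 0 + 0"
    by (rule tendsto_lowerbound) (auto intro!: bound eventually_at_right_less[THEN eventually_mono])
  then have "AE s in halfline. ?N s = 0"
    using nn_integral_0_iff_AE[OF Nm] by simp
  then show ?thesis by eventually_elim simp
qed

context positive_perturbation
begin

text \<open>
  Let \<open>A\<close> bound the distance of \<open>V\<^sub>1\<close> to \<open>h *\<^sub>R \<beta> (s + h)\<close>, and let \<open>I\<close> be the integral of the norms of \<open>B r (U r s u)\<close>.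
  The terms of order at least 2 are bounded by \<open>I\<close> minus the norm of \<open>V\<^sub>1\<close>. As both numbers are within
  controlled distance of the norm of \<open>h *\<^sub>R \<beta> (s + h)\<close>, they nearly cancel. So the error is measured by how
  far \<open>B r (U r s u)\<close> is from \<open>\<beta> r\<close>, and \<open>\<beta> r\<close>, transported by \<open>U\<close> or not, from \<open>\<beta> (s + h)\<close>.
\<close>

lemma Dyson_increment_estimate:
  assumes s: "0 \<le> s" and h: "0 < h" and u: "0 \<le> u" and \<beta>: "\<beta> \<in> L1"
  shows "ennreal (norm (Dyson_series U B (s + h) s u - U (s + h) s u - h *\<^sub>R \<beta> (s + h)))
    \<le> ennreal (4 * K + 1) * (nint (lebesgue_on {s..s + h}) (\<lambda>r. B r (U r s u) - \<beta> r))
      + 2 * (nint (lebesgue_on {s..s + h}) (\<lambda>r. U (s + h) r (\<beta> r) - \<beta> (s + h)))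
      + (nint (lebesgue_on {s..s + h}) (\<lambda>r. \<beta> r - \<beta> (s + h)))"
proof -
  let ?x = "s + h" let ?M = "lebesgue_on {s..s + h}"
  let ?k1 = "\<lambda>r. ennreal (norm (B r (U r s u) - \<beta> r))"
  let ?k2 = "\<lambda>r. ennreal (norm (U ?x r (\<beta> r) - \<beta> ?x))"
  let ?k3 = "\<lambda>r. ennreal (norm (\<beta> r - \<beta> ?x))"
  let ?I = "nint ?M (\<lambda>r. B r (U r s u))"
  interpret R: complete_measure ?M by (rule complete_lebesgue_on) simp
  have \<phi>m: "strongly_measurable ?M (\<lambda>r. B r (U r s u))"
    using BU_integrable[OF s] by (simp add: strongly_integrable_def)
  have \<beta>m: "strongly_measurable ?M \<beta>"
    by (rule strongly_measurable_lebesgue_on_subset[of "{0..}"]) (use \<beta> s in \<open>auto simp: L1_def\<close>)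
  have U\<beta>m: "strongly_measurable ?M (\<lambda>r. U ?x r (\<beta> r))"
    by (rule strongly_measurable_start[OF \<beta>m]) (use s in auto)
  have k1m: "?k1 \<in> borel_measurable ?M"
    using R.strongly_measurable_norm[OF strongly_measurable_diff[OF \<phi>m \<beta>m]] by simp
  have k2m: "?k2 \<in> borel_measurable ?M"
    using R.strongly_measurable_norm[OF strongly_measurable_diff[OF U\<beta>m strongly_measurable_const]] by simp
  have k3m: "?k3 \<in> borel_measurable ?M"
    using R.strongly_measurable_norm[OF strongly_measurable_diff[OF \<beta>m strongly_measurable_const]] by simp
  have int: "strongly_integrable ?M (\<lambda>r. U ?x r (B r (U r s u)))"
    by (rule Duhamel_integrable[OF regular_U s]) auto
  have V1: "V 1 ?x s u = strong_integral ?M (\<lambda>r. U ?x r (B r (U r s u)))" by simp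
  have const: "strong_integral ?M (\<lambda>_. \<beta> ?x) = h *\<^sub>R \<beta> ?x"
    using strong_integral_const[of s ?x "\<beta> ?x"] h by simp
  have diff: "V 1 ?x s u - h *\<^sub>R \<beta> ?x = strong_integral ?M (\<lambda>r. U ?x r (B r (U r s u)) - \<beta> ?x)"
    using R.strong_integral_lincomb[OF int strongly_integrable_const[of s ?x "\<beta> ?x"], of 1 "-1"]
    unfolding V1 const by simp
  have int': "strongly_integrable ?M (\<lambda>r. U ?x r (B r (U r s u)) - \<beta> ?x)"
    using R.strongly_integrable_lincomb[OF int strongly_integrable_const[of s ?x "\<beta> ?x"], of 1 "-1"] by simp
  define A where "A = ennreal (2 * K) * (\<integral>\<^sup>+r. ?k1 r \<partial>?M) + (\<integral>\<^sup>+r. ?k2 r \<partial>?M)"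
  define J where "J = (\<integral>\<^sup>+r. ?k1 r \<partial>?M) + (\<integral>\<^sup>+r. ?k3 r \<partial>?M)"
  have A: "ennreal (norm (V 1 ?x s u - h *\<^sub>R \<beta> ?x)) \<le> A"
  proof -
    have "ennreal (norm (V 1 ?x s u - h *\<^sub>R \<beta> ?x)) \<le> (nint ?M (\<lambda>r. U ?x r (B r (U r s u)) - \<beta> ?x))"
      unfolding diff by (rule R.norm_strong_integral_le[OF int'])
    also have "\<dots> \<le> (\<integral>\<^sup>+r. ennreal (2 * K) * ?k1 r + ?k2 r \<partial>?M)"
    proof (rule nn_integral_mono)
      fix r assume "r \<in> space ?M"
      then have r: "0 \<le> r" "r \<le> ?x" using s by auto
      interpret L: bounded_linear "U ?x r" by (rule linear[OF r])
      have "U ?x r (B r (U r s u)) - \<beta> ?x = U ?x r (B r (U r s u) - \<beta> r) + (U ?x r (\<beta> r) - \<beta> ?x)"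
        by (simp add: L.diff)
      also have "ennreal (norm \<dots>) \<le> ennreal (norm (U ?x r (B r (U r s u) - \<beta> r))) + ?k2 r"
        by (rule ennreal_norm_triangle)
      also have "ennreal (norm (U ?x r (B r (U r s u) - \<beta> r))) \<le> ennreal (2 * K * norm (B r (U r s u) - \<beta> r))"
        by (intro ennreal_leI norm_le r)
      also have "\<dots> = ennreal (2 * K) * ?k1 r"
        using K_ge_1 by (intro ennreal_mult) auto
      finally show "ennreal (norm (U ?x r (B r (U r s u)) - \<beta> ?x)) \<le> ennreal (2 * K) * ?k1 r + ?k2 r"
        by (simp add: add_right_mono)
    qed
    also have "\<dots> = A"
      unfolding A_def nn_integral_cmult[OF k1m, symmetric]
      by (intro nn_integral_add borel_measurable_times_ennreal borel_measurable_const k1m k2m)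
    finally show ?thesis .
  qed
  have I: "?I \<le> J + ennreal (norm (h *\<^sub>R \<beta> ?x))"
  proof -
    have "?I \<le> (\<integral>\<^sup>+r. (?k1 r + ?k3 r) + ennreal (norm (\<beta> ?x)) \<partial>?M)"
    proof (rule nn_integral_mono)
      fix r
      have "ennreal (norm (B r (U r s u))) = ennreal (norm (((B r (U r s u) - \<beta> r) + (\<beta> r - \<beta> ?x)) + \<beta> ?x))" by simp
      also have "\<dots> \<le> ennreal (norm ((B r (U r s u) - \<beta> r) + (\<beta> r - \<beta> ?x))) + ennreal (norm (\<beta> ?x))"
        by (rule ennreal_norm_triangle)
      also have "\<dots> \<le> (?k1 r + ?k3 r) + ennreal (norm (\<beta> ?x))"
        by (intro add_right_mono ennreal_norm_triangle)
      finally show "ennreal (norm (B r (U r s u))) \<le> (?k1 r + ?k3 r) + ennreal (norm (\<beta> ?x))" .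
    qed
    also have "\<dots> = (\<integral>\<^sup>+r. ?k1 r + ?k3 r \<partial>?M) + (nint ?M (\<lambda>r. \<beta> ?x))"
      by (intro nn_integral_add borel_measurable_add k1m k3m) simp
    also have "(\<integral>\<^sup>+r. ?k1 r + ?k3 r \<partial>?M) = J"
      unfolding J_def by (rule nn_integral_add[OF k1m k3m])
    also have "(nint ?M (\<lambda>r. \<beta> ?x)) = ennreal (norm (h *\<^sub>R \<beta> ?x))"
      using h by (simp add: emeasure_restrict_space ennreal_mult mult.commute)
    finally show ?thesis .
  qed
  let ?T = "ennreal (norm (Dyson_series U B ?x s u - U ?x s u - V 1 ?x s u))"
  have "ennreal (norm (h *\<^sub>R \<beta> ?x)) \<le> A + ennreal (norm (V 1 ?x s u))"
  proof -
    have "ennreal (norm (h *\<^sub>R \<beta> ?x)) = ennreal (norm (- (V 1 ?x s u - h *\<^sub>R \<beta> ?x) + V 1 ?x s u))" by simp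
    also have "\<dots> \<le> ennreal (norm (- (V 1 ?x s u - h *\<^sub>R \<beta> ?x))) + ennreal (norm (V 1 ?x s u))"
      by (rule ennreal_norm_triangle)
    also have "\<dots> \<le> A + ennreal (norm (V 1 ?x s u))"
      unfolding norm_minus_cancel by (rule add_right_mono[OF A])
    finally show ?thesis .
  qed
  then have "J + ennreal (norm (h *\<^sub>R \<beta> ?x)) \<le> (J + A) + ennreal (norm (V 1 ?x s u))"
    unfolding add.assoc by (rule add_left_mono)
  moreover have "?T + ennreal (norm (V 1 ?x s u)) \<le> ?I"
    using h by (intro Dyson_tail_le s u) simp
  ultimately have "?T + ennreal (norm (V 1 ?x s u)) \<le> (J + A) + ennreal (norm (V 1 ?x s u))"
    using I by (meson order_trans)
  then have T: "?T \<le> J + A"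
    unfolding add.commute[of _ "ennreal (norm (V 1 ?x s u))"] ennreal_add_left_cancel_le by auto
  have "Dyson_series U B ?x s u - U ?x s u - h *\<^sub>R \<beta> ?x
    = (Dyson_series U B ?x s u - U ?x s u - V 1 ?x s u) + (V 1 ?x s u - h *\<^sub>R \<beta> ?x)" by simp
  also have "ennreal (norm \<dots>) \<le> ?T + ennreal (norm (V 1 ?x s u - h *\<^sub>R \<beta> ?x))"
    by (rule ennreal_norm_triangle)
  also have "\<dots> \<le> (J + A) + A" by (rule add_mono[OF T A])
  also have "\<dots> = (1 + (ennreal (2 * K) + ennreal (2 * K))) * (\<integral>\<^sup>+r. ?k1 r \<partial>?M) + 2 * (\<integral>\<^sup>+r. ?k2 r \<partial>?M) + (\<integral>\<^sup>+r. ?k3 r \<partial>?M)"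
  proof -
    have "((X + Z) + (c * X + Y)) + (c * X + Y) = (1 + (c + c)) * X + 2 * Y + Z" for X Y Z c :: ennreal
      by (simp add: distrib_right mult_2 add_ac)
    then show ?thesis unfolding A_def J_def .
  qed
  also have "1 + (ennreal (2 * K) + ennreal (2 * K)) = ennreal (4 * K + 1)"
    using decomposition_constant by (simp add: ennreal_plus[symmetric] ennreal_1[symmetric] del: ennreal_plus ennreal_1)
  finally show ?thesis .
qed

context
  fixes g :: "real \<Rightarrow> 'a"
  assumes g: "g \<in> L1" and g_pos: "\<And>s. 0 \<le> g s"
begin

abbreviation (input) "Bpot x \<equiv> B x (E.mild g x)"

text \<open>
  The bound of \<open>Dyson_increment_estimate\<close>, divided by \<open>h\<close>, at the vector \<open>E.mild g s\<close>. For \<open>0 \<le> s\<close> the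
  expression \<open>max 0 (s + h - h)\<close> is just \<open>s\<close>; written this way, the last two integrals are visibly functions of
  \<open>s + h\<close> of the kind treated in \<open>drift_strip\<close>.
\<close>

definition slope_error :: "real \<Rightarrow> real \<Rightarrow> ennreal" where
  "slope_error h s = ennreal (1 / h) *
     (ennreal (4 * K + 1) * (nint (lebesgue_on {s..s + h}) (\<lambda>t. B t (U t s (E.mild g s)) - Bpot t))
      + (2 * (nint (lebesgue_on {max 0 (s + h - h)..s + h}) (\<lambda>r. U (s + h) r (Bpot r) - Bpot (s + h)))
      + (nint (lebesgue_on {max 0 (s + h - h)..s + h}) (\<lambda>r. Bpot r - Bpot (s + h)))))"

lemma Bpot_L1: "Bpot \<in> L1"
  by (rule B_pot_L1[OF g g_pos])

lemma Bpot_sm: "strongly_measurable halfline Bpot"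
  using Bpot_L1 by (simp add: L1_def)

lemma slope_error_bound:
  assumes s: "0 \<le> s" and h: "0 < h"
  shows "ennreal (norm ((Dyson_series U B (s + h) s (E.mild g s) - U (s + h) s (E.mild g s)) /\<^sub>R h - Bpot (s + h)))
    \<le> slope_error h s"
proof -
  let ?d = "Dyson_series U B (s + h) s (E.mild g s) - U (s + h) s (E.mild g s)"
  have "?d /\<^sub>R h - Bpot (s + h) = (1 / h) *\<^sub>R (?d - h *\<^sub>R Bpot (s + h))"
    using h by (simp add: scaleR_diff_right divide_inverse)
  then have "ennreal (norm (?d /\<^sub>R h - Bpot (s + h))) = ennreal (1 / h) * ennreal (norm (?d - h *\<^sub>R Bpot (s + h)))"
    using h by (simp add: ennreal_mult[symmetric])
  also have "\<dots> \<le> slope_error h s"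
    unfolding slope_error_def
    using Dyson_increment_estimate[OF s h pot_nonneg[OF g g_pos] Bpot_L1] s
    by (intro mult_left_mono) (simp_all add: add.assoc)
  finally show ?thesis .
qed

text \<open>
  Integrated over \<open>s\<close>, the three integrals over \<open>[s, s + h]\<close> become means over delays up to \<open>h\<close>: of the
  distance between \<open>B\<close> applied to the delayed values and its limit, of the drift under \<open>U\<close>, and of the drift under
  the identity.
\<close>

lemma slope_error_integral:
  assumes h: "0 < h"
  shows "slope_error h \<in> borel_measurable halfline" (is ?m)
    and "(\<integral>\<^sup>+s. slope_error h s \<partial>halfline) \<le> ennreal (4 * K + 1) * (ennreal (1 / h) * (\<integral>\<^sup>+d. (nint halfline (\<lambda>s. B (s + d) (U (s + d) s (E.mild g s)) - Bpot (s + d))) \<partial>lebesgue_on {0..h}))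
      + (2 * (ennreal (1 / h) * (\<integral>\<^sup>+d. drift Bpot d \<partial>lebesgue_on {0..h}))
      + ennreal (1 / h) * (\<integral>\<^sup>+d. bounded_evolution.drift (\<lambda>t s u. u) Bpot d \<partial>lebesgue_on {0..h}))" (is ?i)
proof -
  interpret I: bounded_evolution "\<lambda>t s u :: 'a. u" 1 by (rule bounded_evolution_id)
  have fL: "E.mild g \<in> L1" by (rule pot_L1[OF g g_pos])
  have "strongly_measurable (lebesgue_on Delta) (\<lambda>p. B (fst p) (U (fst p) (snd p) (E.mild g (snd p))) - Bpot (fst p))"
    using BUf_measurable[OF fL]
    by (intro strongly_measurable_diff strongly_measurable_fst[OF Bpot_sm]) (simp add: case_prod_beta')
  from complete_measure.strongly_measurable_norm[OF complete_lebesgue_on[OF Delta_lebesgue] this]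
  have F: "(\<lambda>p. ennreal (norm (B (fst p) (U (fst p) (snd p) (E.mild g (snd p))) - Bpot (fst p)))) \<in> borel_measurable (lebesgue_on Delta)"
    by simp
  have h0: "0 \<le> h" using h by simp
  let ?a = "\<lambda>s. nint (lebesgue_on {s..s + h}) (\<lambda>t. B t (U t s (E.mild g s)) - Bpot t)"
  let ?b = "\<lambda>x. nint (lebesgue_on {max 0 (x - h)..x}) (\<lambda>r. U x r (Bpot r) - Bpot x)"
  let ?c = "\<lambda>x. nint (lebesgue_on {max 0 (x - h)..x}) (\<lambda>r. Bpot r - Bpot x)"
  have am: "?a \<in> borel_measurable halfline" using nn_integral_strip(3)[OF F h0] by simp
  have bm: "?b \<in> borel_measurable halfline" by (rule drift_strip(2)[OF Bpot_sm h0])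
  have cm: "?c \<in> borel_measurable halfline" by (rule I.drift_strip(2)[OF Bpot_sm h0])
  have bm': "(\<lambda>s. ?b (s + h)) \<in> borel_measurable halfline" by (rule borel_measurable_halfline_shift[OF bm h0])
  have cm': "(\<lambda>s. ?c (s + h)) \<in> borel_measurable halfline" by (rule borel_measurable_halfline_shift[OF cm h0])
  note [measurable] = am bm' cm'
  have err_eq: "slope_error h = (\<lambda>s. ennreal (1 / h) * (ennreal (4 * K + 1) * ?a s + (2 * ?b (s + h) + ?c (s + h))))"
    by (simp add: slope_error_def fun_eq_iff)
  show ?m unfolding err_eq by measurable
  have "(\<integral>\<^sup>+s. slope_error h s \<partial>halfline)
    = ennreal (1 / h) * (ennreal (4 * K + 1) * (\<integral>\<^sup>+s. ?a s \<partial>halfline)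
      + (2 * (\<integral>\<^sup>+s. ?b (s + h) \<partial>halfline) + (\<integral>\<^sup>+s. ?c (s + h) \<partial>halfline)))"
  proof -
    have "(\<integral>\<^sup>+s. slope_error h s \<partial>halfline)
      = ennreal (1 / h) * (\<integral>\<^sup>+s. ennreal (4 * K + 1) * ?a s + (2 * ?b (s + h) + ?c (s + h)) \<partial>halfline)"
      unfolding err_eq by (rule nn_integral_cmult) measurable
    also have "(\<integral>\<^sup>+s. ennreal (4 * K + 1) * ?a s + (2 * ?b (s + h) + ?c (s + h)) \<partial>halfline)
      = (\<integral>\<^sup>+s. ennreal (4 * K + 1) * ?a s \<partial>halfline) + (\<integral>\<^sup>+s. 2 * ?b (s + h) + ?c (s + h) \<partial>halfline)"
      by (rule nn_integral_add) measurable
    also have "(\<integral>\<^sup>+s. 2 * ?b (s + h) + ?c (s + h) \<partial>halfline)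
      = (\<integral>\<^sup>+s. 2 * ?b (s + h) \<partial>halfline) + (\<integral>\<^sup>+s. ?c (s + h) \<partial>halfline)"
      by (rule nn_integral_add) measurable
    also have "(\<integral>\<^sup>+s. 2 * ?b (s + h) \<partial>halfline) = 2 * (\<integral>\<^sup>+s. ?b (s + h) \<partial>halfline)"
      by (rule nn_integral_cmult[OF bm'])
    also have "(\<integral>\<^sup>+s. ennreal (4 * K + 1) * ?a s \<partial>halfline) = ennreal (4 * K + 1) * (\<integral>\<^sup>+s. ?a s \<partial>halfline)"
      by (rule nn_integral_cmult[OF am])
    finally show ?thesis .
  qed
  also have "\<dots> \<le> ennreal (1 / h) * (ennreal (4 * K + 1) * (\<integral>\<^sup>+s. ?a s \<partial>halfline)
      + (2 * (\<integral>\<^sup>+s. ?b s \<partial>halfline) + (\<integral>\<^sup>+s. ?c s \<partial>halfline)))"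
    by (intro mult_left_mono add_left_mono add_mono nn_integral_halfline_shift_le[OF bm h0]
        nn_integral_halfline_shift_le[OF cm h0]) simp_all
  also have "(\<integral>\<^sup>+s. ?a s \<partial>halfline) = (\<integral>\<^sup>+d. (nint halfline (\<lambda>s. B (s + d) (U (s + d) s (E.mild g s)) - Bpot (s + d))) \<partial>lebesgue_on {0..h})"
    using nn_integral_strip(1)[OF F h0] by simp
  also have "(\<integral>\<^sup>+s. ?b s \<partial>halfline) = (\<integral>\<^sup>+d. drift Bpot d \<partial>lebesgue_on {0..h})"
    by (rule drift_strip(1)[OF Bpot_sm h0])
  also have "(\<integral>\<^sup>+s. ?c s \<partial>halfline) = (\<integral>\<^sup>+d. I.drift Bpot d \<partial>lebesgue_on {0..h})"
    by (rule I.drift_strip(1)[OF Bpot_sm h0])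
  finally show ?i by (simp add: distrib_left mult_ac)
qed

lemma slope_error_tendsto_0: "((\<lambda>h. \<integral>\<^sup>+s. slope_error h s \<partial>halfline) \<longlongrightarrow> 0) (at_right 0)"
proof (rule ennreal_tendsto_zero_mono)
  interpret I: bounded_evolution "\<lambda>t s u :: 'a. u" 1 by (rule bounded_evolution_id)
  let ?R = "\<lambda>h. ennreal (4 * K + 1) * (ennreal (1 / h) * (\<integral>\<^sup>+d. (nint halfline (\<lambda>s. B (s + d) (U (s + d) s (E.mild g s)) - Bpot (s + d))) \<partial>lebesgue_on {0..h}))
      + (2 * (ennreal (1 / h) * (\<integral>\<^sup>+d. drift Bpot d \<partial>lebesgue_on {0..h}))
      + ennreal (1 / h) * (\<integral>\<^sup>+d. I.drift Bpot d \<partial>lebesgue_on {0..h}))"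
  have "(?R \<longlongrightarrow> ennreal (4 * K + 1) * 0 + (2 * 0 + 0)) (at_right 0)"
    by (intro tendsto_add ennreal_tendsto_cmult average_tendsto_0 average_tendsto_0' drift_tendsto_0 I.drift_tendsto_0
        Bpot_L1 BU_tendsto_B_pot[OF g g_pos]) auto
  then show "(?R \<longlongrightarrow> 0) (at_right 0)" by simp
  show "\<forall>\<^sub>F h in at_right 0. (\<integral>\<^sup>+s. slope_error h s \<partial>halfline) \<le> ?R h"
    using eventually_at_right_less by eventually_elim (rule slope_error_integral(2))
qed

end

end

section \<open>The generators\<close>

lemma L1_AE_cong:
  assumes "f \<in> L1" "AE s in halfline. f s = g s"
  shows "g \<in> L1"
  using complete_measure.strongly_integrable_cong_AE[OF complete_halfline _ assms(2)] assms(1)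
  by (simp add: L1_iff)

lemma L1_lincomb:
  assumes "f \<in> L1" "g \<in> L1"
  shows "(\<lambda>s. a *\<^sub>R f s + b *\<^sub>R g s) \<in> L1"
  using complete_measure.strongly_integrable_lincomb[OF complete_halfline, of f g a b] assms
  by (simp add: L1_iff)

lemma L1_diff: "f \<in> L1 \<Longrightarrow> g \<in> L1 \<Longrightarrow> (\<lambda>s. f s - g s) \<in> L1"
  using L1_lincomb[of f g 1 "-1"] by simp

lemma L1_add: "f \<in> L1 \<Longrightarrow> g \<in> L1 \<Longrightarrow> (\<lambda>s. f s + g s) \<in> L1"
  using L1_lincomb[of f g 1 1] by simp

lemma L1_strongly_measurable: "f \<in> L1 \<Longrightarrow> strongly_measurable halfline f"
  by (simp add: L1_def)

lemma L1_norm_triangle3: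
  assumes "strongly_measurable halfline f" "strongly_measurable halfline g" "strongly_measurable halfline k"
  shows "L1_norm (\<lambda>s. f s + g s + k s) \<le> L1_norm f + L1_norm g + L1_norm k"
  by (rule order_trans[OF L1_norm_add_le[OF strongly_measurable_add[OF assms(1,2)] assms(3)]
      add_right_mono[OF L1_norm_add_le[OF assms(1,2)]]])

lemma ennreal_tendsto_zero_times_const:
  fixes c :: ennreal
  assumes "(\<phi> \<longlongrightarrow> 0) F" "c < \<infinity>"
  shows "((\<lambda>h. ennreal \<bar>\<phi> h\<bar> * c) \<longlongrightarrow> 0) F"
proof -
  have "((\<lambda>h. ennreal \<bar>\<phi> h\<bar>) \<longlongrightarrow> ennreal \<bar>0\<bar>) F" by (intro tendsto_intros assms(1))
  then have "((\<lambda>h. c * ennreal \<bar>\<phi> h\<bar>) \<longlongrightarrow> c * ennreal \<bar>0\<bar>) F"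
    using assms(2) by (intro ennreal_tendsto_cmult) auto
  then show ?thesis by (simp add: mult.commute)
qed

lemma exp_minus_difference_quotient: "((\<lambda>h::real. (exp (- h) - 1) / h + 1) \<longlongrightarrow> 0) (at_right 0)"
proof -
  have "((\<lambda>h::real. exp (- h)) has_real_derivative - 1) (at 0)"
    by (auto intro!: derivative_eq_intros)
  then have "((\<lambda>h::real. (exp (- (0 + h)) - exp (- 0)) / h) \<longlongrightarrow> - 1) (at 0)"
    unfolding DERIV_def .
  then have "((\<lambda>h::real. (exp (- h) - 1) / h) \<longlongrightarrow> - 1) (at_right 0)"
    by (simp add: filterlim_at_split)
  from tendsto_add[OF this tendsto_const[of 1]] show ?thesis by simp
qed

context bounded_evolution
begin

lemma generator_damped:
  assumes f: "f \<in> L1" and z: "z \<in> L1"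
    and lim: "((\<lambda>h. L1_norm (\<lambda>s. (evolution_semigroup U h f s - f s) /\<^sub>R h - z s)) \<longlongrightarrow> 0) (at_right 0)"
  shows "((\<lambda>h. L1_norm (\<lambda>s. (evolution_semigroup (damped U) h f s - f s) /\<^sub>R h - (z s - f s))) \<longlongrightarrow> 0) (at_right 0)"
proof (rule ennreal_tendsto_zero_mono)
  note fm = L1_strongly_measurable[OF f] and zm = L1_strongly_measurable[OF z]
  let ?R = "\<lambda>h. L1_norm (\<lambda>s. (evolution_semigroup U h f s - f s) /\<^sub>R h - z s)
      + ennreal \<bar>exp (- h) - 1\<bar> * L1_norm z + ennreal \<bar>(exp (- h) - 1) / h + 1\<bar> * L1_norm f"
  have "((\<lambda>h. exp (- h) - 1) \<longlongrightarrow> exp (- 0) - 1) (at_right (0::real))" by (intro tendsto_intros)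
  then have e: "((\<lambda>h. exp (- h) - 1) \<longlongrightarrow> 0) (at_right (0::real))" by simp
  have "(?R \<longlongrightarrow> 0 + 0 + 0) (at_right 0)"
    using f z by (intro tendsto_add lim ennreal_tendsto_zero_times_const e exp_minus_difference_quotient)
      (auto simp: L1_def)
  then show "(?R \<longlongrightarrow> 0) (at_right 0)" by simp
  show "\<forall>\<^sub>F h in at_right 0. L1_norm (\<lambda>s. (evolution_semigroup (damped U) h f s - f s) /\<^sub>R h - (z s - f s)) \<le> ?R h"
    using eventually_at_right_less
  proof eventually_elim
    case (elim h)
    let ?q = "\<lambda>s. (evolution_semigroup U h f s - f s) /\<^sub>R h - z s"
    have qm: "strongly_measurable halfline ?q"
      using elim by (intro strongly_measurable_diff strongly_measurable_scaleR strongly_measurable_evolution_semigroup fm zm) auto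
    have eq: "(evolution_semigroup (damped U) h f s - f s) /\<^sub>R h - (z s - f s)
      = exp (- h) *\<^sub>R ?q s + (exp (- h) - 1) *\<^sub>R z s + ((exp (- h) - 1) / h + 1) *\<^sub>R f s" for s
    proof -
      have "evolution_semigroup (damped U) h f s = exp (- h) *\<^sub>R evolution_semigroup U h f s"
        by (simp add: evolution_semigroup_def damped_def)
      then show ?thesis by (simp add: algebra_simps divide_inverse)
    qed
    have "L1_norm (\<lambda>s. exp (- h) *\<^sub>R ?q s + (exp (- h) - 1) *\<^sub>R z s + ((exp (- h) - 1) / h + 1) *\<^sub>R f s)
      \<le> L1_norm (\<lambda>s. exp (- h) *\<^sub>R ?q s) + L1_norm (\<lambda>s. (exp (- h) - 1) *\<^sub>R z s)
        + L1_norm (\<lambda>s. ((exp (- h) - 1) / h + 1) *\<^sub>R f s)"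
      by (intro L1_norm_triangle3 strongly_measurable_scaleR qm zm fm) auto
    also have "\<dots> = ennreal \<bar>exp (- h)\<bar> * L1_norm ?q + ennreal \<bar>exp (- h) - 1\<bar> * L1_norm z
        + ennreal \<bar>(exp (- h) - 1) / h + 1\<bar> * L1_norm f"
      by (simp only: L1_norm_scaleR[OF qm] L1_norm_scaleR[OF zm] L1_norm_scaleR[OF fm])
    also have "\<dots> \<le> ?R h"
    proof (intro add_right_mono)
      have "ennreal \<bar>exp (- h)\<bar> * L1_norm ?q \<le> 1 * L1_norm ?q"
        using elim by (intro mult_right_mono) (auto simp: ennreal_le_1)
      then show "ennreal \<bar>exp (- h)\<bar> * L1_norm ?q \<le> L1_norm ?q" by simp
    qed
    finally show ?case by (simp only: eq)
  qed
qed

text \<open>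
  By \<open>generator_mild\<close> the generator annihilates \<open>f - mild g1 + mild g2\<close>, so \<open>stationary_imp_zero\<close> applies.
\<close>

lemma eq_mild_diff:
  assumes f: "f \<in> L1" and g1: "g1 \<in> L1" and g2: "g2 \<in> L1"
    and g: "AE s in halfline. - y s = g1 s - g2 s"
    and lim: "((\<lambda>h. L1_norm (\<lambda>s. (evolution_semigroup U h f s - f s) /\<^sub>R h - y s)) \<longlongrightarrow> 0) (at_right 0)"
    and y: "y \<in> L1"
  shows "AE s in halfline. f s = mild g1 s - mild g2 s"
proof -
  note ms = L1_strongly_measurable[OF f] strongly_measurable_mild[OF g1] strongly_measurable_mild[OF g2] L1_strongly_measurable[OF g1] L1_strongly_measurable[OF g2] L1_strongly_measurable[OF y]
  let ?d = "\<lambda>s. f s - mild g1 s + mild g2 s"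
  have dm: "strongly_measurable halfline ?d" by (intro strongly_measurable_add strongly_measurable_diff ms)
  have "AE s in halfline. ?d s = 0"
  proof (rule stationary_imp_zero[OF dm], rule ennreal_tendsto_zero_mono)
    let ?q0 = "\<lambda>h s. (evolution_semigroup U h f s - f s) /\<^sub>R h - y s"
    let ?q1 = "\<lambda>h s. (mild g1 s - evolution_semigroup U h (mild g1) s) /\<^sub>R h - g1 s"
    let ?q2 = "\<lambda>h s. (mild g2 s - evolution_semigroup U h (mild g2) s) /\<^sub>R h - g2 s"
    have "((\<lambda>h. L1_norm (?q0 h) + L1_norm (?q1 h) + L1_norm (?q2 h)) \<longlongrightarrow> 0 + 0 + 0) (at_right 0)"
      by (intro tendsto_add lim generator_mild g1 g2)
    then show "((\<lambda>h. L1_norm (?q0 h) + L1_norm (?q1 h) + L1_norm (?q2 h)) \<longlongrightarrow> 0) (at_right 0)" by simp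
    show "\<forall>\<^sub>F h in at_right 0. L1_norm (\<lambda>s. (evolution_semigroup U h ?d s - ?d s) /\<^sub>R h)
      \<le> L1_norm (?q0 h) + L1_norm (?q1 h) + L1_norm (?q2 h)"
      using eventually_at_right_less
    proof eventually_elim
      case (elim h)
      have q0m: "strongly_measurable halfline (?q0 h)" and q1m: "strongly_measurable halfline (?q1 h)"
        and q2m: "strongly_measurable halfline (?q2 h)"
        using elim by (intro strongly_measurable_diff strongly_measurable_scaleR strongly_measurable_evolution_semigroup ms; simp)+
      have "L1_norm (\<lambda>s. (evolution_semigroup U h ?d s - ?d s) /\<^sub>R h)
        = L1_norm (\<lambda>s. ?q0 h s + ?q1 h s + (-1) *\<^sub>R ?q2 h s)"
        unfolding L1_norm_def
      proof (rule nn_integral_cong_AE, use g AE_space in eventually_elim)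
        case (elim s)
        have "evolution_semigroup U h ?d s
          = evolution_semigroup U h f s - evolution_semigroup U h (mild g1) s + evolution_semigroup U h (mild g2) s"
        proof (cases "h \<le> s")
          case True
          then interpret L: bounded_linear "U s (s - h)" using \<open>0 < h\<close> by (intro linear) auto
          show ?thesis using True by (simp add: evolution_semigroup_def L.add L.diff)
        qed (simp add: evolution_semigroup_def)
        note E = this
        have y: "y s = g2 s - g1 s" using elim(1) by (metis minus_diff_eq minus_equation_iff)
        have "(evolution_semigroup U h ?d s - ?d s) /\<^sub>R h = ?q0 h s + ?q1 h s + (-1) *\<^sub>R ?q2 h s"
          unfolding E y by (simp add: algebra_simps)
        then show ?case by simp
      qed
      also have "\<dots> \<le> L1_norm (?q0 h) + L1_norm (?q1 h) + L1_norm (\<lambda>s. (-1) *\<^sub>R ?q2 h s)"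
        by (intro L1_norm_triangle3 q0m q1m strongly_measurable_scaleR q2m) simp
      also have "L1_norm (\<lambda>s. (-1) *\<^sub>R ?q2 h s) = L1_norm (?q2 h)"
        by (subst L1_norm_scaleR[OF q2m]) simp
      finally show ?case .
    qed
  qed
  then show ?thesis by eventually_elim (simp add: algebra_simps)
qed

end

context positive_perturbation
begin

text \<open>
  For a value \<open>z\<close> of the generator at \<open>f\<close>, the generator of the damped semigroup has the value \<open>z - f\<close>;
  split \<open>f - z\<close> into positive parts.
\<close>

lemma Z_domain_representation:
  assumes "is_generator_value (evolution_semigroup U) f z"
  shows "\<exists>g1 g2. g1 \<in> L1 \<and> g2 \<in> L1 \<and> (\<forall>s. 0 \<le> g1 s \<and> 0 \<le> g2 s) \<and>
    (AE s in halfline. f s = E.mild g1 s - E.mild g2 s)"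
proof -
  have f: "f \<in> L1" and z: "z \<in> L1"
    and lim: "((\<lambda>h. L1_norm (\<lambda>s. (evolution_semigroup U h f s - f s) /\<^sub>R h - z s)) \<longlongrightarrow> 0) (at_right 0)"
    using assms by (auto simp: is_generator_value_def)
  obtain g1 g2 where g: "g1 \<in> L1" "g2 \<in> L1" "\<forall>s. 0 \<le> g1 s \<and> 0 \<le> g2 s"
    "AE s in halfline. f s - z s = g1 s - g2 s"
    using L1_cone_decomposition[OF cone_closed decomposition L1_diff[OF f z]] by blast
  have "AE s in halfline. f s = E.mild g1 s - E.mild g2 s"
  proof (rule E.eq_mild_diff[OF f g(1,2) _ generator_damped[OF f z lim] L1_diff[OF z f]])
    show "AE s in halfline. - (z s - f s) = g1 s - g2 s" using g(4) by simp
  qed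
  then show ?thesis using g(1-3) by blast
qed

text \<open>
  With \<open>f\<close> written as a difference of two potentials, \<open>slope_error\<close> for each of them controls the difference
  between the quotients of the two semigroups on \<open>s \<ge> h\<close>. So \<open>z + \<beta>\<close> is a value of the perturbed generator at
  \<open>f\<close>, and uniqueness of generator values identifies it with the value that \<open>generator\<close> selects.
\<close>

lemma generator_perturbed:
  assumes gen: "is_generator_value (evolution_semigroup U) f z"
  shows "AE s in halfline. f s \<in> D s"
    and "mult_op B f \<in> L1"
    and "AE s in halfline. B_hat U B f s = B s (f s)"
proof -
  have f: "f \<in> L1" and z: "z \<in> L1"
    and lim: "((\<lambda>h. L1_norm (\<lambda>s. (evolution_semigroup U h f s - f s) /\<^sub>R h - z s)) \<longlongrightarrow> 0) (at_right 0)"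
    using gen by (auto simp: is_generator_value_def)
  note fm = L1_strongly_measurable[OF f] and zm = L1_strongly_measurable[OF z]
  obtain g1 g2 where g1: "g1 \<in> L1" "\<And>s. 0 \<le> g1 s" and g2: "g2 \<in> L1" "\<And>s. 0 \<le> g2 s"
    and rep: "AE s in halfline. f s = E.mild g1 s - E.mild g2 s"
    using Z_domain_representation[OF gen] by blast
  define \<beta> where "\<beta> s = B s (E.mild g1 s) - B s (E.mild g2 s)" for s
  have \<beta>: "\<beta> \<in> L1"
    unfolding \<beta>_def by (intro L1_diff B_pot_L1 g1 g2)
  note \<beta>m = L1_strongly_measurable[OF \<beta>]
  have D\<beta>: "AE s in halfline. f s \<in> D s \<and> \<beta> s = B s (f s)"
    using rep pot_in_D[OF g1] pot_in_D[OF g2] AE_space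
    by eventually_elim (auto simp: D_diff B_diff \<beta>_def)
  show "AE s in halfline. f s \<in> D s" using D\<beta> by eventually_elim simp
  have "AE s in halfline. \<beta> s = mult_op B f s" using D\<beta> by eventually_elim (simp add: mult_op_def)
  then show "mult_op B f \<in> L1" by (rule L1_AE_cong[OF \<beta>])
  let ?T = "evolution_semigroup (Dyson_series U B)"
  let ?q = "\<lambda>h s. (evolution_semigroup U h f s - f s) /\<^sub>R h - z s"
  \<comment> \<open>for \<open>s < h\<close> both semigroups give 0, and the error is \<open>norm (\<beta> s)\<close>\<close>
  define \<rho> where "\<rho> h s = (if h \<le> s then slope_error g1 h (s - h) + slope_error g2 h (s - h) else 0)
      + ennreal (norm (\<beta> s)) * indicator {0..h} s" for h s
  define \<Psi> where "\<Psi> h s = ennreal (norm (?q h s)) + \<rho> h s" for h s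
  have errm: "slope_error g1 h \<in> borel_measurable halfline" "slope_error g2 h \<in> borel_measurable halfline" if "0 < h" for h
    using slope_error_integral(1)[OF g1 that] slope_error_integral(1)[OF g2 that] by auto
  have m1: "(\<lambda>s. if h \<le> s then slope_error g1 h (s - h) + slope_error g2 h (s - h) else 0) \<in> borel_measurable halfline" if "0 < h" for h
    using that by (intro borel_measurable_halfline_unshift[of "\<lambda>s. slope_error g1 h s + slope_error g2 h s"] borel_measurable_add errm) simp_all
  have m2: "(\<lambda>s. ennreal (norm (\<beta> s)) * indicator {0..h} s) \<in> borel_measurable halfline" for h
    by (intro borel_measurable_times_ennreal borel_measurable_norm_halfline \<beta>m borel_measurable_indicator)
      (auto simp: sets_restrict_space_iff)
  have \<rho>m: "\<rho> h \<in> borel_measurable halfline" if "0 < h" for h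
    unfolding \<rho>_def by (rule borel_measurable_add[OF m1[OF that] m2])
  have qm: "(\<lambda>s. ennreal (norm (?q h s))) \<in> borel_measurable halfline" if "0 < h" for h
    using that by (intro borel_measurable_norm_halfline strongly_measurable_diff strongly_measurable_scaleR
        strongly_measurable_evolution_semigroup fm zm) auto
  have \<Psi>m: "\<Psi> h \<in> borel_measurable halfline" if "0 < h" for h
    unfolding \<Psi>_def by (rule borel_measurable_add[OF qm[OF that] \<rho>m[OF that]])
  have I\<Psi>: "(\<integral>\<^sup>+s. \<Psi> h s \<partial>halfline) = L1_norm (?q h) + (((\<integral>\<^sup>+s. slope_error g1 h s \<partial>halfline) + (\<integral>\<^sup>+s. slope_error g2 h s \<partial>halfline))
      + (nint (lebesgue_on {0..0 + h}) \<beta>))" if h: "0 < h" for h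
  proof -
    have "(\<integral>\<^sup>+s. \<Psi> h s \<partial>halfline) = L1_norm (?q h) + (\<integral>\<^sup>+s. \<rho> h s \<partial>halfline)"
      unfolding \<Psi>_def L1_norm_def by (rule nn_integral_add[OF qm[OF h] \<rho>m[OF h]])
    also have "(\<integral>\<^sup>+s. \<rho> h s \<partial>halfline) = (\<integral>\<^sup>+s. (if h \<le> s then slope_error g1 h (s - h) + slope_error g2 h (s - h) else 0) \<partial>halfline)
        + (\<integral>\<^sup>+s. ennreal (norm (\<beta> s)) * indicator {0..h} s \<partial>halfline)"
      unfolding \<rho>_def by (rule nn_integral_add[OF m1[OF h] m2])
    also have "(\<integral>\<^sup>+s. ennreal (norm (\<beta> s)) * indicator {0..h} s \<partial>halfline) = (nint (lebesgue_on {0..0 + h}) \<beta>)"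
      by (simp add: nn_integral_restrict_space, rule nn_integral_cong) (auto simp: indicator_def)
    also have "(\<integral>\<^sup>+s. (if h \<le> s then slope_error g1 h (s - h) + slope_error g2 h (s - h) else 0) \<partial>halfline)
      = (\<integral>\<^sup>+s. (if h \<le> s then slope_error g1 h (s - h) + slope_error g2 h (s - h) else 0) \<partial>lebesgue_on {0..<h})
        + (\<integral>\<^sup>+s. (if h \<le> s + h then slope_error g1 h (s + h - h) + slope_error g2 h (s + h - h) else 0) \<partial>halfline)"
      by (rule nn_integral_halfline_split[OF m1[OF h] less_imp_le[OF h]])
    also have "(\<integral>\<^sup>+s. (if h \<le> s then slope_error g1 h (s - h) + slope_error g2 h (s - h) else 0) \<partial>lebesgue_on {0..<h})
      = (\<integral>\<^sup>+s. 0 \<partial>lebesgue_on {0..<h})"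
      by (intro nn_integral_cong) auto
    also have "(\<integral>\<^sup>+s. (if h \<le> s + h then slope_error g1 h (s + h - h) + slope_error g2 h (s + h - h) else 0) \<partial>halfline)
      = (\<integral>\<^sup>+s. slope_error g1 h s + slope_error g2 h s \<partial>halfline)"
      by (intro nn_integral_cong) auto
    also have "\<dots> = (\<integral>\<^sup>+s. slope_error g1 h s \<partial>halfline) + (\<integral>\<^sup>+s. slope_error g2 h s \<partial>halfline)"
      by (rule nn_integral_add[OF errm[OF h]])
    finally show ?thesis by simp
  qed
  have lim0: "((\<lambda>h. L1_norm (?q h) + (((\<integral>\<^sup>+s. slope_error g1 h s \<partial>halfline) + (\<integral>\<^sup>+s. slope_error g2 h s \<partial>halfline))
      + (nint (lebesgue_on {0..0 + h}) \<beta>))) \<longlongrightarrow> 0 + ((0 + 0) + 0)) (at_right 0)"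
    using \<beta> by (intro tendsto_add lim slope_error_tendsto_0 g1 g2 nn_integral_small_interval_tendsto_0 borel_measurable_norm_halfline \<beta>m)
      (auto simp: L1_def L1_norm_def)
  have "\<forall>\<^sub>F h in at_right 0. L1_norm (?q h) + (((\<integral>\<^sup>+s. slope_error g1 h s \<partial>halfline) + (\<integral>\<^sup>+s. slope_error g2 h s \<partial>halfline))
      + (nint (lebesgue_on {0..0 + h}) \<beta>)) = (\<integral>\<^sup>+s. \<Psi> h s \<partial>halfline)"
    using eventually_at_right_less by eventually_elim (simp only: I\<Psi>)
  from Lim_transform_eventually[OF lim0 this]
  have lim\<Psi>: "((\<lambda>h. \<integral>\<^sup>+s. \<Psi> h s \<partial>halfline) \<longlongrightarrow> 0) (at_right 0)" by simp
  have bound: "AE s in halfline. ennreal (norm ((?T h f s - f s) /\<^sub>R h - (z s + \<beta> s))) \<le> \<Psi> h s" if h: "0 < h" for h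
  proof -
    have "AE s in halfline. h \<le> s \<longrightarrow> f (s - h) = E.mild g1 (s - h) - E.mild g2 (s - h)"
      using rep h by (intro AE_halfline_unshift[where d = h]) simp_all
    then show ?thesis
      using AE_space
    proof eventually_elim
      case (elim s)
      let ?w = "(?T h f s - evolution_semigroup U h f s) /\<^sub>R h - \<beta> s"
      have w: "ennreal (norm ?w) \<le> \<rho> h s"
      proof (cases "h \<le> s")
        case True
        let ?r = "s - h"
        let ?e = "\<lambda>g. (Dyson_series U B s ?r (E.mild g ?r) - U s ?r (E.mild g ?r)) /\<^sub>R h - B s (E.mild g s)"
        have r: "0 \<le> ?r" "?r \<le> s" using True h by auto
        interpret L: bounded_linear "U s ?r" by (rule linear[OF r])
        have e: "ennreal (norm (?e g1)) \<le> slope_error g1 h ?r" "ennreal (norm (?e g2)) \<le> slope_error g2 h ?r"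
          using slope_error_bound[OF g1 r(1) h] slope_error_bound[OF g2 r(1) h] by simp_all
        have fr: "f ?r = E.mild g1 ?r - E.mild g2 ?r" using elim(1) True by simp
        have "?w = (Dyson_series U B s ?r (f ?r) - U s ?r (f ?r)) /\<^sub>R h - \<beta> s"
          using True by (simp add: evolution_semigroup_def)
        also have "\<dots> = ?e g1 + - ?e g2"
          unfolding fr Dyson_diff[OF r] L.diff \<beta>_def by (simp add: algebra_simps)
        finally have "ennreal (norm ?w) \<le> ennreal (norm (?e g1)) + ennreal (norm (- ?e g2))"
          by (simp only: ennreal_norm_triangle)
        also have "\<dots> \<le> slope_error g1 h ?r + slope_error g2 h ?r"
          unfolding norm_minus_cancel by (rule add_mono[OF e])
        also have "\<dots> \<le> \<rho> h s" using True by (simp add: \<rho>_def)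
        finally show ?thesis .
      next
        case False
        then show ?thesis using elim(2) by (simp add: \<rho>_def evolution_semigroup_def)
      qed
      have eq: "(?T h f s - f s) /\<^sub>R h - (z s + \<beta> s) = ?q h s + ?w" by (simp add: algebra_simps)
      have "ennreal (norm (?q h s + ?w)) \<le> ennreal (norm (?q h s)) + ennreal (norm ?w)"
        by (rule ennreal_norm_triangle)
      also have "\<dots> \<le> \<Psi> h s" unfolding \<Psi>_def by (rule add_left_mono[OF w])
      finally show ?case unfolding eq .
    qed
  qed
  have genT: "is_generator_value ?T f (\<lambda>s. z s + \<beta> s)"
    unfolding is_generator_value_def
  proof (intro conjI f L1_add z \<beta>)
    show "((\<lambda>h. L1_norm (\<lambda>s. (?T h f s - f s) /\<^sub>R h - (z s + \<beta> s))) \<longlongrightarrow> 0) (at_right 0)"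
    proof (rule ennreal_tendsto_zero_mono[OF lim\<Psi>])
      show "\<forall>\<^sub>F h in at_right 0. L1_norm (\<lambda>s. (?T h f s - f s) /\<^sub>R h - (z s + \<beta> s)) \<le> (\<integral>\<^sup>+s. \<Psi> h s \<partial>halfline)"
        using eventually_at_right_less
        by eventually_elim (unfold L1_norm_def, rule nn_integral_mono_AE, rule bound)
    qed
  qed
  have "is_generator_value ?T f (generator ?T f)"
    unfolding generator_def by (rule someI[of "is_generator_value ?T f", OF genT])
  then have G: "AE s in halfline. generator ?T f s = z s + \<beta> s"
    by (intro L1_limit_unique_dominated[where Q = "\<lambda>h s. (?T h f s - f s) /\<^sub>R h" and \<Psi> = \<Psi>] \<Psi>m bound lim\<Psi>
        strongly_measurable_add zm \<beta>m) (simp_all add: is_generator_value_def L1_strongly_measurable)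
  have "is_generator_value (evolution_semigroup U) f (generator (evolution_semigroup U) f)"
    unfolding generator_def by (rule someI[of "is_generator_value (evolution_semigroup U) f", OF gen])
  then have Z: "AE s in halfline. generator (evolution_semigroup U) f s = z s"
    by (intro L1_limit_unique_dominated[where Q = "\<lambda>h s. (evolution_semigroup U h f s - f s) /\<^sub>R h"
          and \<Psi> = "\<lambda>h s. ennreal (norm (?q h s))"] qm zm)
      (use lim in \<open>simp_all add: is_generator_value_def L1_strongly_measurable L1_norm_def\<close>)
  show "AE s in halfline. B_hat U B f s = B s (f s)"
    using G Z D\<beta> by eventually_elim (simp add: B_hat_def)
qed

end

theorem proposition4p3:
  fixes U :: "real \<Rightarrow> real \<Rightarrow> 'a \<Rightarrow> 'a::{banach, ordered_real_vector}"
    and B :: "real \<Rightarrow> 'a \<Rightarrow> 'a"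
    and D :: "real \<Rightarrow> 'a set"
  assumes cone_closed: "closed {u::'a. 0 \<le> u}"
    and cone_generating: "\<And>u::'a. \<exists>v w. 0 \<le> v \<and> 0 \<le> w \<and> u = v - w"
    and norm_additive: "\<And>u v::'a. 0 \<le> u \<Longrightarrow> 0 \<le> v \<Longrightarrow> norm (u + v) = norm u + norm v"
    and evolution: "evolution_family U"
    and B_linear: "\<And>t. 0 \<le> t \<Longrightarrow> linear_on_domain (D t) (B t)"
    and U_positive: "\<And>t s u. 0 \<le> s \<Longrightarrow> s \<le> t \<Longrightarrow> 0 \<le> u \<Longrightarrow> 0 \<le> U t s u"
    and U_contractive: "\<And>t s u. 0 \<le> s \<Longrightarrow> s \<le> t \<Longrightarrow> 0 \<le> u \<Longrightarrow> norm (U t s u) \<le> norm u"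
    and B_positive: "\<And>t u. 0 \<le> t \<Longrightarrow> u \<in> D t \<Longrightarrow> 0 \<le> u \<Longrightarrow> 0 \<le> B t u"
    and BU_defined: "\<And>s u. 0 \<le> s \<Longrightarrow> AE t in lebesgue_on {s..}. U t s u \<in> D t"
    and BU_measurable:
      "\<And>s u. 0 \<le> s \<Longrightarrow> strongly_measurable (lebesgue_on {s..}) (\<lambda>t. B t (U t s u))"
    and BU_integral:
      "\<And>t s u. 0 \<le> s \<Longrightarrow> s \<le> t \<Longrightarrow> 0 \<le> u \<Longrightarrow>
         (\<integral>\<^sup>+\<tau>. ennreal (norm (B \<tau> (U \<tau> s u))) \<partial>lebesgue_on {s..t})
           \<le> ennreal (norm u - norm (U t s u))"
    and BUf_defined:
      "\<And>f. f \<in> L1 \<Longrightarrow> AE (t, s) in lebesgue_on Delta. U t s (f s) \<in> D t"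
    and BUf_measurable:
      "\<And>f. f \<in> L1 \<Longrightarrow>
         strongly_measurable (lebesgue_on Delta) (\<lambda>(t, s). B t (U t s (f s)))"
    and B_increasingly_closed: "\<And>t. 0 \<le> t \<Longrightarrow> increasingly_closed (D t) (B t)"
  shows "(\<forall>f \<in> Z_domain U.
            (AE t in lebesgue_on {0..}. f t \<in> D t) \<and>
            (AE t in lebesgue_on {0..}. B_hat U B f t = B t (f t))) \<and>
         Z_domain U \<subseteq> mult_domain D B \<and>
         (\<forall>f \<in> Z_domain U. L1_eq (B_hat U B f) (mult_op B f))"
proof -
  obtain K where K: "1 \<le> K"
    "\<forall>u::'a. \<exists>v w. 0 \<le> v \<and> 0 \<le> w \<and> u = v - w \<and> norm v \<le> K * norm u \<and> norm w \<le> K * norm u"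
    using cone_decomposition[OF cone_closed cone_generating] by (elim exE conjE)
  interpret positive_perturbation U B D K
    by (rule positive_perturbation.intro[OF cone_closed norm_additive evolution B_linear U_positive
          U_contractive B_positive BU_defined BU_measurable BU_integral BUf_defined BUf_measurable
          B_increasingly_closed K(1) K(2)[rule_format]])
  have main: "(AE s in halfline. f s \<in> D s) \<and> mult_op B f \<in> L1 \<and> (AE s in halfline. B_hat U B f s = B s (f s)) \<and> f \<in> L1"
    if f: "f \<in> Z_domain U" for f
  proof -
    obtain z where z: "is_generator_value (evolution_semigroup U) f z"
      using f by (auto simp: generator_domain_def)
    then show ?thesis using generator_perturbed[OF z] by (simp add: is_generator_value_def)
  qed
  have "f \<in> mult_domain D B" if f: "f \<in> Z_domain U" for f
  proof -
    have "AE s in lebesgue. 0 \<le> s \<longrightarrow> f s \<in> D s"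
      using main[OF f] by (simp add: AE_halfline_iff)
    then have "AE s in lebesgue. s \<in> {0<..} \<longrightarrow> f s \<in> D s"
      by eventually_elim simp
    then have "AE s in lebesgue_on {0<..}. f s \<in> D s"
      by (simp add: AE_restrict_space_iff)
    then show ?thesis using main[OF f] by (simp add: mult_domain_def)
  qed
  then show ?thesis
    using main by (auto simp: L1_eq_def mult_op_def)
qed

end
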